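(* Let $n\ge2$ and let $U=\{U(t),t\in[0,T]\}$ be the unique strong solution of the $(n-1)$-dimensional stochastic differential equation $$dU(t)+A_n^2U(t)\,dt=A_nF_n(U(t))\,dt+\sqrt{n/\pi}\,\Sigma_n(U(t))\,d\beta_t,\qquad U(0)=(u_0(h),\dots,u_0((n-1)h))^\top,$$ with $h=\pi/n$ and the notation of the context. Let $\sigma$ be continuously differentiable with $\sigma(x)\ne0$ for any $x\in\mathbb R$. Then for any $t\in(0,T]$ the law of $U(t)$ is absolutely continuous with respect to the Lebesgue measure on $\mathbb R^{n-1}$.
   Context: $T>0$; $f(x)=x^3-x$; $\sigma:\mathbb R\to\mathbb R$ is bounded and globally Lipschitz; $u_0:(0,\pi)\to\mathbb R$ is nonrandom and continuous. $A_n\in\mathbb R^{(n-1)\times(n-1)}$ is $\frac{n^2}{\pi^2}$ times the tridiagonal matrix with $-2$ on the diagonal and $1$ on the two off-diagonals. For $a\in\mathbb R^{n-1}$, $F_n(a)=(f(a_1),\dots,f(a_{n-1}))^\top$ and $\Sigma_n(a)=\mathrm{diag}(\sigma(a_1),\dots,\sigma(a_{n-1}))$. $\beta_t=(\beta_t^1,\dots,\beta_t^{n-1})^\top$, $\beta^k_t=\sqrt{n/\pi}\,(W(t,(k+1)h)-W(t,kh))$, where $W$ is a Brownian sheet on $[0,T]\times(0,\pi)$ on a complete filtered probability space; thus $\beta$ is a standard $(n-1)$-dimensional Brownian motion. *)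

theory Defs
  imports "HOL-Probability.Probability"
begin

section \<open>Filtered probability spaces\<close>

locale complete_filtered_prob_space = prob_space M + complete_measure M
  for M :: "'a measure" +
  fixes F :: "real \<Rightarrow> 'a measure" and T :: real
  assumes subalgebra_F: "t \<in> {0..T} \<Longrightarrow> subalgebra M (F t)"
    and F_mono: "\<lbrakk>0 \<le> s; s \<le> t; t \<le> T\<rbrakk> \<Longrightarrow> sets (F s) \<subseteq> sets (F t)"
    and null_sets_F: "null_sets M \<subseteq> sets (F 0)"


section \<open>Brownian sheet\<close>

text \<open>Degenerate centred Gaussian variables are allowed: \<^const>\<open>normal_density\<close> only makes sense for
  a positive standard deviation, so variance 0 is treated separately.\<close>

definition centered_gaussian :: "'a measure \<Rightarrow> ('a \<Rightarrow> real) \<Rightarrow> real \<Rightarrow> bool" where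
  "centered_gaussian M X v \<longleftrightarrow>
     (if v = 0 then X \<in> borel_measurable M \<and> (AE \<omega> in M. X \<omega> = 0)
      else v > 0 \<and> distributed M lborel X (normal_density 0 (sqrt v)))"

text \<open>Brownian sheet \<open>W t x\<close> on \<open>[0,T] \<times> [0,L]\<close> with respect to the filtration \<open>F\<close> (in the time
  variable). That the finite-dimensional laws are Gaussian with covariance
  \<open>min s t * min x y\<close> is expressed through all finite linear combinations.\<close>

definition brownian_sheet ::
  "'a measure \<Rightarrow> (real \<Rightarrow> 'a measure) \<Rightarrow> real \<Rightarrow> real \<Rightarrow> (real \<Rightarrow> real \<Rightarrow> 'a \<Rightarrow> real) \<Rightarrow> bool" where
  "brownian_sheet M F T L W \<longleftrightarrow>
     (\<forall>t\<in>{0..T}. \<forall>x\<in>{0..L}. W t x \<in> borel_measurable (F t)) \<and>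
     (\<forall>J c. finite J \<longrightarrow> J \<subseteq> {0..T} \<times> {0..L} \<longrightarrow>
        centered_gaussian M (\<lambda>\<omega>. \<Sum>(t, x)\<in>J. c (t, x) * W t x \<omega>)
          (\<Sum>(s, x)\<in>J. \<Sum>(t, y)\<in>J. c (s, x) * c (t, y) * (min s t * min x y))) \<and>
     (\<forall>s t. 0 \<le> s \<longrightarrow> s \<le> t \<longrightarrow> t \<le> T \<longrightarrow>
        prob_space.indep_set M (sets (F s))
          (sigma_sets (space M)
             {(\<lambda>\<omega>. W t x \<omega> - W s x \<omega>) -` B \<inter> space M | x B. x \<in> {0..L} \<and> B \<in> sets borel})) \<and>
     (AE \<omega> in M. continuous_on ({0..T} \<times> {0..L}) (\<lambda>(t, x). W t x \<omega>))"


section \<open>The It\^o integral\<close>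

definition progressively_measurable ::
  "(real \<Rightarrow> 'a measure) \<Rightarrow> real \<Rightarrow> (real \<Rightarrow> 'a \<Rightarrow> real) \<Rightarrow> bool" where
  "progressively_measurable F t X \<longleftrightarrow>
     (\<forall>r\<in>{0..t}. (\<lambda>(s, \<omega>). X s \<omega>) \<in> borel_measurable (restrict_space borel {0..r} \<Otimes>\<^sub>M F r))"

text \<open>A simple integrand on \<open>[0,t]\<close> is given by a number of steps \<open>m\<close>, a partition
  \<open>0 = p 0 \<le> \<dots> \<le> p m = t\<close> and bounded, \<open>F (p i)\<close>-measurable values \<open>\<xi> i\<close> on \<open>(p i, p (i + 1)]\<close>.\<close>

definition simple_integrand ::
  "(real \<Rightarrow> 'a measure) \<Rightarrow> real \<Rightarrow> nat \<Rightarrow> (nat \<Rightarrow> real) \<Rightarrow> (nat \<Rightarrow> 'a \<Rightarrow> real) \<Rightarrow> bool" where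
  "simple_integrand F t m p \<xi> \<longleftrightarrow>
     p 0 = 0 \<and> p m = t \<and> mono_on {0..m} p \<and>
     (\<forall>i<m. \<xi> i \<in> borel_measurable (F (p i)) \<and> (\<exists>C. \<forall>\<omega>\<in>space (F (p i)). \<bar>\<xi> i \<omega>\<bar> \<le> C))"

definition simple_process ::
  "nat \<Rightarrow> (nat \<Rightarrow> real) \<Rightarrow> (nat \<Rightarrow> 'a \<Rightarrow> real) \<Rightarrow> real \<Rightarrow> 'a \<Rightarrow> real" where
  "simple_process m p \<xi> s \<omega> = (\<Sum>i<m. \<xi> i \<omega> * indicator {p i<..p (Suc i)} s)"

definition simple_ito ::
  "(real \<Rightarrow> 'a \<Rightarrow> real) \<Rightarrow> nat \<Rightarrow> (nat \<Rightarrow> real) \<Rightarrow> (nat \<Rightarrow> 'a \<Rightarrow> real) \<Rightarrow> 'a \<Rightarrow> real" where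
  "simple_ito B m p \<xi> \<omega> = (\<Sum>i<m. \<xi> i \<omega> * (B (p (Suc i)) \<omega> - B (p i) \<omega>))"

definition tendsto_zero_in_prob :: "'a measure \<Rightarrow> (nat \<Rightarrow> 'a \<Rightarrow> ennreal) \<Rightarrow> bool" where
  "tendsto_zero_in_prob M D \<longleftrightarrow>
     (\<forall>\<epsilon>::real. \<epsilon> > 0 \<longrightarrow> (\<lambda>k. measure M {\<omega> \<in> space M. ennreal \<epsilon> < D k \<omega>}) \<longlonglongrightarrow> 0)"

text \<open>\<open>Y\<close> is (a version of) the It\^o integral of \<open>X\<close> with respect to the Brownian motion \<open>B\<close> over
  \<open>[0,t]\<close>: \<open>X\<close> is progressively measurable with almost surely square integrable paths, and \<open>Y\<close> is
  the limit in probability of the elementary integrals of simple integrands that approximate \<open>X\<close>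
  in probability in \<open>L\<^sup>2[0,t]\<close>.\<close>

definition has_ito_integral ::
  "'a measure \<Rightarrow> (real \<Rightarrow> 'a measure) \<Rightarrow> (real \<Rightarrow> 'a \<Rightarrow> real) \<Rightarrow> real \<Rightarrow>
   (real \<Rightarrow> 'a \<Rightarrow> real) \<Rightarrow> ('a \<Rightarrow> real) \<Rightarrow> bool" where
  "has_ito_integral M F B t X Y \<longleftrightarrow>
     progressively_measurable F t X \<and>
     (AE \<omega> in M. (\<integral>\<^sup>+s\<in>{0..t}. ennreal ((X s \<omega>)\<^sup>2) \<partial>lborel) < \<infinity>) \<and>
     Y \<in> borel_measurable M \<and>
     (\<exists>m p \<xi>. (\<forall>k. simple_integrand F t (m k) (p k) (\<xi> k)) \<and>
        tendsto_zero_in_prob M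
          (\<lambda>k \<omega>. \<integral>\<^sup>+s\<in>{0..t}. ennreal ((simple_process (m k) (p k) (\<xi> k) s \<omega> - X s \<omega>)\<^sup>2) \<partial>lborel) \<and>
        tendsto_zero_in_prob M
          (\<lambda>k \<omega>. ennreal \<bar>simple_ito B (m k) (p k) (\<xi> k) \<omega> - Y \<omega>\<bar>))"


section \<open>Stochastic differential equations\<close>

text \<open>Since the dimension is a variable, vectors in \<open>\<real>\<^sup>d\<close> and \<open>d \<times> d\<close> matrices are
  functions on \<^typ>\<open>nat\<close> of which only the values at the indices \<open>1, \<dots>, d\<close> matter.

  \<open>X\<close> is a strong solution on \<open>[0,T]\<close>, on the given filtered space and for the given driving
  Brownian motion \<open>B\<close>, of
  \<open>dX(t) = b(X(t)) dt + S(X(t)) dB(t), X(0) = x\<^sub>0\<close>.\<close>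

definition strong_solution ::
  "'a measure \<Rightarrow> (real \<Rightarrow> 'a measure) \<Rightarrow> real \<Rightarrow> nat \<Rightarrow>
   ((nat \<Rightarrow> real) \<Rightarrow> nat \<Rightarrow> real) \<Rightarrow> ((nat \<Rightarrow> real) \<Rightarrow> nat \<Rightarrow> nat \<Rightarrow> real) \<Rightarrow>
   (nat \<Rightarrow> real \<Rightarrow> 'a \<Rightarrow> real) \<Rightarrow> (nat \<Rightarrow> real) \<Rightarrow> (real \<Rightarrow> 'a \<Rightarrow> nat \<Rightarrow> real) \<Rightarrow> bool" where
  "strong_solution M F T d b S B x\<^sub>0 X \<longleftrightarrow>
     (\<forall>t\<in>{0..T}. \<forall>i\<in>{1..d}. (\<lambda>\<omega>. X t \<omega> i) \<in> borel_measurable (F t)) \<and>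
     (AE \<omega> in M. \<forall>i\<in>{1..d}. continuous_on {0..T} (\<lambda>t. X t \<omega> i)) \<and>
     (AE \<omega> in M. \<forall>i\<in>{1..d}. X 0 \<omega> i = x\<^sub>0 i) \<and>
     (AE \<omega> in M. \<forall>i\<in>{1..d}. set_integrable lborel {0..T} (\<lambda>s. b (X s \<omega>) i)) \<and>
     (\<forall>t\<in>{0..T}. \<exists>I.
        (\<forall>i\<in>{1..d}. \<forall>j\<in>{1..d}. has_ito_integral M F (B j) t (\<lambda>s \<omega>. S (X s \<omega>) i j) (I i j)) \<and>
        (AE \<omega> in M. \<forall>i\<in>{1..d}.
           X t \<omega> i = x\<^sub>0 i + (LINT s:{0..t}|lborel. b (X s \<omega>) i) + (\<Sum>j\<in>{1..d}. I i j \<omega>)))"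


section \<open>The spatial finite difference method\<close>

definition mat_vec :: "nat \<Rightarrow> (nat \<Rightarrow> nat \<Rightarrow> real) \<Rightarrow> (nat \<Rightarrow> real) \<Rightarrow> nat \<Rightarrow> real" where
  "mat_vec d A v i = (\<Sum>j\<in>{1..d}. A i j * v j)"

definition mat_mult ::
  "nat \<Rightarrow> (nat \<Rightarrow> nat \<Rightarrow> real) \<Rightarrow> (nat \<Rightarrow> nat \<Rightarrow> real) \<Rightarrow> nat \<Rightarrow> nat \<Rightarrow> real" where
  "mat_mult d A B i j = (\<Sum>l\<in>{1..d}. A i l * B l j)"

definition A_mat :: "nat \<Rightarrow> nat \<Rightarrow> nat \<Rightarrow> real" where
  "A_mat n i j = (real n)\<^sup>2 / pi\<^sup>2 *
     (if i = j then - 2 else if i = Suc j \<or> j = Suc i then 1 else 0)"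

definition f_nl :: "real \<Rightarrow> real" where
  "f_nl x = x ^ 3 - x"

definition F_vec :: "(nat \<Rightarrow> real) \<Rightarrow> nat \<Rightarrow> real" where
  "F_vec a i = f_nl (a i)"

definition Sigma_mat :: "(real \<Rightarrow> real) \<Rightarrow> (nat \<Rightarrow> real) \<Rightarrow> nat \<Rightarrow> nat \<Rightarrow> real" where
  "Sigma_mat \<sigma> a i j = (if i = j then \<sigma> (a i) else 0)"

definition drift :: "nat \<Rightarrow> (nat \<Rightarrow> real) \<Rightarrow> nat \<Rightarrow> real" where
  "drift n a i =
     - mat_vec (n - 1) (mat_mult (n - 1) (A_mat n) (A_mat n)) a i
     + mat_vec (n - 1) (A_mat n) (F_vec a) i"

definition diffusion :: "nat \<Rightarrow> (real \<Rightarrow> real) \<Rightarrow> (nat \<Rightarrow> real) \<Rightarrow> nat \<Rightarrow> nat \<Rightarrow> real" where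
  "diffusion n \<sigma> a i j = sqrt (real n / pi) * Sigma_mat \<sigma> a i j"

definition mesh :: "nat \<Rightarrow> real" where
  "mesh n = pi / real n"

definition noise :: "nat \<Rightarrow> (real \<Rightarrow> real \<Rightarrow> 'a \<Rightarrow> real) \<Rightarrow> nat \<Rightarrow> real \<Rightarrow> 'a \<Rightarrow> real" where
  "noise n W k t \<omega> =
     sqrt (real n / pi) * (W t ((real k + 1) * mesh n) \<omega> - W t (real k * mesh n) \<omega>)"

end

theory Submission
  imports Defs
begin

text \<open>
  Freeze the diffusion coefficient at time \<open>r = t - \<epsilon>\<close>: given the past up to \<open>r\<close>, the solution at time \<open>t\<close>
  is close to a Gaussian vector with mean \<open>U(r)\<close> and variance of order \<open>\<epsilon>\<close>, and the law \<open>\<mu>\<^sub>\<epsilon>\<close> of that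
  vector has a density. Passing from \<open>\<epsilon>\<close> to a fixed fraction \<open>\<epsilon>'\<close> of \<open>\<epsilon>\<close> moves the mean, outside an
  event of small probability, by an error that is small against the
  standard deviation, and changes the variance by a factor close to 1. A Gaussian density is
  dominated, up to a factor close to 1, by one with a slightly shifted mean and a slightly larger
  variance; hence \<open>\<mu>\<^bsub>\<epsilon>'\<^esub>(A) \<le> \<mu>\<^sub>\<epsilon>(A) + O(\<epsilon>\<^sup>\<kappa>)\<close> uniformly in \<open>A\<close>. Summing over a geometric sequence
  of scales and using lower semicontinuity for open \<open>A\<close> gives \<open>P(U(t) \<in> A) \<le> \<mu>\<^sub>\<epsilon>(A) + O(\<epsilon>\<^sup>\<kappa>)\<close>, and outer
  regularity of \<open>\<mu>\<^sub>\<epsilon>\<close> extends this to Lebesgue null sets, for which the first term vanishes.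

  The drift is only locally bounded, so \<open>\<mu>\<^sub>\<epsilon>\<close> is restricted to the event that \<open>U\<close> has stayed
  in a ball up to time \<open>r\<close>. This event shrinks as \<open>\<epsilon>\<close> decreases, which is harmless because only
  one-sided inequalities are needed.
\<close>

section \<open>Products of one-dimensional Gaussian laws\<close>

text \<open>The Ito integral is given only through limits in probability, so its increments are
  controlled by tail bounds, and the second moment of a coefficient increment over time h comes out
  of order h^(1/2) instead of h. This fixes the exponents. Put \<epsilon> = x^8, so that a standard
  deviation is of order x^4. The squared coefficient error is then x^4 on average and its time
  integral x^12. This integral exceeds x^11 with probability of order x; otherwise the mean moves by
  at most x^5, up to a further event of probability of order x. The exponential price of moving the
  mean is the squared shift over the surplus of variance, so the surplus must dominate x^10; it is
  taken of order x^9, that is \<epsilon> times x. Every loss is thus of order x, so \<kappa> = 1/8,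
  and halving x gives \<epsilon>' = \<epsilon>/256. Because the noise is diagonal, all Gaussian laws
  are products and every comparison of densities is one-dimensional.\<close>

definition gauss_prod :: "'i set \<Rightarrow> ('i \<Rightarrow> real) \<Rightarrow> ('i \<Rightarrow> real) \<Rightarrow> ('i \<Rightarrow> real) set \<Rightarrow> ennreal" where
  "gauss_prod I m s A =
     (\<integral>\<^sup>+f. (\<Prod>i\<in>I. ennreal (normal_density (m i) (s i) (f i))) * indicator A f \<partial>(\<Pi>\<^sub>M i\<in>I. lborel))"

lemma product_sigma_finite_lborel: "product_sigma_finite (\<lambda>_. lborel :: real measure)"
  by (simp add: product_sigma_finite_def sigma_finite_lborel)

lemma sets_PiM_lborel: "sets (\<Pi>\<^sub>M i\<in>I. (lborel :: real measure)) = sets (\<Pi>\<^sub>M i\<in>I. borel)"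
  by (intro sets_PiM_cong) auto

lemma borel_measurable_normal_density_compose [measurable]:
  assumes [measurable]: "f \<in> borel_measurable N" "g \<in> borel_measurable N" "h \<in> borel_measurable N"
  shows "(\<lambda>x. normal_density (f x) (g x) (h x)) \<in> borel_measurable N"
  unfolding normal_density_def by measurable

text \<open>Mean and deviation will be random, which is why \<open>gauss_prod\<close> is a
  parametrised integral and not a measure: joint measurability of the integrand yields measurability
  in the parameters.\<close>

lemma gauss_prod_measurable:
  fixes m s :: "'a \<Rightarrow> 'i \<Rightarrow> real"
  assumes "finite I" and [measurable]: "\<And>i. i \<in> I \<Longrightarrow> (\<lambda>\<omega>. m \<omega> i) \<in> borel_measurable N"
    "\<And>i. i \<in> I \<Longrightarrow> (\<lambda>\<omega>. s \<omega> i) \<in> borel_measurable N"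
    and A: "A \<in> sets (\<Pi>\<^sub>M i\<in>I. borel)"
  shows "(\<lambda>\<omega>. gauss_prod I (m \<omega>) (s \<omega>) A) \<in> borel_measurable N"
proof -
  interpret product_sigma_finite "\<lambda>_::'i. lborel :: real measure"
    by (rule product_sigma_finite_lborel)
  interpret sigma_finite_measure "\<Pi>\<^sub>M i\<in>I. (lborel :: real measure)"
    using assms(1) by (rule sigma_finite)
  have [measurable]: "A \<in> sets (\<Pi>\<^sub>M i\<in>I. (lborel :: real measure))"
    using A by (simp only: sets_PiM_lborel)
  have [measurable]: "i \<in> I \<Longrightarrow> (\<lambda>x. snd x i) \<in> borel_measurable (N \<Otimes>\<^sub>M (\<Pi>\<^sub>M i\<in>I. (lborel :: real measure)))" for i
    by measurable
  show ?thesis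
    unfolding gauss_prod_def by measurable
qed

lemma gauss_prod_Pi:
  assumes I: "finite I" and B: "\<And>i. i \<in> I \<Longrightarrow> B i \<in> sets borel"
  shows "gauss_prod I m s (Pi\<^sub>E I B) =
    (\<Prod>i\<in>I. \<integral>\<^sup>+z. ennreal (normal_density (m i) (s i) z) * indicator (B i) z \<partial>lborel)"
proof -
  interpret product_sigma_finite "\<lambda>_::'a. lborel :: real measure"
    by (rule product_sigma_finite_lborel)
  have "gauss_prod I m s (Pi\<^sub>E I B) =
    (\<integral>\<^sup>+f. (\<Prod>i\<in>I. ennreal (normal_density (m i) (s i) (f i)) * indicator (B i) (f i)) \<partial>(\<Pi>\<^sub>M i\<in>I. lborel))"
    unfolding gauss_prod_def
  proof (intro nn_integral_cong)
    fix f :: "'a \<Rightarrow> real" assume "f \<in> space (\<Pi>\<^sub>M i\<in>I. lborel)"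
    then have f: "f \<in> extensional I" by (auto simp: space_PiM PiE_def)
    have "indicator (Pi\<^sub>E I B) f = (\<Prod>i\<in>I. indicator (B i) (f i) :: ennreal)"
    proof (cases "f \<in> Pi\<^sub>E I B")
      case False
      then obtain i where "i \<in> I" "f i \<notin> B i" using f by (auto simp: PiE_def)
      with False I show ?thesis by (auto simp: prod_zero_iff intro!: bexI[of _ i])
    qed (auto simp: PiE_mem intro!: prod.neutral[symmetric])
    then show "(\<Prod>i\<in>I. ennreal (normal_density (m i) (s i) (f i))) * indicator (Pi\<^sub>E I B) f =
      (\<Prod>i\<in>I. ennreal (normal_density (m i) (s i) (f i)) * indicator (B i) (f i))"
      by (simp add: prod.distrib)
  qed
  also have "\<dots> = (\<Prod>i\<in>I. \<integral>\<^sup>+z. ennreal (normal_density (m i) (s i) z) * indicator (B i) z \<partial>lborel)"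
    using B I by (intro product_nn_integral_prod) auto
  finally show ?thesis .
qed

lemma nn_integral_normal_density:
  assumes "0 < s" shows "(\<integral>\<^sup>+z. ennreal (normal_density m s z) \<partial>lborel) = 1"
  using assms by (simp add: nn_integral_eq_integral)

lemma gauss_prod_le_1:
  assumes I: "finite I" and s: "\<And>i. i \<in> I \<Longrightarrow> 0 < s i"
  shows "gauss_prod I m s A \<le> 1"
proof -
  have "gauss_prod I m s A \<le> gauss_prod I m s (Pi\<^sub>E I (\<lambda>_. UNIV))"
    unfolding gauss_prod_def
    by (intro nn_integral_mono mult_left_mono) (auto simp: space_PiM split: split_indicator)
  also have "\<dots> = 1"
    using I s by (subst gauss_prod_Pi) (auto simp: nn_integral_normal_density)
  finally show ?thesis .
qed

lemma gauss_prod_null: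
  assumes "finite I" "A \<in> null_sets (\<Pi>\<^sub>M i\<in>I. lborel)"
  shows "gauss_prod I m s A = 0"
proof -
  have "AE f in (\<Pi>\<^sub>M i\<in>I. lborel). (\<Prod>i\<in>I. ennreal (normal_density (m i) (s i) (f i))) * indicator A f = 0"
    using AE_not_in[OF assms(2)] by eventually_elim auto
  then show ?thesis
    unfolding gauss_prod_def by (subst nn_integral_cong_AE[where v = "\<lambda>_. 0"]) auto
qed

text \<open>The square completed is \<open>((b - a) u - a w)\<^sup>2 \<ge> 0\<close> with \<open>u = z - m\<close> and \<open>w = m - m'\<close>.\<close>

lemma normal_density_le_wider:
  assumes "0 < a" "a < b"
  shows "normal_density m (sqrt a) z \<le>
    sqrt (b / a) * exp ((m - m')\<^sup>2 / (2 * (b - a))) * normal_density m' (sqrt b) z"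
proof -
  define u w where "u = z - m" and "w = m - m'"
  have "a * (b - a) * (u + w)\<^sup>2 \<le> b * (b - a) * u\<^sup>2 + a * b * w\<^sup>2"
  proof -
    have "0 \<le> ((b - a) * u - a * w)\<^sup>2" by simp
    then show ?thesis by (simp add: power2_eq_square algebra_simps)
  qed
  then have "(u + w)\<^sup>2 / b \<le> u\<^sup>2 / a + w\<^sup>2 / (b - a)"
    using assms by (simp add: field_simps)
  then have "- u\<^sup>2 / (2 * a) \<le> w\<^sup>2 / (2 * (b - a)) + - (u + w)\<^sup>2 / (2 * b)"
    using assms by (simp add: divide_simps) (simp add: algebra_simps)
  then have e: "exp (- u\<^sup>2 / (2 * a)) \<le> exp (w\<^sup>2 / (2 * (b - a))) * exp (- (u + w)\<^sup>2 / (2 * b))"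
    by (subst exp_add[symmetric]) simp
  have "normal_density m (sqrt a) z = (1 / sqrt (2 * pi * a)) * exp (- u\<^sup>2 / (2 * a))"
    using assms by (simp add: normal_density_def u_def)
  also have "\<dots> \<le> (1 / sqrt (2 * pi * a)) * (exp (w\<^sup>2 / (2 * (b - a))) * exp (- (u + w)\<^sup>2 / (2 * b)))"
    using e assms by (intro mult_left_mono) auto
  also have "1 / sqrt (2 * pi * a) = sqrt (b / a) * (1 / sqrt (2 * pi * b))"
    using assms by (simp add: real_sqrt_mult real_sqrt_divide)
  also have "\<dots> * (exp (w\<^sup>2 / (2 * (b - a))) * exp (- (u + w)\<^sup>2 / (2 * b))) =
      sqrt (b / a) * exp ((m - m')\<^sup>2 / (2 * (b - a))) * normal_density m' (sqrt b) z"
    using assms by (simp add: normal_density_def u_def w_def)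
  finally show ?thesis .
qed

text \<open>Coordinatewise domination of the densities multiplies up. The exponent in the hypothesis
  on \<open>c\<close> is the price of moving the mean: the squared shift over twice the surplus of
  variance.\<close>

lemma gauss_prod_le_wider:
  fixes c :: real
  assumes I: "finite I" and s: "\<And>i. i \<in> I \<Longrightarrow> 0 < s i" "\<And>i. i \<in> I \<Longrightarrow> s i < s' i"
    and c: "\<And>i. i \<in> I \<Longrightarrow> s' i / s i * exp ((m i - m' i)\<^sup>2 / (2 * ((s' i)\<^sup>2 - (s i)\<^sup>2))) \<le> c" "0 \<le> c"
    and A: "A \<in> sets (\<Pi>\<^sub>M i\<in>I. borel)"
  shows "gauss_prod I m s A \<le> ennreal (c ^ card I) * gauss_prod I m' s' A"
proof -
  have A' [measurable]: "A \<in> sets (\<Pi>\<^sub>M i\<in>I. (lborel :: real measure))"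
    using A by (simp only: sets_PiM_lborel)
  have *: "normal_density (m i) (s i) z \<le> c * normal_density (m' i) (s' i) z" if "i \<in> I" for i z
  proof -
    have lt: "(s i)\<^sup>2 < (s' i)\<^sup>2" "0 < (s i)\<^sup>2" "0 < s' i"
      using s[OF that] by (auto intro!: power_strict_mono)
    have "sqrt ((s' i)\<^sup>2 / (s i)\<^sup>2) = s' i / s i"
      using s[OF that] by (simp add: real_sqrt_divide)
    then have "normal_density (m i) (s i) z \<le>
        s' i / s i * exp ((m i - m' i)\<^sup>2 / (2 * ((s' i)\<^sup>2 - (s i)\<^sup>2))) * normal_density (m' i) (s' i) z"
      using normal_density_le_wider[OF lt(2,1), of "m i" z "m' i"] s[OF that] lt by simp
    also have "\<dots> \<le> c * normal_density (m' i) (s' i) z"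
      using c(1)[OF that] by (intro mult_right_mono) auto
    finally show ?thesis .
  qed
  have "gauss_prod I m s A \<le>
    (\<integral>\<^sup>+f. ennreal (c ^ card I) * ((\<Prod>i\<in>I. ennreal (normal_density (m' i) (s' i) (f i))) * indicator A f) \<partial>(\<Pi>\<^sub>M i\<in>I. lborel))"
    unfolding gauss_prod_def
  proof (intro nn_integral_mono)
    fix f :: "'a \<Rightarrow> real"
    have "(\<Prod>i\<in>I. ennreal (normal_density (m i) (s i) (f i))) \<le> (\<Prod>i\<in>I. ennreal (c * normal_density (m' i) (s' i) (f i)))"
      using * by (intro prod_mono_ennreal ennreal_leI) auto
    also have "\<dots> = ennreal (c ^ card I) * (\<Prod>i\<in>I. ennreal (normal_density (m' i) (s' i) (f i)))"
      using c(2) by (simp add: ennreal_mult prod.distrib ennreal_power)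
    finally show "(\<Prod>i\<in>I. ennreal (normal_density (m i) (s i) (f i))) * indicator A f \<le>
      ennreal (c ^ card I) * ((\<Prod>i\<in>I. ennreal (normal_density (m' i) (s' i) (f i))) * indicator A f)"
      by (auto split: split_indicator)
  qed
  also have "\<dots> = ennreal (c ^ card I) * gauss_prod I m' s' A"
    unfolding gauss_prod_def by (intro nn_integral_cmult) measurable
  finally show ?thesis .
qed

section \<open>Convolution and concentration of Gaussian products\<close>

lemma normal_density_shift:
  "normal_density (m + D * w) s z = normal_density 0 s ((z - m) - D * w)"
  by (simp add: normal_density_def algebra_simps)

text \<open>For standard normal w, \<open>D * w\<close> has law N(0, D^2), so averaging over w
  convolves two Gaussians. The sign of \<open>D\<close> is free because a diffusion coefficient may
  be negative; the substitution y = D * w leaves only its absolute value.\<close>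

lemma nn_integral_normal_density_convolution:
  assumes s: "0 < s" and D: "D \<noteq> 0"
  shows "(\<integral>\<^sup>+w. ennreal (std_normal_density w) * ennreal (normal_density (m + D * w) s z) \<partial>lborel)
    = ennreal (normal_density m (sqrt (s\<^sup>2 + D\<^sup>2)) z)"
proof -
  have eq: "std_normal_density w = \<bar>D\<bar> * normal_density 0 \<bar>D\<bar> (D * w)" for w
    using D by (simp add: normal_density_def power_mult_distrib real_sqrt_mult)
  have "(\<integral>\<^sup>+w. ennreal (std_normal_density w) * ennreal (normal_density (m + D * w) s z) \<partial>lborel) =
    (\<integral>\<^sup>+w. ennreal \<bar>D\<bar> * ennreal (normal_density 0 s ((z - m) - (0 + D * w)) * normal_density 0 \<bar>D\<bar> (0 + D * w)) \<partial>lborel)"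
    by (intro nn_integral_cong)
       (simp only: eq normal_density_shift add_0, simp add: ennreal_mult[symmetric] ac_simps)
  also have "\<dots> = ennreal \<bar>D\<bar> * (\<integral>\<^sup>+w. ennreal (normal_density 0 s ((z - m) - (0 + D * w)) * normal_density 0 \<bar>D\<bar> (0 + D * w)) \<partial>lborel)"
    by (intro nn_integral_cmult) measurable
  also have "\<dots> = (\<integral>\<^sup>+y. ennreal (normal_density 0 s ((z - m) - y) * normal_density 0 \<bar>D\<bar> y) \<partial>lborel)"
    using D by (subst nn_integral_real_affine[of "\<lambda>y. ennreal (normal_density 0 s ((z - m) - y) * normal_density 0 \<bar>D\<bar> y)" D 0]) auto
  also have "\<dots> = ennreal (normal_density 0 (sqrt (s\<^sup>2 + \<bar>D\<bar>\<^sup>2)) (z - m))"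
    using conv_normal_density_zero_mean[OF s, of "\<bar>D\<bar>"] D by (simp add: fun_eq_iff)
  also have "\<dots> = ennreal (normal_density m (sqrt (s\<^sup>2 + D\<^sup>2)) z)"
    by (simp add: normal_density_def)
  finally show ?thesis .
qed

definition std_gauss :: "'i set \<Rightarrow> ('i \<Rightarrow> real) measure" where
  "std_gauss I = (\<Pi>\<^sub>M i\<in>I. density lborel std_normal_density)"

lemma sets_std_gauss [measurable_cong]: "sets (std_gauss I) = sets (\<Pi>\<^sub>M i\<in>I. borel)"
  unfolding std_gauss_def by (intro sets_PiM_cong) auto

lemma std_gauss_density:
  fixes I :: "'i set"
  assumes I: "finite I"
  shows "std_gauss I = density (\<Pi>\<^sub>M i\<in>I. lborel) (\<lambda>f. \<Prod>i\<in>I. ennreal (std_normal_density (f i)))"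
proof -
  interpret N: product_prob_space "\<lambda>_::'i. density lborel std_normal_density"
    by (simp add: product_prob_space_def product_prob_space_axioms_def product_sigma_finite_def
        prob_space_normal_density prob_space_imp_sigma_finite)
  interpret L: product_sigma_finite "\<lambda>_::'i. lborel :: real measure"
    by (rule product_sigma_finite_lborel)
  show ?thesis
    unfolding std_gauss_def
  proof (rule N.PiM_eqI[OF I, symmetric])
    fix A :: "'i \<Rightarrow> real set" assume A: "\<And>i. i \<in> I \<Longrightarrow> A i \<in> sets (density lborel std_normal_density)"
    then have A' [measurable]: "\<And>i. i \<in> I \<Longrightarrow> A i \<in> sets borel" by auto
    have [measurable]: "Pi\<^sub>E I A \<in> sets (\<Pi>\<^sub>M i\<in>I. (lborel :: real measure))"
      using I A by (intro sets_PiM_I_finite) auto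
    have "emeasure (density (\<Pi>\<^sub>M i\<in>I. lborel) (\<lambda>f. \<Prod>i\<in>I. ennreal (std_normal_density (f i)))) (Pi\<^sub>E I A)
      = gauss_prod I (\<lambda>_. 0) (\<lambda>_. 1) (Pi\<^sub>E I A)"
      unfolding gauss_prod_def by (subst emeasure_density) auto
    also have "\<dots> = (\<Prod>i\<in>I. emeasure (density lborel std_normal_density) (A i))"
      using I A by (subst gauss_prod_Pi) (auto simp: emeasure_density)
    finally show "emeasure (density (\<Pi>\<^sub>M i\<in>I. lborel) (\<lambda>f. \<Prod>i\<in>I. ennreal (std_normal_density (f i)))) (Pi\<^sub>E I A) =
      (\<Prod>i\<in>I. emeasure (density lborel std_normal_density) (A i))" .
  qed (auto intro!: sets_PiM_cong)
qed

text \<open>After Tonelli both integrands factor over the coordinates. This is the rule by which a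
  frozen Gaussian absorbs an independent Brownian increment: variances add.\<close>

lemma gauss_prod_convolution:
  fixes m s D :: "'i \<Rightarrow> real"
  assumes I: "finite I" and s: "\<And>i. i \<in> I \<Longrightarrow> 0 < s i" and D: "\<And>i. i \<in> I \<Longrightarrow> D i \<noteq> 0"
    and A: "A \<in> sets (\<Pi>\<^sub>M i\<in>I. borel)"
  shows "(\<integral>\<^sup>+w. gauss_prod I (\<lambda>i. m i + D i * w i) s A \<partial>std_gauss I) =
    gauss_prod I m (\<lambda>i. sqrt ((s i)\<^sup>2 + (D i)\<^sup>2)) A"
proof -
  interpret L: product_sigma_finite "\<lambda>_::'i. lborel :: real measure"
    by (rule product_sigma_finite_lborel)
  let ?P = "\<Pi>\<^sub>M i\<in>I. (lborel :: real measure)"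
  interpret S: sigma_finite_measure ?P using I by (rule L.sigma_finite)
  interpret P: pair_sigma_finite ?P ?P ..
  have [measurable]: "A \<in> sets ?P"
    using A by (simp only: sets_PiM_lborel)
  have c1 [measurable]: "i \<in> I \<Longrightarrow> (\<lambda>x. x i) \<in> borel_measurable ?P" for i by measurable
  have c2 [measurable]: "i \<in> I \<Longrightarrow> (\<lambda>x. fst x i) \<in> borel_measurable (?P \<Otimes>\<^sub>M ?P)"
     "i \<in> I \<Longrightarrow> (\<lambda>x. snd x i) \<in> borel_measurable (?P \<Otimes>\<^sub>M ?P)" for i by measurable
  have gm [measurable]: "(\<lambda>w. gauss_prod I (\<lambda>i. m i + D i * w i) s A) \<in> borel_measurable ?P"
    using I A by (intro gauss_prod_measurable) auto
  let ?p = "\<lambda>w f. (\<Prod>i\<in>I. ennreal (std_normal_density (w i)) * ennreal (normal_density (m i + D i * w i) (s i) (f i))) * indicator A f :: ennreal"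
  have "(\<integral>\<^sup>+w. gauss_prod I (\<lambda>i. m i + D i * w i) s A \<partial>std_gauss I) =
     (\<integral>\<^sup>+w. (\<Prod>i\<in>I. ennreal (std_normal_density (w i))) * gauss_prod I (\<lambda>i. m i + D i * w i) s A \<partial>?P)"
    unfolding std_gauss_density[OF I] by (subst nn_integral_density) auto
  also have "\<dots> = (\<integral>\<^sup>+w. \<integral>\<^sup>+f. ?p w f \<partial>?P \<partial>?P)"
    unfolding gauss_prod_def
    by (intro nn_integral_cong, subst nn_integral_cmult[symmetric])
       (auto simp: prod.distrib mult.assoc)
  also have "\<dots> = (\<integral>\<^sup>+f. \<integral>\<^sup>+w. ?p w f \<partial>?P \<partial>?P)"
    by (rule P.Fubini'[symmetric]) measurable
  also have "\<dots> = (\<integral>\<^sup>+f. (\<Prod>i\<in>I. ennreal (normal_density (m i) (sqrt ((s i)\<^sup>2 + (D i)\<^sup>2)) (f i))) * indicator A f \<partial>?P)"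
  proof (intro nn_integral_cong)
    fix f
    have "(\<integral>\<^sup>+w. ?p w f \<partial>?P) = (\<integral>\<^sup>+w. (\<Prod>i\<in>I. ennreal (std_normal_density (w i)) * ennreal (normal_density (m i + D i * w i) (s i) (f i))) \<partial>?P) * indicator A f"
      by (intro nn_integral_multc) measurable
    also have "(\<integral>\<^sup>+w. (\<Prod>i\<in>I. ennreal (std_normal_density (w i)) * ennreal (normal_density (m i + D i * w i) (s i) (f i))) \<partial>?P) =
      (\<Prod>i\<in>I. \<integral>\<^sup>+w. ennreal (std_normal_density w) * ennreal (normal_density (m i + D i * w) (s i) (f i)) \<partial>lborel)"
      using I by (intro L.product_nn_integral_prod) auto
    also have "\<dots> = (\<Prod>i\<in>I. ennreal (normal_density (m i) (sqrt ((s i)\<^sup>2 + (D i)\<^sup>2)) (f i)))"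
      using s D by (intro prod.cong refl nn_integral_normal_density_convolution) auto
    finally show "(\<integral>\<^sup>+w. ?p w f \<partial>?P) = (\<Prod>i\<in>I. ennreal (normal_density (m i) (sqrt ((s i)\<^sup>2 + (D i)\<^sup>2)) (f i))) * indicator A f" .
  qed
  finally show ?thesis unfolding gauss_prod_def .
qed

text \<open>Chebyshev's inequality: a point at distance at least \<open>r\<close> from
  \<open>y\<close> is at distance at least r / 2 from the mean. Truncated subtraction in
  \<open>ennreal\<close> makes the bound trivial when \<open>s\<close> is large compared with
  \<open>r\<close>.\<close>

lemma normal_density_tail:
  assumes s: "0 < s" and r: "0 < r" and m: "\<bar>m - y\<bar> \<le> r / 2"
  shows "1 - ennreal (4 * s\<^sup>2 / r\<^sup>2) \<le>
    (\<integral>\<^sup>+z. ennreal (normal_density m s z) * indicator {z. \<bar>z - y\<bar> < r} z \<partial>lborel)"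
proof -
  have *: "has_bochner_integral lborel (\<lambda>x. normal_density m s x * (x - m)\<^sup>2) (s\<^sup>2)"
    using normal_moment_even[OF s, of m 1] s by simp
  have "(\<integral>\<^sup>+z. ennreal (normal_density m s z * (z - m)\<^sup>2) \<partial>lborel) = ennreal (s\<^sup>2)"
    using * by (subst nn_integral_eq_integral) (auto simp: has_bochner_integral_iff)
  then have 1: "(\<integral>\<^sup>+z. ennreal (4 / r\<^sup>2) * ennreal (normal_density m s z * (z - m)\<^sup>2) \<partial>lborel) = ennreal (4 * s\<^sup>2 / r\<^sup>2)"
    by (subst nn_integral_cmult) (auto simp: ennreal_mult[symmetric])
  have "1 = (\<integral>\<^sup>+z. ennreal (normal_density m s z) \<partial>lborel)"
    using s by (simp add: nn_integral_normal_density)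
  also have "\<dots> \<le> (\<integral>\<^sup>+z. ennreal (4 / r\<^sup>2) * ennreal (normal_density m s z * (z - m)\<^sup>2) +
      ennreal (normal_density m s z) * indicator {z. \<bar>z - y\<bar> < r} z \<partial>lborel)"
  proof (intro nn_integral_mono)
    fix z :: real
    show "ennreal (normal_density m s z) \<le> ennreal (4 / r\<^sup>2) * ennreal (normal_density m s z * (z - m)\<^sup>2) +
      ennreal (normal_density m s z) * indicator {z. \<bar>z - y\<bar> < r} z"
    proof (cases "\<bar>z - y\<bar> < r")
      case False
      then have "r / 2 \<le> \<bar>z - m\<bar>" using m by (auto simp: abs_if split: if_splits)
      then have "(r / 2)\<^sup>2 \<le> (z - m)\<^sup>2" using r by (simp add: abs_le_square_iff[symmetric])
      then have "1 \<le> 4 / r\<^sup>2 * (z - m)\<^sup>2" using r by (simp add: field_simps power2_eq_square)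
      then have "normal_density m s z * 1 \<le> normal_density m s z * (4 / r\<^sup>2 * (z - m)\<^sup>2)"
        by (intro mult_left_mono) auto
      then have "normal_density m s z \<le> 4 / r\<^sup>2 * (normal_density m s z * (z - m)\<^sup>2)"
        by (simp add: ac_simps)
      then show ?thesis using False by (simp add: ennreal_mult[symmetric] ennreal_leI)
    qed simp
  qed
  also have "\<dots> = ennreal (4 * s\<^sup>2 / r\<^sup>2) + (\<integral>\<^sup>+z. ennreal (normal_density m s z) * indicator {z. \<bar>z - y\<bar> < r} z \<partial>lborel)"
    by (subst nn_integral_add) (auto simp: 1)
  finally show ?thesis by (simp add: ennreal_minus_le_iff)
qed

text \<open>\<open>A\<close> contains a cube around \<open>y\<close>, and the mass of a cube is a
  product of one-dimensional masses, each tending to 1. The lemma is applied path by path, with the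
  solution at times approaching t as centres.\<close>

lemma gauss_prod_tendsto_1:
  fixes m :: "nat \<Rightarrow> 'i \<Rightarrow> real"
  assumes I: "finite I" and A: "A \<in> sets (\<Pi>\<^sub>M i\<in>I. borel)" and r: "0 < r"
    and sub: "\<And>f. f \<in> extensional I \<Longrightarrow> (\<And>i. i \<in> I \<Longrightarrow> \<bar>f i - y i\<bar> < r) \<Longrightarrow> f \<in> A"
    and m: "\<And>i. i \<in> I \<Longrightarrow> (\<lambda>k. m k i) \<longlonglongrightarrow> y i"
    and s: "\<And>i. i \<in> I \<Longrightarrow> (\<lambda>k. s k i) \<longlonglongrightarrow> 0" "\<And>k i. i \<in> I \<Longrightarrow> 0 < s k i"
  shows "(\<lambda>k. gauss_prod I (m k) (s k) A) \<longlonglongrightarrow> 1"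
proof (rule tendsto_sandwich)
  let ?B = "\<lambda>i. {z. \<bar>z - y i\<bar> < r}"
  have [measurable]: "?B i \<in> sets borel" for i by measurable
  show "\<forall>\<^sub>F k in sequentially. (\<Prod>i\<in>I. 1 - ennreal (4 * (s k i)\<^sup>2 / r\<^sup>2)) \<le> gauss_prod I (m k) (s k) A"
  proof -
    have "\<forall>\<^sub>F k in sequentially. \<forall>i\<in>I. \<bar>m k i - y i\<bar> \<le> r / 2"
      using I
    proof (rule eventually_ball_finite, intro ballI)
      fix i assume "i \<in> I"
      from tendstoD[OF m[OF this], of "r / 2"] r
      show "\<forall>\<^sub>F k in sequentially. \<bar>m k i - y i\<bar> \<le> r / 2"
        by (auto simp: dist_real_def elim!: eventually_mono)
    qed
    then show ?thesis
    proof eventually_elim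
      case (elim k)
      then have "(\<Prod>i\<in>I. 1 - ennreal (4 * (s k i)\<^sup>2 / r\<^sup>2)) \<le>
        (\<Prod>i\<in>I. \<integral>\<^sup>+z. ennreal (normal_density (m k i) (s k i) z) * indicator (?B i) z \<partial>lborel)"
        using s r by (intro prod_mono_ennreal normal_density_tail) auto
      also have "\<dots> = gauss_prod I (m k) (s k) (Pi\<^sub>E I ?B)"
        using I by (subst gauss_prod_Pi) auto
      also have "\<dots> \<le> gauss_prod I (m k) (s k) A"
        unfolding gauss_prod_def
        by (intro nn_integral_mono mult_left_mono)
           (auto split: split_indicator simp: PiE_def intro!: sub)
      finally show ?case .
    qed
  qed
  show "\<forall>\<^sub>F k in sequentially. gauss_prod I (m k) (s k) A \<le> 1"
    using I s by (intro always_eventually allI gauss_prod_le_1) auto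
  have "(\<lambda>k. \<Prod>i\<in>I. 1 - ennreal (4 * (s k i)\<^sup>2 / r\<^sup>2)) \<longlonglongrightarrow> (\<Prod>i\<in>I. 1 - ennreal (4 * 0\<^sup>2 / r\<^sup>2))"
  proof -
    \<comment> \<open>Capping at 1 turns the truncated \<open>ennreal\<close> difference into a
      continuous real expression, to which the limit rules apply.\<close>
    have "(\<lambda>k. \<Prod>i\<in>I. (1 - min 1 (4 * (s k i)\<^sup>2 / r\<^sup>2))) \<longlonglongrightarrow> (\<Prod>i\<in>I. 1 - min 1 (4 * 0\<^sup>2 / r\<^sup>2))"
      by (intro tendsto_prod tendsto_intros s) (use r in auto)
    then have "(\<lambda>k. ennreal (\<Prod>i\<in>I. (1 - min 1 (4 * (s k i)\<^sup>2 / r\<^sup>2)))) \<longlonglongrightarrow> ennreal (\<Prod>i\<in>I. 1 - min 1 (4 * 0\<^sup>2 / r\<^sup>2))"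
      by (rule tendsto_ennrealI)
    moreover have "ennreal (\<Prod>i\<in>I. (1 - min 1 (4 * (s k i)\<^sup>2 / r\<^sup>2))) = (\<Prod>i\<in>I. 1 - ennreal (4 * (s k i)\<^sup>2 / r\<^sup>2))" for k
    proof -
      have "ennreal (1 - min 1 (4 * (s k i)\<^sup>2 / r\<^sup>2)) = 1 - ennreal (4 * (s k i)\<^sup>2 / r\<^sup>2)" for i
        by (simp add: ennreal_minus min_def ennreal_neg flip: ennreal_1)
      then show ?thesis by (subst prod_ennreal[symmetric]) auto
    qed
    ultimately show ?thesis by simp
  qed
  then show "(\<lambda>k. \<Prod>i\<in>I. 1 - ennreal (4 * (s k i)\<^sup>2 / r\<^sup>2)) \<longlonglongrightarrow> 1" by simp
qed simp

section \<open>Outer approximation by open sets\<close>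

text \<open>Outer regularity holds for finite Borel measures on the Polish space of all functions on
  a countable type, whereas \<open>Q\<close> lives on functions extensional on \<open>I\<close>.
  Extension by zero transports \<open>Q\<close>, and restriction pulls \<open>N\<close> back.
  Openness of \<open>A\<close> is recorded as containing a cube around each point, the form in which
  the concentration argument uses it.\<close>

lemma outer_approx_PiM_borel:
  fixes I :: "'i::countable set" and Q :: "('i \<Rightarrow> real) measure"
  assumes I: "finite I" and Q: "sets Q = sets (\<Pi>\<^sub>M i\<in>I. borel)" "emeasure Q (space Q) \<noteq> \<infinity>"
    and N: "N \<in> sets (\<Pi>\<^sub>M i\<in>I. borel)" "emeasure Q N < e"
  obtains A where "A \<in> sets (\<Pi>\<^sub>M i\<in>I. borel)" "N \<subseteq> A" "emeasure Q A < e"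
    "\<And>y. y \<in> A \<Longrightarrow> \<exists>r>0. \<forall>f\<in>extensional I. (\<forall>i\<in>I. \<bar>f i - y i\<bar> < r) \<longrightarrow> f \<in> A"
proof -
  define emb :: "('i \<Rightarrow> real) \<Rightarrow> 'i \<Rightarrow> real" where "emb f i = (if i \<in> I then f i else 0)" for f i
  have spQ: "space Q = Pi\<^sub>E I (\<lambda>_. UNIV)"
    using sets_eq_imp_space_eq[OF Q(1)] by (simp add: space_PiM)
  have emb [measurable]: "emb \<in> borel_measurable Q"
  proof -
    have "emb \<in> measurable Q (\<Pi>\<^sub>M i\<in>UNIV. borel)"
    proof (rule measurable_PiM_single')
      fix i :: 'i
      have "(\<lambda>f. f i) \<in> borel_measurable (\<Pi>\<^sub>M i\<in>I. (borel :: real measure))" if "i \<in> I"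
        using that by measurable
      then show "(\<lambda>f. emb f i) \<in> borel_measurable Q"
        unfolding emb_def by (cases "i \<in> I") (auto simp: measurable_cong_sets[OF Q(1) refl])
    qed (auto simp: emb_def)
    then show ?thesis
      using sets_PiM_equal_borel measurable_cong_sets by blast
  qed
  have res [measurable]: "(\<lambda>f. restrict f I) \<in> measurable borel (\<Pi>\<^sub>M i\<in>I. (borel :: real measure))"
    by (rule measurable_restrict) (auto intro!: borel_measurable_continuous_onI continuous_intros)
  define Q' where "Q' = distr Q borel emb"
  define N' where "N' = (\<lambda>f. restrict f I) -` N \<inter> space borel"
  have N' [measurable]: "N' \<in> sets borel" unfolding N'_def using N(1) by measurable
  have emb_N: "emb -` N' \<inter> space Q = N"
  proof -
    have "restrict (emb f) I = f" if "f \<in> space Q" for f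
      using that by (auto simp: emb_def spQ fun_eq_iff PiE_def extensional_def)
    moreover have "N \<subseteq> space Q" using N(1) Q(1) by (metis sets.sets_into_space)
    ultimately show ?thesis by (auto simp: N'_def)
  qed
  have "emeasure Q' N' = (INF U \<in> {U. N' \<subseteq> U \<and> open U}. emeasure Q' U)"
    using Q(2) by (intro outer_regular) (auto simp: Q'_def emeasure_distr)
  moreover have "emeasure Q' N' = emeasure Q N"
    unfolding Q'_def by (subst emeasure_distr) (auto simp: emb_N)
  ultimately have "(INF U \<in> {U. N' \<subseteq> U \<and> open U}. emeasure Q' U) < e"
    using N(2) by simp
  then obtain U where U: "N' \<subseteq> U" "open U" "emeasure Q' U < e"
    unfolding INF_less_iff by auto
  have [measurable]: "U \<in> sets borel" using U by auto
  define A where "A = emb -` U \<inter> space Q"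
  have "A \<in> sets Q" unfolding A_def by measurable
  then have A: "A \<in> sets (\<Pi>\<^sub>M i\<in>I. borel)" using Q by simp
  moreover have "N \<subseteq> A" using U(1) emb_N unfolding A_def by auto
  moreover have "emeasure Q A < e"
    using U(3) unfolding Q'_def A_def by (subst (asm) emeasure_distr) auto
  moreover have "\<exists>r>0. \<forall>f\<in>extensional I. (\<forall>i\<in>I. \<bar>f i - y i\<bar> < r) \<longrightarrow> f \<in> A" if "y \<in> A" for y
  proof -
    have "openin (product_topology (\<lambda>i. euclidean) UNIV) U" "emb y \<in> U"
      using U(2) that by (auto simp: A_def open_fun_def)
    \<comment> \<open>Outside \<open>I\<close> all embedded points have value 0, so the basic box
      constrains only the coordinates in \<open>I\<close>.\<close>
    from product_topology_open_contains_basis[OF this] obtain X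
      where X: "emb y \<in> (\<Pi>\<^sub>E i\<in>UNIV. X i)" "\<And>i. open (X i)" "(\<Pi>\<^sub>E i\<in>UNIV. X i) \<subseteq> U"
      by auto
    have "\<exists>e>0. \<forall>z. dist z (y i) < e \<longrightarrow> z \<in> X i" if "i \<in> I" for i
    proof -
      have "emb y i \<in> X i" using X(1) by (auto simp: PiE_iff)
      then have "y i \<in> X i" using that by (simp add: emb_def)
      with X(2)[of i] show ?thesis unfolding open_dist by blast
    qed
    then obtain d where d: "\<And>i. i \<in> I \<Longrightarrow> d i > 0" "\<And>i z. i \<in> I \<Longrightarrow> dist z (y i) < d i \<Longrightarrow> z \<in> X i"
      by metis
    \<comment> \<open>The inserted 1 keeps the set nonempty when \<open>I\<close> is empty.\<close>
    define r where "r = Min (insert 1 (d ` I))"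
    have r: "r > 0" "\<And>i. i \<in> I \<Longrightarrow> r \<le> d i"
      using I d(1) by (auto simp: r_def)
    show ?thesis
    proof (intro exI[of _ r] conjI ballI impI r(1))
      fix f assume f: "f \<in> extensional I" "\<forall>i\<in>I. \<bar>f i - y i\<bar> < r"
      have "emb f \<in> (\<Pi>\<^sub>E i\<in>UNIV. X i)"
      proof (auto simp: PiE_iff)
        fix i
        show "emb f i \<in> X i"
        proof (cases "i \<in> I")
          case True
          then have "dist (f i) (y i) < d i" using f(2) r(2)[of i] by (auto simp: dist_real_def)
          then show ?thesis using d(2)[OF True] True by (simp add: emb_def)
        next
          case False
          have "emb y i \<in> X i" using X(1) by (auto simp: PiE_iff)
          then show ?thesis using False by (simp add: emb_def)
        qed
      qed
      then show "f \<in> A" using X(3) f(1) by (auto simp: A_def spQ PiE_def)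
    qed
  qed
  ultimately show ?thesis by (rule that)
qed

section \<open>Joint law from characteristic functions\<close>

context prob_space
begin

lemma char_std_normal_rv:
  assumes [measurable]: "X \<in> borel_measurable M" and X: "distr M borel X = density lborel std_normal_density"
  shows "(CLINT \<omega>|M. iexp (t * X \<omega>)) = complex_of_real (exp (- t\<^sup>2 / 2))"
proof -
  have "(CLINT \<omega>|M. iexp (t * X \<omega>)) = char (distr M borel X) t"
    unfolding char_def by (subst integral_distr) auto
  also have "\<dots> = complex_of_real (exp (- t\<^sup>2 / 2))"
    unfolding X char_std_normal_distribution by simp
  finally show ?thesis .
qed

text \<open>Adding a constant makes the bounded weight positive, so that Levy's uniqueness theorem for
  probability measures applies to the weighted law of \<open>X\<close>.\<close>

lemma weighted_std_normal_real:
  fixes X Z :: "'a \<Rightarrow> real"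
  assumes [measurable]: "X \<in> borel_measurable M" "Z \<in> borel_measurable M" "B \<in> sets borel"
    and X: "distr M borel X = density lborel std_normal_density"
    and Z: "\<And>\<omega>. \<bar>Z \<omega>\<bar> \<le> C"
    and char: "\<And>t. (CLINT \<omega>|M. complex_of_real (Z \<omega>) * iexp (t * X \<omega>)) = complex_of_real (c * exp (- t\<^sup>2 / 2))"
  shows "(LINT \<omega>|M. Z \<omega> * indicator B (X \<omega>)) = c * measure (density lborel std_normal_density) B"
proof -
  define D where "D = C + 1"
  have [simp]: "integrable M Z"
    by (rule integrable_const_bound[where B = C]) (auto simp: Z)
  have C: "0 \<le> C" using Z by (meson abs_ge_zero order_trans)
  \<comment> \<open>At t = 0 the hypothesis reads E Z = c, so c + D is the total mass of the
    positive weight Z + D.\<close>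
  have "complex_of_real (LINT \<omega>|M. Z \<omega>) = complex_of_real c"
    using char[of 0] by simp
  then have EZ: "(LINT \<omega>|M. Z \<omega>) = c" by (simp only: of_real_eq_iff)
  have pos: "1 \<le> Z \<omega> + D" for \<omega> using Z[of \<omega>] by (simp add: D_def abs_le_iff)
  have E: "(LINT \<omega>|M. Z \<omega> + D) = c + D" by (simp add: EZ prob_space)
  have "(LINT \<omega>|M. 1) \<le> (LINT \<omega>|M. Z \<omega> + D)"
    using pos by (intro integral_mono) auto
  then have p: "1 \<le> c + D" by (simp add: E prob_space)
  define w where "w \<omega> = (Z \<omega> + D) / (c + D)" for \<omega>
  have w [measurable]: "w \<in> borel_measurable M" unfolding w_def by measurable
  have w0: "0 \<le> w \<omega>" for \<omega> using pos[of \<omega>] p by (simp add: w_def)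
  have [simp]: "integrable M w" unfolding w_def by simp
  have Ew: "(LINT \<omega>|M. w \<omega>) = 1" unfolding w_def using p E by simp
  define Q where "Q = density M (\<lambda>\<omega>. ennreal (w \<omega>))"
  have [measurable_cong]: "sets Q = sets M" by (simp add: Q_def)
  interpret Q: prob_space Q
  proof
    have "emeasure Q (space Q) = (\<integral>\<^sup>+\<omega>. ennreal (w \<omega>) \<partial>M)"
      by (simp add: Q_def emeasure_density cong: nn_integral_cong)
    also have "\<dots> = 1" using w0 Ew by (subst nn_integral_eq_integral) auto
    finally show "emeasure Q (space Q) = 1" .
  qed
  have XQ [measurable]: "X \<in> borel_measurable Q" by measurable
  have int: "integrable M (\<lambda>\<omega>. complex_of_real (Z \<omega>) * iexp (t * X \<omega>))" for t
    using Z by (intro integrable_const_bound[where B = C]) (auto simp: norm_mult)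
  have int1: "integrable M (\<lambda>\<omega>. iexp (t * X \<omega>))" for t
    by (intro integrable_const_bound[where B = 1]) auto
  have "char (distr Q borel X) t = char (density lborel std_normal_density) t" for t
  proof -
    have "char (distr Q borel X) t = (CLINT \<omega>|Q. iexp (t * X \<omega>))"
      unfolding char_def by (subst integral_distr) auto
    also have "\<dots> = (CLINT \<omega>|M. w \<omega> *\<^sub>R iexp (t * X \<omega>))"
      unfolding Q_def using w0 by (subst integral_density) auto
    also have "\<dots> = (CLINT \<omega>|M. (complex_of_real (Z \<omega>) * iexp (t * X \<omega>) + complex_of_real D * iexp (t * X \<omega>)) / complex_of_real (c + D))"
      by (intro Bochner_Integration.integral_cong refl) (simp add: w_def scaleR_conv_of_real field_simps)
    also have "\<dots> = (complex_of_real (c * exp (- t\<^sup>2 / 2)) + complex_of_real D * complex_of_real (exp (- t\<^sup>2 / 2))) / complex_of_real (c + D)"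
      using int[of t] int1[of t] char[of t] char_std_normal_rv[OF assms(1) X, of t]
      by simp
    also have "\<dots> = complex_of_real (exp (- t\<^sup>2 / 2))"
    proof -
      have "complex_of_real (c + D) \<noteq> 0" using p by (simp only: of_real_eq_0_iff)
      then show ?thesis by (simp add: field_simps)
    qed
    finally show ?thesis by (simp add: char_std_normal_distribution)
  qed
  then have "distr Q borel X = density lborel std_normal_density"
    by (intro Levy_uniqueness) (auto simp: real_dist_normal_dist)
  then have "measure (density lborel std_normal_density) B = measure (distr Q borel X) B" by simp
  also have "\<dots> = (LINT x|distr Q borel X. indicator B x)" by simp
  also have "\<dots> = (LINT \<omega>|Q. indicator B (X \<omega>))"
    by (subst integral_distr) auto
  also have "\<dots> = (LINT \<omega>|M. w \<omega> *\<^sub>R indicator B (X \<omega>))"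
    unfolding Q_def using w0 by (subst integral_density) auto
  also have "\<dots> = (LINT \<omega>|M. (Z \<omega> * indicator B (X \<omega>) + D * indicator B (X \<omega>)) / (c + D))"
    by (intro Bochner_Integration.integral_cong refl) (simp add: w_def field_simps)
  also have "\<dots> = ((LINT \<omega>|M. Z \<omega> * indicator B (X \<omega>)) + D * (LINT \<omega>|M. indicator B (X \<omega>))) / (c + D)"
  proof -
    have "integrable M (\<lambda>\<omega>. Z \<omega> * indicator B (X \<omega>))"
      using Z C by (intro integrable_const_bound[where B = C]) (auto split: split_indicator)
    moreover have "integrable M (\<lambda>\<omega>. indicator B (X \<omega>) :: real)"
      by (intro integrable_const_bound[where B = 1]) auto
    ultimately show ?thesis by simp
  qed
  also have "(LINT \<omega>|M. indicator B (X \<omega>) :: real) = (LINT x|distr M borel X. indicator B x)"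
    by (subst integral_distr) auto
  also have "\<dots> = measure (density lborel std_normal_density) B"
    unfolding X by simp
  finally show ?thesis using p by (simp add: field_simps)
qed

text \<open>The real case is applied to the real and imaginary parts of the weight. Their transforms
  combine those of \<open>Z\<close> and of its conjugate, and the latter is the conjugate of the
  transform of \<open>Z\<close> at -t. The Gaussian factor is real and even, so both have the
  required form.\<close>

lemma weighted_std_normal:
  fixes X :: "'a \<Rightarrow> real" and Z :: "'a \<Rightarrow> complex"
  assumes [measurable]: "X \<in> borel_measurable M" "Z \<in> borel_measurable M" "B \<in> sets borel"
    and X: "distr M borel X = density lborel std_normal_density"
    and Z: "\<And>\<omega>. norm (Z \<omega>) \<le> C"
    and char: "\<And>t. (CLINT \<omega>|M. Z \<omega> * iexp (t * X \<omega>)) = c * complex_of_real (exp (- t\<^sup>2 / 2))"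
  shows "(CLINT \<omega>|M. Z \<omega> * indicator B (X \<omega>)) = c * measure (density lborel std_normal_density) B"
proof -
  have int: "integrable M (\<lambda>\<omega>. Z \<omega> * iexp (t * X \<omega>))" for t
    using Z by (intro integrable_const_bound[where B = C]) (auto simp: norm_mult)
  have [measurable]: "(\<lambda>\<omega>. cnj (Z \<omega>)) \<in> borel_measurable M"
    by (rule borel_measurable_continuous_on[OF _ assms(2)]) (auto intro!: continuous_intros)
  have int': "integrable M (\<lambda>\<omega>. cnj (Z \<omega>) * iexp (t * X \<omega>))" for t
    using Z by (intro integrable_const_bound[where B = C]) (auto simp: norm_mult)
  have cchar: "(CLINT \<omega>|M. cnj (Z \<omega>) * iexp (t * X \<omega>)) = cnj c * complex_of_real (exp (- t\<^sup>2 / 2))" for t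
  proof -
    have "(CLINT \<omega>|M. cnj (Z \<omega>) * iexp (t * X \<omega>)) = (CLINT \<omega>|M. cnj (Z \<omega> * iexp (- t * X \<omega>)))"
      by (simp add: exp_cnj)
    also have "\<dots> = cnj (CLINT \<omega>|M. Z \<omega> * iexp (- t * X \<omega>))"
      by (rule Bochner_Integration.integral_cnj)
    also have "\<dots> = cnj c * complex_of_real (exp (- t\<^sup>2 / 2))"
      unfolding char by simp
    finally show ?thesis .
  qed
  have re: "(CLINT \<omega>|M. complex_of_real (Re (Z \<omega>)) * iexp (t * X \<omega>)) = complex_of_real (Re c * exp (- t\<^sup>2 / 2))" for t
  proof -
    have "(CLINT \<omega>|M. complex_of_real (Re (Z \<omega>)) * iexp (t * X \<omega>)) =
       (CLINT \<omega>|M. (Z \<omega> * iexp (t * X \<omega>) + cnj (Z \<omega>) * iexp (t * X \<omega>)) / 2)"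
      by (intro Bochner_Integration.integral_cong refl) (simp add: complex_eq_iff field_simps)
    also have "\<dots> = (c * complex_of_real (exp (- t\<^sup>2 / 2)) + cnj c * complex_of_real (exp (- t\<^sup>2 / 2))) / 2"
      using int[of t] int'[of t] char[of t] cchar[of t] by simp
    also have "\<dots> = complex_of_real (Re c * exp (- t\<^sup>2 / 2))"
      by (simp add: complex_eq_iff field_simps)
    finally show ?thesis .
  qed
  have im: "(CLINT \<omega>|M. complex_of_real (Im (Z \<omega>)) * iexp (t * X \<omega>)) = complex_of_real (Im c * exp (- t\<^sup>2 / 2))" for t
  proof -
    have "(CLINT \<omega>|M. complex_of_real (Im (Z \<omega>)) * iexp (t * X \<omega>)) =
       (CLINT \<omega>|M. (Z \<omega> * iexp (t * X \<omega>) - cnj (Z \<omega>) * iexp (t * X \<omega>)) / (2 * \<i>))"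
          proof -
      have "complex_of_real (Im z) * w = (z * w - cnj z * w) / (2 * \<i>)" for z w
        by (simp add: left_diff_distrib[symmetric] complex_diff_cnj) (simp add: complex_eq_iff)
      then show ?thesis by simp
    qed
    also have "\<dots> = (c * complex_of_real (exp (- t\<^sup>2 / 2)) - cnj c * complex_of_real (exp (- t\<^sup>2 / 2))) / (2 * \<i>)"
      using int[of t] int'[of t] char[of t] cchar[of t] by simp
    also have "\<dots> = complex_of_real (Im c * exp (- t\<^sup>2 / 2))"
      by (simp add: left_diff_distrib[symmetric] complex_diff_cnj) (simp add: complex_eq_iff)
    finally show ?thesis .
  qed
  have "integrable M (\<lambda>\<omega>. Z \<omega> * indicator B (X \<omega>))"
    using Z order_trans[OF norm_ge_zero Z]
    by (intro integrable_const_bound[where B = C]) (auto split: split_indicator)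
  then have "Re (CLINT \<omega>|M. Z \<omega> * indicator B (X \<omega>)) = (LINT \<omega>|M. Re (Z \<omega> * indicator B (X \<omega>)))"
    and "Im (CLINT \<omega>|M. Z \<omega> * indicator B (X \<omega>)) = (LINT \<omega>|M. Im (Z \<omega> * indicator B (X \<omega>)))"
    by (simp_all only: integral_Re integral_Im)
  moreover have "(LINT \<omega>|M. Re (Z \<omega> * indicator B (X \<omega>))) = (LINT \<omega>|M. Re (Z \<omega>) * indicator B (X \<omega>))"
    and "(LINT \<omega>|M. Im (Z \<omega> * indicator B (X \<omega>))) = (LINT \<omega>|M. Im (Z \<omega>) * indicator B (X \<omega>))"
    by (auto intro!: Bochner_Integration.integral_cong split: split_indicator)
  moreover have "(LINT \<omega>|M. Re (Z \<omega>) * indicator B (X \<omega>)) = Re c * measure (density lborel std_normal_density) B"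
    using order_trans[OF abs_Re_le_cmod Z]
    by (intro weighted_std_normal_real[OF assms(1) _ assms(3) X _ re]) auto
  moreover have "(LINT \<omega>|M. Im (Z \<omega>) * indicator B (X \<omega>)) = Im c * measure (density lborel std_normal_density) B"
    using order_trans[OF abs_Im_le_cmod Z]
    by (intro weighted_std_normal_real[OF assms(1) _ assms(3) X _ im]) auto
  ultimately show ?thesis by (simp add: complex_eq_iff)
qed

text \<open>The coordinates are treated one at a time: the one-dimensional uniqueness theorem replaces the
  factor \<open>exp (\<i> \<xi> X\<^sub>k)\<close> by the indicator of \<open>X\<^sub>k \<in> B\<^sub>k\<close>.\<close>

lemma distr_std_gauss_from_char:
  fixes X :: "'i \<Rightarrow> 'a \<Rightarrow> real"
  assumes I: "finite I" and [measurable]: "\<And>i. i \<in> I \<Longrightarrow> X i \<in> borel_measurable M"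
    and char: "\<And>\<xi>. (CLINT \<omega>|M. iexp (\<Sum>i\<in>I. \<xi> i * X i \<omega>)) = complex_of_real (exp (- (\<Sum>i\<in>I. (\<xi> i)\<^sup>2) / 2))"
  shows "distr M (\<Pi>\<^sub>M i\<in>I. borel) (\<lambda>\<omega>. \<lambda>i\<in>I. X i \<omega>) = std_gauss I"
proof -
  let ?N = "density lborel std_normal_density :: real measure"
  interpret N: product_prob_space "\<lambda>_::'i. ?N"
    by (simp add: product_prob_space_def product_prob_space_axioms_def product_sigma_finite_def
        prob_space_normal_density prob_space_imp_sigma_finite)
  have marg: "distr M borel (X k) = ?N" if k: "k \<in> I" for k
  proof (rule Levy_uniqueness)
    show "char (distr M borel (X k)) = char ?N"
    proof
      fix t
      have "char (distr M borel (X k)) t = (CLINT \<omega>|M. iexp (\<Sum>i\<in>I. (if i = k then t else 0) * X i \<omega>))"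
        unfolding char_def using k I by (subst integral_distr) (auto simp: if_distrib[of "\<lambda>x. x * _"] cong: if_cong)
      also have "\<dots> = complex_of_real (exp (- t\<^sup>2 / 2))"
        unfolding char using k I by (simp add: if_distrib[of "\<lambda>x. x\<^sup>2"] cong: if_cong)
      finally show "char (distr M borel (X k)) t = char ?N t"
        by (simp add: char_std_normal_distribution)
    qed
  qed (use k in \<open>auto simp: real_dist_normal_dist\<close>)
  \<comment> \<open>Mixed transform: the coordinates in \<open>J\<close> already carry indicators,
    the others still exponentials. The empty set is the hypothesis, and \<open>J = I\<close> gives
    the box probabilities.\<close>
  have main: "(CLINT \<omega>|M. (\<Prod>j\<in>J. indicator (B j) (X j \<omega>)) * iexp (\<Sum>i\<in>I - J. \<xi> i * X i \<omega>)) =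
      (\<Prod>j\<in>J. complex_of_real (measure ?N (B j))) * complex_of_real (exp (- (\<Sum>i\<in>I - J. (\<xi> i)\<^sup>2) / 2))"
    if "J \<subseteq> I" "\<And>j. j \<in> J \<Longrightarrow> B j \<in> sets borel" for J B \<xi>
    using finite_subset[OF that(1) I] that
  proof (induction J arbitrary: \<xi>)
    case empty
    then show ?case using char[of \<xi>] by simp
  next
    case (insert k J)
    from insert.prems have k: "k \<in> I" "k \<notin> J" and JI: "J \<subseteq> I" using insert.hyps by auto
    have fin: "finite (I - J)" using I by auto
    have split: "(\<Sum>i\<in>I - J. f i) = f k + (\<Sum>i\<in>I - insert k J. f i)" for f :: "'i \<Rightarrow> real"
    proof -
      show ?thesis
        using sum.remove[OF fin, of k f] k by (simp add: Diff_insert[symmetric])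
    qed
    let ?Z = "\<lambda>\<omega>. (\<Prod>j\<in>J. indicator (B j) (X j \<omega>)) * iexp (\<Sum>i\<in>I - insert k J. \<xi> i * X i \<omega>)"
    let ?c = "(\<Prod>j\<in>J. complex_of_real (measure ?N (B j))) * complex_of_real (exp (- (\<Sum>i\<in>I - insert k J. (\<xi> i)\<^sup>2) / 2))"
    have [measurable]: "\<And>j. j \<in> J \<Longrightarrow> B j \<in> sets borel" "B k \<in> sets borel" using insert.prems by auto
    have [measurable]: "\<And>j. j \<in> J \<Longrightarrow> X j \<in> borel_measurable M" "X k \<in> borel_measurable M" using JI k by auto
    have "(CLINT \<omega>|M. ?Z \<omega> * indicator (B k) (X k \<omega>)) = ?c * measure ?N (B k)"
    proof (rule weighted_std_normal[OF _ _ _ marg[OF k(1)]])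
      show "?Z \<in> borel_measurable M" by measurable
      show "norm (?Z \<omega>) \<le> 1" for \<omega>
      proof -
        have "norm (\<Prod>j\<in>J. indicator (B j) (X j \<omega>) :: complex) \<le> 1"
          unfolding prod_norm[symmetric] by (intro prod_le_1) (auto split: split_indicator)
        then show ?thesis by (simp add: norm_mult del: of_real_sum)
      qed
      fix t
      let ?\<xi> = "\<xi>(k := t)"
      have eq: "(\<Sum>i\<in>I - insert k J. ?\<xi> i * X i \<omega>) = (\<Sum>i\<in>I - insert k J. \<xi> i * X i \<omega>)"
        "(\<Sum>i\<in>I - insert k J. (?\<xi> i)\<^sup>2) = (\<Sum>i\<in>I - insert k J. (\<xi> i)\<^sup>2)" for \<omega>
        by (intro sum.cong; auto)+
      have "(CLINT \<omega>|M. ?Z \<omega> * iexp (t * X k \<omega>)) = (CLINT \<omega>|M. (\<Prod>j\<in>J. indicator (B j) (X j \<omega>)) * iexp (\<Sum>i\<in>I - J. ?\<xi> i * X i \<omega>))"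
      proof (intro Bochner_Integration.integral_cong refl)
        fix \<omega>
        show "?Z \<omega> * iexp (t * X k \<omega>) = (\<Prod>j\<in>J. indicator (B j) (X j \<omega>)) * iexp (\<Sum>i\<in>I - J. ?\<xi> i * X i \<omega>)"
          unfolding split eq by (simp only: of_real_add ring_distribs exp_add fun_upd_same mult.assoc mult.commute mult.left_commute)
      qed
      also have "\<dots> = (\<Prod>j\<in>J. complex_of_real (measure ?N (B j))) * complex_of_real (exp (- (\<Sum>i\<in>I - J. (?\<xi> i)\<^sup>2) / 2))"
        using insert.prems by (intro insert.IH) auto
      also have "\<dots> = ?c * complex_of_real (exp (- t\<^sup>2 / 2))"
      proof -
        have "exp (- (t\<^sup>2 + r) / 2) = exp (- r / 2) * exp (- t\<^sup>2 / 2)" for r :: real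
          by (simp add: exp_add[symmetric] add_divide_distrib)
        then show ?thesis unfolding split eq fun_upd_same by (simp only: of_real_mult mult.assoc)
      qed
      finally show "(CLINT \<omega>|M. ?Z \<omega> * iexp (t * X k \<omega>)) = ?c * complex_of_real (exp (- t\<^sup>2 / 2))" .
    qed (use k in auto)
    then show ?case using insert.hyps k by (simp add: mult_ac)
  qed
  show ?thesis
    unfolding std_gauss_def
  proof (rule N.PiM_eqI[OF I])
    fix B :: "'i \<Rightarrow> real set" assume "\<And>i. i \<in> I \<Longrightarrow> B i \<in> sets ?N"
    then have B [measurable]: "\<And>i. i \<in> I \<Longrightarrow> B i \<in> sets borel" by simp
    let ?E = "{\<omega>\<in>space M. \<forall>i\<in>I. X i \<omega> \<in> B i}"
    have E [measurable]: "?E \<in> sets M" using I by measurable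
    have "complex_of_real (measure M ?E) = (CLINT \<omega>|M. complex_of_real (indicator ?E \<omega>))"
      using E by simp
    also have "\<dots> = (CLINT \<omega>|M. \<Prod>j\<in>I. indicator (B j) (X j \<omega>))"
    proof (intro Bochner_Integration.integral_cong refl)
      fix \<omega> assume "\<omega> \<in> space M"
      then show "complex_of_real (indicator ?E \<omega>) = (\<Prod>j\<in>I. indicator (B j) (X j \<omega>) :: complex)"
        using I by (cases "\<omega> \<in> ?E") (auto intro!: prod.neutral[symmetric] simp: indicator_def)
    qed
    also have "\<dots> = (\<Prod>j\<in>I. complex_of_real (measure ?N (B j)))"
      using main[of I B "\<lambda>_. 0"] B by simp
    finally have "measure M ?E = (\<Prod>j\<in>I. measure ?N (B j))"
      by (simp only: of_real_prod[symmetric] of_real_eq_iff)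
    then have "emeasure M ?E = (\<Prod>j\<in>I. emeasure ?N (B j))"
      by (simp add: emeasure_eq_measure N.M.emeasure_eq_measure prod_ennreal)
    moreover have "(\<lambda>\<omega>. \<lambda>i\<in>I. X i \<omega>) -` Pi\<^sub>E I B \<inter> space M = ?E"
      by (auto simp: PiE_iff)
    ultimately show "emeasure (distr M (\<Pi>\<^sub>M i\<in>I. borel) (\<lambda>\<omega>. \<lambda>i\<in>I. X i \<omega>)) (Pi\<^sub>E I B) = (\<Prod>i\<in>I. emeasure ?N (B i))"
      using I by (subst emeasure_distr) (auto intro!: sets_PiM_I_finite measurable_restrict)
  qed (auto intro!: sets_PiM_cong)
qed

end

section \<open>Elementary stochastic integrals\<close>

text \<open>This is what the isometry uses: increments independent of the past, centred, with
  variance the elapsed time. The Gaussian law enters separately and jointly for all coordinates, in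
  \<open>diagonal_sde\<close>.\<close>

locale adapted_brownian_motion = prob_space M for M :: "'a measure" +
  fixes F :: "real \<Rightarrow> 'a measure" and T :: real and B :: "real \<Rightarrow> 'a \<Rightarrow> real"
  assumes subalg: "t \<in> {0..T} \<Longrightarrow> subalgebra M (F t)"
    and filtration_mono: "0 \<le> s \<Longrightarrow> s \<le> t \<Longrightarrow> t \<le> T \<Longrightarrow> sets (F s) \<subseteq> sets (F t)"
    and adapted: "t \<in> {0..T} \<Longrightarrow> B t \<in> borel_measurable (F t)"
    and indep_increment: "0 \<le> s \<Longrightarrow> s \<le> t \<Longrightarrow> t \<le> T \<Longrightarrow> Y \<in> borel_measurable (F s) \<Longrightarrow>
      indep_var borel Y borel (\<lambda>\<omega>. B t \<omega> - B s \<omega>)"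
    and increment_square_integrable: "0 \<le> s \<Longrightarrow> s \<le> t \<Longrightarrow> t \<le> T \<Longrightarrow> integrable M (\<lambda>\<omega>. (B t \<omega> - B s \<omega>)\<^sup>2)"
    and increment_mean: "0 \<le> s \<Longrightarrow> s \<le> t \<Longrightarrow> t \<le> T \<Longrightarrow> (LINT \<omega>|M. B t \<omega> - B s \<omega>) = 0"
    and increment_variance: "0 \<le> s \<Longrightarrow> s \<le> t \<Longrightarrow> t \<le> T \<Longrightarrow> (LINT \<omega>|M. (B t \<omega> - B s \<omega>)\<^sup>2) = t - s"
begin

lemma space_F: "t \<in> {0..T} \<Longrightarrow> space (F t) = space M"
  using subalg by (auto simp: subalgebra_def)

lemma measurable_F_M: "t \<in> {0..T} \<Longrightarrow> f \<in> borel_measurable (F t) \<Longrightarrow> f \<in> borel_measurable M"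
  using subalg measurable_from_subalg by blast

lemma measurable_F_mono:
  "0 \<le> s \<Longrightarrow> s \<le> t \<Longrightarrow> t \<le> T \<Longrightarrow> f \<in> borel_measurable (F s) \<Longrightarrow> f \<in> borel_measurable (F t)"
  using filtration_mono[of s t] space_F[of s] space_F[of t] by (auto simp: measurable_def)

text \<open>Induction on the last interval. In the cross term the first factor is known at the left
  endpoint, hence independent of the centred increment; in the square, independence factors out the
  variance. Adaptedness stands in the conclusion because the induction step needs it.\<close>

lemma elementary_isometry:
  assumes q: "mono_on {0..N} q" "0 \<le> q 0" "q N \<le> T"
    and h: "\<And>j. j < N \<Longrightarrow> h j \<in> borel_measurable (F (q j))"
    and bd: "\<And>j. j < N \<Longrightarrow> \<exists>C. \<forall>\<omega>\<in>space M. \<bar>h j \<omega>\<bar> \<le> C"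
  defines "Z \<equiv> \<lambda>\<omega>. \<Sum>j<N. h j \<omega> * (B (q (Suc j)) \<omega> - B (q j) \<omega>)"
  shows "Z \<in> borel_measurable (F (q N)) \<and> integrable M (\<lambda>\<omega>. (Z \<omega>)\<^sup>2) \<and>
    (LINT \<omega>|M. (Z \<omega>)\<^sup>2) = (\<Sum>j<N. (LINT \<omega>|M. (h j \<omega>)\<^sup>2) * (q (Suc j) - q j))"
  using q h bd unfolding Z_def
proof (induction N)
  case 0
  then show ?case by simp
next
  case (Suc N)
  let ?Z = "\<lambda>\<omega>. \<Sum>j<N. h j \<omega> * (B (q (Suc j)) \<omega> - B (q j) \<omega>)"
  let ?D = "\<lambda>\<omega>. B (q (Suc N)) \<omega> - B (q N) \<omega>"
  have le: "0 \<le> q N" "q N \<le> q (Suc N)" "q (Suc N) \<le> T"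
    using Suc.prems(1-3) mono_onD[OF Suc.prems(1), of 0 N] mono_onD[OF Suc.prems(1), of N "Suc N"] by auto
  have IH: "?Z \<in> borel_measurable (F (q N))" "integrable M (\<lambda>\<omega>. (?Z \<omega>)\<^sup>2)"
    "(LINT \<omega>|M. (?Z \<omega>)\<^sup>2) = (\<Sum>j<N. (LINT \<omega>|M. (h j \<omega>)\<^sup>2) * (q (Suc j) - q j))"
  proof -
    have "mono_on {0..N} q" using Suc.prems(1) by (rule mono_on_subset) auto
    moreover have "q N \<le> T" using le by simp
    ultimately have "?Z \<in> borel_measurable (F (q N)) \<and> integrable M (\<lambda>\<omega>. (?Z \<omega>)\<^sup>2) \<and>
      (LINT \<omega>|M. (?Z \<omega>)\<^sup>2) = (\<Sum>j<N. (LINT \<omega>|M. (h j \<omega>)\<^sup>2) * (q (Suc j) - q j))"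
      using Suc.IH Suc.prems(2,4,5) less_SucI by blast
    then show "?Z \<in> borel_measurable (F (q N))" "integrable M (\<lambda>\<omega>. (?Z \<omega>)\<^sup>2)"
      "(LINT \<omega>|M. (?Z \<omega>)\<^sup>2) = (\<Sum>j<N. (LINT \<omega>|M. (h j \<omega>)\<^sup>2) * (q (Suc j) - q j))"
      by blast+
  qed
  have hF: "h N \<in> borel_measurable (F (q N))" using Suc.prems by auto
  obtain C where C: "\<And>\<omega>. \<omega> \<in> space M \<Longrightarrow> \<bar>h N \<omega>\<bar> \<le> C" using Suc.prems(5)[of N] by auto
  have [measurable]: "?Z \<in> borel_measurable M" "h N \<in> borel_measurable M" "?D \<in> borel_measurable M"
    using IH(1) hF adapted[of "q N"] adapted[of "q (Suc N)"] le
    by (auto intro!: borel_measurable_diff intro: measurable_F_M[of "q N"] measurable_F_M[of "q (Suc N)"])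
  have D2: "integrable M (\<lambda>\<omega>. (?D \<omega>)\<^sup>2)" using le by (intro increment_square_integrable)
  have D1: "integrable M ?D" using D2 by (rule square_integrable_imp_integrable[rotated]) measurable
  have Z1: "integrable M ?Z" using IH(2) by (rule square_integrable_imp_integrable[rotated]) measurable
  have Zh: "integrable M (\<lambda>\<omega>. 2 * ?Z \<omega> * h N \<omega>)"
  proof (rule Bochner_Integration.integrable_bound)
    show "integrable M (\<lambda>\<omega>. 2 * C * ?Z \<omega>)" using Z1 by simp
    show "AE \<omega> in M. norm (2 * ?Z \<omega> * h N \<omega>) \<le> norm (2 * C * ?Z \<omega>)"
    proof (intro AE_I2)
      fix \<omega> assume "\<omega> \<in> space M"
      then have "\<bar>h N \<omega>\<bar> \<le> \<bar>C\<bar>" using C by fastforce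
      then show "norm (2 * ?Z \<omega> * h N \<omega>) \<le> norm (2 * C * ?Z \<omega>)"
        by (simp add: abs_mult mult_mono mult.commute)
    qed
  qed measurable
  have h2: "integrable M (\<lambda>\<omega>. (h N \<omega>)\<^sup>2)"
  proof (rule integrable_const_bound[where B = "C\<^sup>2"])
    show "AE \<omega> in M. norm ((h N \<omega>)\<^sup>2) \<le> C\<^sup>2"
      using C by (intro AE_I2) (simp add: abs_le_square_iff[symmetric] order_trans[OF _ abs_ge_self])
  qed measurable
  have i1: "indep_var borel (\<lambda>\<omega>. 2 * ?Z \<omega> * h N \<omega>) borel ?D"
    using le IH(1) hF by (intro indep_increment) auto
  have "indep_var borel (\<lambda>\<omega>. (h N \<omega>)\<^sup>2) borel ?D"
    using le hF by (intro indep_increment) auto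
  from indep_var_compose[OF this, of "\<lambda>x. x" borel "\<lambda>x. x\<^sup>2" borel]
  have i2: "indep_var borel (\<lambda>\<omega>. (h N \<omega>)\<^sup>2) borel (\<lambda>\<omega>. (?D \<omega>)\<^sup>2)"
    by (simp add: comp_def)
  have sq: "(?Z \<omega> + h N \<omega> * ?D \<omega>)\<^sup>2 = (?Z \<omega>)\<^sup>2 + (2 * ?Z \<omega> * h N \<omega>) * ?D \<omega> + (h N \<omega>)\<^sup>2 * (?D \<omega>)\<^sup>2" for \<omega>
    by (simp add: power2_eq_square algebra_simps)
  have I1: "integrable M (\<lambda>\<omega>. (2 * ?Z \<omega> * h N \<omega>) * ?D \<omega>)"
    by (rule indep_var_integrable[OF i1 Zh D1])
  have I2: "integrable M (\<lambda>\<omega>. (h N \<omega>)\<^sup>2 * (?D \<omega>)\<^sup>2)"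
    by (rule indep_var_integrable[OF i2 h2 D2])
  have E1: "(LINT \<omega>|M. (2 * ?Z \<omega> * h N \<omega>) * ?D \<omega>) = 0"
    using indep_var_lebesgue_integral[OF i1 Zh D1] increment_mean[OF le] by simp
  have E2: "(LINT \<omega>|M. (h N \<omega>)\<^sup>2 * (?D \<omega>)\<^sup>2) = (LINT \<omega>|M. (h N \<omega>)\<^sup>2) * (q (Suc N) - q N)"
    using indep_var_lebesgue_integral[OF i2 h2 D2] increment_variance[OF le] by simp
  have "integrable M (\<lambda>\<omega>. (?Z \<omega> + h N \<omega> * ?D \<omega>)\<^sup>2)"
    unfolding sq using IH(2) I1 I2 by (intro Bochner_Integration.integrable_add)
  moreover have "(LINT \<omega>|M. (?Z \<omega> + h N \<omega> * ?D \<omega>)\<^sup>2) =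
      (LINT \<omega>|M. (?Z \<omega>)\<^sup>2) + (LINT \<omega>|M. (h N \<omega>)\<^sup>2) * (q (Suc N) - q N)"
    unfolding sq using IH(2) I1 I2 E1 E2 by (simp only: Bochner_Integration.integral_add Bochner_Integration.integrable_add)
  moreover have "(\<lambda>\<omega>. ?Z \<omega> + h N \<omega> * ?D \<omega>) \<in> borel_measurable (F (q (Suc N)))"
    using le IH(1) hF adapted[of "q N"] adapted[of "q (Suc N)"]
    by (intro borel_measurable_add borel_measurable_times borel_measurable_diff)
       (auto intro: measurable_F_mono[of "q N"])
  ultimately show ?case using IH(3) by simp
qed

text \<open>The integrand is switched off as soon as its energy exceeds \<open>d\<close>; this keeps it predictable
  and makes the second moment of the integral at most \<open>d\<close>.\<close>

lemma elementary_lenglart: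
  assumes q: "mono_on {0..N} q" "0 \<le> q 0" "q N \<le> T"
    and h: "\<And>j. j < N \<Longrightarrow> h j \<in> borel_measurable (F (q j))"
    and bd: "\<And>j. j < N \<Longrightarrow> \<exists>C. \<forall>\<omega>\<in>space M. \<bar>h j \<omega>\<bar> \<le> C"
    and e: "0 < e" and d: "0 \<le> d"
  shows "measure M {\<omega>\<in>space M. e < \<bar>\<Sum>j<N. h j \<omega> * (B (q (Suc j)) \<omega> - B (q j) \<omega>)\<bar> \<and>
      (\<Sum>j<N. (h j \<omega>)\<^sup>2 * (q (Suc j) - q j)) \<le> d} \<le> d / e\<^sup>2"
proof -
  define V where "V n \<omega> = (\<Sum>j<n. (h j \<omega>)\<^sup>2 * (q (Suc j) - q j))" for n \<omega>
  \<comment> \<open>\<open>V (Suc j)\<close> includes the j-th interval, so the energy cannot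
    overshoot \<open>d\<close>; it is still known at time \<open>q j\<close> because
    \<open>h j\<close> is.\<close>
  define g where "g j \<omega> = (if V (Suc j) \<omega> \<le> d then h j \<omega> else 0)" for j \<omega>
  have qr: "0 \<le> q j" "q j \<le> q (Suc j)" "q (Suc j) \<le> T" if "j < N" for j
    using q(2,3) mono_onD[OF q(1), of 0 j] mono_onD[OF q(1), of j "Suc j"] mono_onD[OF q(1), of "Suc j" N] that by auto
  have qm: "q i \<le> q j" if "i \<le> j" "j \<le> N" for i j
    using mono_onD[OF q(1), of i j] that by auto
  have gF: "g j \<in> borel_measurable (F (q j))" if "j < N" for j
  proof -
    have [measurable]: "h i \<in> borel_measurable (F (q j))" if "i \<le> j" for i
      using that \<open>j < N\<close> qr[of i] qr[of j] qm[of i j] h[of i] by (intro measurable_F_mono[of "q i" "q j"]) auto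
    have [measurable]: "h i \<in> borel_measurable (F (q j))" if "i \<in> {..<Suc j}" for i
      using that by simp
    show ?thesis unfolding g_def V_def by measurable
  qed
  have gbd: "\<exists>C. \<forall>\<omega>\<in>space M. \<bar>g j \<omega>\<bar> \<le> C" if j: "j < N" for j
  proof -
    obtain C where "\<forall>\<omega>\<in>space M. \<bar>h j \<omega>\<bar> \<le> C" using bd[OF j] by auto
    then show ?thesis by (intro exI[of _ "\<bar>C\<bar>"]) (auto simp: g_def)
  qed
  let ?G = "\<lambda>\<omega>. \<Sum>j<N. g j \<omega> * (B (q (Suc j)) \<omega> - B (q j) \<omega>)"
  let ?H = "\<lambda>\<omega>. \<Sum>j<N. h j \<omega> * (B (q (Suc j)) \<omega> - B (q j) \<omega>)"
  have iso: "?G \<in> borel_measurable (F (q N))" "integrable M (\<lambda>\<omega>. (?G \<omega>)\<^sup>2)"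
    "(LINT \<omega>|M. (?G \<omega>)\<^sup>2) = (\<Sum>j<N. (LINT \<omega>|M. (g j \<omega>)\<^sup>2) * (q (Suc j) - q j))"
    using elementary_isometry[OF q gF gbd] by auto
  have qT: "q j \<in> {0..T}" if "j \<le> N" for j
    using qm[of 0 j] qm[of j N] that q by auto
  have hM [measurable]: "h j \<in> borel_measurable M" "g j \<in> borel_measurable M"
      "B (q j) \<in> borel_measurable M" "B (q (Suc j)) \<in> borel_measurable M" if "j \<in> {..<N}" for j
  proof -
    have j: "j < N" "j \<le> N" "Suc j \<le> N" using that by auto
    show "h j \<in> borel_measurable M" "g j \<in> borel_measurable M"
      "B (q j) \<in> borel_measurable M" "B (q (Suc j)) \<in> borel_measurable M"
      using measurable_F_M[OF qT[OF j(2)] h[OF j(1)]] measurable_F_M[OF qT[OF j(2)] gF[OF j(1)]]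
        measurable_F_M[OF qT[OF j(2)] adapted[OF qT[OF j(2)]]]
        measurable_F_M[OF qT[OF j(3)] adapted[OF qT[OF j(3)]]] by auto
  qed
  have g2: "integrable M (\<lambda>\<omega>. (g j \<omega>)\<^sup>2)" if j: "j \<in> {..<N}" for j
  proof -
    obtain C where C: "\<forall>\<omega>\<in>space M. \<bar>g j \<omega>\<bar> \<le> C" using gbd[of j] j by auto
    show ?thesis
    proof (rule integrable_const_bound[where B = "C\<^sup>2"])
      show "AE \<omega> in M. norm ((g j \<omega>)\<^sup>2) \<le> C\<^sup>2"
        using C by (intro AE_I2) (simp add: abs_le_square_iff[symmetric] order_trans[OF _ abs_ge_self])
    qed (use j in measurable)
  qed
  \<comment> \<open>The second conjunct drives the induction: before the switch, the energy of
    \<open>g\<close> is that of \<open>h\<close>.\<close>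
  have energy: "(\<Sum>j<n. (g j \<omega>)\<^sup>2 * (q (Suc j) - q j)) \<le> d \<and>
      (V n \<omega> \<le> d \<longrightarrow> (\<Sum>j<n. (g j \<omega>)\<^sup>2 * (q (Suc j) - q j)) = V n \<omega>)" if "n \<le> N" for n \<omega>
    using that
  proof (induction n)
    case 0
    then show ?case using d by (simp add: V_def)
  next
    case (Suc n)
    have V: "V (Suc n) \<omega> = V n \<omega> + (h n \<omega>)\<^sup>2 * (q (Suc n) - q n)" by (simp add: V_def)
    have "0 \<le> (h n \<omega>)\<^sup>2 * (q (Suc n) - q n)" using qr[of n] Suc.prems by simp
    then show ?case
      using Suc V by (cases "V (Suc n) \<omega> \<le> d") (auto simp: g_def)
  qed
  have "(LINT \<omega>|M. (?G \<omega>)\<^sup>2) = (LINT \<omega>|M. (\<Sum>j<N. (g j \<omega>)\<^sup>2 * (q (Suc j) - q j)))"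
    unfolding iso(3) using g2 by (subst Bochner_Integration.integral_sum) auto
  also have "\<dots> \<le> (LINT \<omega>|M. d)"
    using g2 energy[of N] by (intro integral_mono) auto
  finally have EG: "(LINT \<omega>|M. (?G \<omega>)\<^sup>2) \<le> d" by (simp add: prob_space)
  have Vmono: "V (Suc j) \<omega> \<le> V N \<omega>" if "j < N" for j \<omega>
    unfolding V_def using that qr by (intro sum_mono2) auto
  have "measure M {\<omega>\<in>space M. e < \<bar>?H \<omega>\<bar> \<and> (\<Sum>j<N. (h j \<omega>)\<^sup>2 * (q (Suc j) - q j)) \<le> d}
      \<le> measure M {\<omega>\<in>space M. e\<^sup>2 \<le> (?G \<omega>)\<^sup>2}"
  proof (intro finite_measure_mono subsetI)
    fix \<omega> assume "\<omega> \<in> {\<omega>\<in>space M. e < \<bar>?H \<omega>\<bar> \<and> (\<Sum>j<N. (h j \<omega>)\<^sup>2 * (q (Suc j) - q j)) \<le> d}"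
    then have \<omega>: "\<omega> \<in> space M" "e < \<bar>?H \<omega>\<bar>" "V N \<omega> \<le> d" by (auto simp: V_def)
    have "?G \<omega> = ?H \<omega>"
      using Vmono[of _ \<omega>] \<omega>(3) by (intro sum.cong refl) (force simp: g_def)
    moreover have "e\<^sup>2 \<le> (?H \<omega>)\<^sup>2" using \<omega>(2) e by (simp add: abs_le_square_iff[symmetric])
    ultimately show "\<omega> \<in> {\<omega>\<in>space M. e\<^sup>2 \<le> (?G \<omega>)\<^sup>2}" using \<omega>(1) by simp
  qed measurable
  also have "\<dots> \<le> (LINT \<omega>|M. (?G \<omega>)\<^sup>2) / e\<^sup>2"
    using e iso(2) by (intro integral_Markov_inequality_measure[where A = "{}"]) auto
  also have "\<dots> \<le> d / e\<^sup>2" using EG e by (intro divide_right_mono) auto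
  finally show ?thesis .
qed

end

section \<open>Simple integrands on a common refinement of their partitions\<close>

lemma finite_set_grid:
  assumes "finite (P :: real set)" "P \<noteq> {}"
  obtains q :: "nat \<Rightarrow> real" and N where "strict_mono_on {0..N} q" "q ` {0..N} = P"
proof -
  let ?l = "sorted_list_of_set P"
  have len: "length ?l = card P" "card P > 0" using assms by (auto simp: card_gt_0_iff)
  have "strict_mono_on {0..card P - 1} (\<lambda>j. ?l ! j)"
    using len by (intro strict_mono_onI) (auto intro!: sorted_wrt_nth_less[OF strict_sorted_list_of_set])
  moreover have "(\<lambda>j. ?l ! j) ` {0..card P - 1} = P"
  proof -
    have "{0..card P - 1} = {0..<length ?l}" using len by auto
    then have "(\<lambda>j. ?l ! j) ` {0..card P - 1} = set ?l" by (metis list.set_map map_nth set_upt)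
    then show ?thesis using assms by simp
  qed
  ultimately show ?thesis by (rule that)
qed

context
  fixes m N :: nat and p q :: "nat \<Rightarrow> real"
  assumes q: "strict_mono_on {0..N} q" and pq: "p ` {0..m} \<subseteq> q ` {0..N}" and p: "mono_on {0..m} p"
begin

lemma grid_less_iff: "i \<le> N \<Longrightarrow> j \<le> N \<Longrightarrow> q i < q j \<longleftrightarrow> i < j"
  using strict_mono_on_less[OF q, of i j] by auto

lemma partition_in_grid: "i \<le> m \<Longrightarrow> \<exists>a\<le>N. p i = q a"
  using pq by force

text \<open>No partition point lies strictly inside a grid cell, so half-open indicators are
  constant on half-open cells and may be evaluated at the right end.\<close>

lemma partition_indicator_grid:
  assumes "i < m" "j < N" "q j < s" "s \<le> q (Suc j)"
  shows "indicator {p i<..p (Suc i)} s = (indicator {p i<..p (Suc i)} (q (Suc j)) :: real)"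
proof -
  obtain a b where ab: "a \<le> N" "p i = q a" "b \<le> N" "p (Suc i) = q b"
    using partition_in_grid[of i] partition_in_grid[of "Suc i"] assms(1) by auto
  have "q a < s \<longleftrightarrow> q a < q (Suc j)"
  proof
    assume "q a < q (Suc j)"
    then have "a \<le> j" using grid_less_iff[of a "Suc j"] ab assms by auto
    then have "\<not> q j < q a" using grid_less_iff[of j a] ab assms by auto
    then show "q a < s" using assms by simp
  qed (use assms in simp)
  moreover have "s \<le> q b \<longleftrightarrow> q (Suc j) \<le> q b"
  proof
    assume "s \<le> q b"
    then have "j < b" using grid_less_iff[of j b] ab assms by auto
    then have "\<not> q b < q (Suc j)" using grid_less_iff[of b "Suc j"] ab assms by auto
    then show "q (Suc j) \<le> q b" by simp
  qed (use assms in simp)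
  ultimately show ?thesis using ab by (simp add: indicator_def)
qed

lemma simple_process_grid:
  assumes "j < N" "q j < s" "s \<le> q (Suc j)"
  shows "simple_process m p \<xi> s \<omega> = simple_process m p \<xi> (q (Suc j)) \<omega>"
  unfolding simple_process_def
  using partition_indicator_grid[OF _ assms] by (intro sum.cong refl) auto

text \<open>The increment over a partition step telescopes over the grid cells that it contains.
  Partition points may repeat while the grid is strict; a repeated point gives an empty sum.\<close>

lemma simple_ito_grid:
  "simple_ito B m p \<xi> \<omega> = (\<Sum>j<N. simple_process m p \<xi> (q (Suc j)) \<omega> * (B (q (Suc j)) \<omega> - B (q j) \<omega>))"
proof -
  have tele: "(\<Sum>j<N. indicator {p i<..p (Suc i)} (q (Suc j)) * (B (q (Suc j)) \<omega> - B (q j) \<omega>)) =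
      B (p (Suc i)) \<omega> - B (p i) \<omega>" if i: "i < m" for i
  proof -
    obtain a b where ab: "a \<le> N" "p i = q a" "b \<le> N" "p (Suc i) = q b"
      using partition_in_grid[of i] partition_in_grid[of "Suc i"] i by auto
    have "p i \<le> p (Suc i)" using mono_onD[OF p, of i "Suc i"] i by auto
    then have le: "a \<le> b" using grid_less_iff[of b a] ab by auto
    have ind: "indicator {p i<..p (Suc i)} (q (Suc j)) = (if j \<in> {a..<b} then 1 else 0 :: real)" if "j < N" for j
      using grid_less_iff[of a "Suc j"] grid_less_iff[of b "Suc j"] ab that by (auto simp: indicator_def)
    have "(\<Sum>j<N. indicator {p i<..p (Suc i)} (q (Suc j)) * (B (q (Suc j)) \<omega> - B (q j) \<omega>)) =
        (\<Sum>j<N. if j \<in> {a..<b} then B (q (Suc j)) \<omega> - B (q j) \<omega> else 0)"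
      using ind by (intro sum.cong refl) auto
    also have "\<dots> = (\<Sum>j\<in>{a..<b}. B (q (Suc j)) \<omega> - B (q j) \<omega>)"
      using ab by (subst sum.inter_restrict[symmetric]) (auto intro!: sum.cong)
    also have "\<dots> = B (q b) \<omega> - B (q a) \<omega>"
      using le by (rule sum_Suc_diff')
    finally show ?thesis using ab by simp
  qed
  have "(\<Sum>j<N. simple_process m p \<xi> (q (Suc j)) \<omega> * (B (q (Suc j)) \<omega> - B (q j) \<omega>)) =
      (\<Sum>j<N. \<Sum>i<m. \<xi> i \<omega> * (indicator {p i<..p (Suc i)} (q (Suc j)) * (B (q (Suc j)) \<omega> - B (q j) \<omega>)))"
    unfolding simple_process_def by (simp only: sum_distrib_right mult.assoc)
  also have "\<dots> = (\<Sum>i<m. \<xi> i \<omega> * (\<Sum>j<N. indicator {p i<..p (Suc i)} (q (Suc j)) * (B (q (Suc j)) \<omega> - B (q j) \<omega>)))"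
    by (subst sum.swap) (simp only: sum_distrib_left)
  also have "\<dots> = simple_ito B m p \<xi> \<omega>"
    unfolding simple_ito_def using tele by (intro sum.cong refl) auto
  finally show ?thesis by simp
qed

end

text \<open>The cells are disjoint and contained in [0, t], so the sum is the energy over their
  union.\<close>

lemma grid_energy_le:
  assumes q: "strict_mono_on {0..N} q" "0 \<le> q 0" "q N \<le> t"
    and H: "\<And>j s. j < N \<Longrightarrow> q j < s \<Longrightarrow> s \<le> q (Suc j) \<Longrightarrow> H s = H (q (Suc j))"
  shows "ennreal (\<Sum>j<N. (H (q (Suc j)))\<^sup>2 * (q (Suc j) - q j)) \<le> (\<integral>\<^sup>+s\<in>{0..t}. ennreal ((H s)\<^sup>2) \<partial>lborel)"
proof -
  have less: "i \<le> N \<Longrightarrow> j \<le> N \<Longrightarrow> q i < q j \<longleftrightarrow> i < j" for i j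
    using strict_mono_on_less[OF q(1), of i j] by auto
  have le: "q i \<le> q j" if "i \<le> j" "j \<le> N" for i j using less[of j i] that by auto
  have "ennreal (\<Sum>j<N. (H (q (Suc j)))\<^sup>2 * (q (Suc j) - q j)) =
    (\<Sum>j<N. \<integral>\<^sup>+s. ennreal ((H (q (Suc j)))\<^sup>2) * indicator {q j<..q (Suc j)} s \<partial>lborel)"
  proof (subst sum_ennreal[symmetric])
    show "(\<Sum>j<N. ennreal ((H (q (Suc j)))\<^sup>2 * (q (Suc j) - q j))) =
      (\<Sum>j<N. \<integral>\<^sup>+s. ennreal ((H (q (Suc j)))\<^sup>2) * indicator {q j<..q (Suc j)} s \<partial>lborel)"
    proof (intro sum.cong refl)
      fix j assume "j \<in> {..<N}"
      then have "q j \<le> q (Suc j)" using le by auto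
      then show "ennreal ((H (q (Suc j)))\<^sup>2 * (q (Suc j) - q j)) =
        (\<integral>\<^sup>+s. ennreal ((H (q (Suc j)))\<^sup>2) * indicator {q j<..q (Suc j)} s \<partial>lborel)"
        by (subst nn_integral_cmult_indicator) (auto simp: ennreal_mult)
    qed
  qed (use le in auto)
  also have "\<dots> = (\<integral>\<^sup>+s. (\<Sum>j<N. ennreal ((H (q (Suc j)))\<^sup>2) * indicator {q j<..q (Suc j)} s) \<partial>lborel)"
    by (subst nn_integral_sum) auto
  also have "\<dots> \<le> (\<integral>\<^sup>+s\<in>{0..t}. ennreal ((H s)\<^sup>2) \<partial>lborel)"
  proof (intro nn_integral_mono)
    fix s :: real
    show "(\<Sum>j<N. ennreal ((H (q (Suc j)))\<^sup>2) * indicator {q j<..q (Suc j)} s) \<le> ennreal ((H s)\<^sup>2) * indicator {0..t} s"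
    proof (cases "\<exists>k<N. q k < s \<and> s \<le> q (Suc k)")
      case True
      then obtain k where k: "k < N" "q k < s" "s \<le> q (Suc k)" by auto
      have uniq: "j = k" if "j < N" "q j < s" "s \<le> q (Suc j)" for j
      proof -
        have "q j < q (Suc k)" "q k < q (Suc j)" using that k by linarith+
        then have "j < Suc k" "k < Suc j"
          using less[of j "Suc k"] less[of k "Suc j"] that(1) k(1) by simp_all
        then show ?thesis by simp
      qed
      have "(\<Sum>j<N. ennreal ((H (q (Suc j)))\<^sup>2) * indicator {q j<..q (Suc j)} s) =
          (\<Sum>j<N. if j = k then ennreal ((H (q (Suc k)))\<^sup>2) else 0)"
      proof (intro sum.cong refl)
        fix j assume "j \<in> {..<N}"
        then have "s \<in> {q j<..q (Suc j)} \<longleftrightarrow> j = k" using k uniq[of j] by fastforce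
        then show "ennreal ((H (q (Suc j)))\<^sup>2) * indicator {q j<..q (Suc j)} s =
          (if j = k then ennreal ((H (q (Suc k)))\<^sup>2) else 0)"
          by (simp add: indicator_def)
      qed
      also have "\<dots> = ennreal ((H (q (Suc k)))\<^sup>2)" using k(1) by simp
      also have "\<dots> = ennreal ((H s)\<^sup>2) * indicator {0..t} s"
      proof -
        have "q 0 \<le> q k" "q (Suc k) \<le> q N" using le[of 0 k] le[of "Suc k" N] k(1) by auto
        then have "0 \<le> s" "s \<le> t" using k q(2,3) by linarith+
        then show ?thesis unfolding H[OF k] by simp
      qed
      finally show ?thesis by simp
    next
      case False
      then have "(\<Sum>j<N. ennreal ((H (q (Suc j)))\<^sup>2) * indicator {q j<..q (Suc j)} s) = 0"
        by (intro sum.neutral) (auto split: split_indicator)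
      then show ?thesis by simp
    qed
  qed
  finally show ?thesis .
qed

section \<open>Increments of the It\^o integral\<close>

context adapted_brownian_motion
begin

section \<open>Simple integrals and the measurability of energies\<close>

lemma ident_measurable_F: "t \<in> {0..T} \<Longrightarrow> (\<lambda>\<omega>. \<omega>) \<in> measurable M (F t)"
  using subalg[of t] by (intro measurableI) (auto simp: subalgebra_def)

text \<open>Clamping the time to [0, t] extends the process to all real times without changing it on
  [0, t], so that \<open>restrict_space\<close> disappears and theorems on product measures apply
  directly.\<close>

lemma progressively_measurable_joint:
  assumes X: "progressively_measurable F t X" and t: "t \<in> {0..T}"
  shows "(\<lambda>x. X (max 0 (min (snd x) t)) (fst x)) \<in> borel_measurable (M \<Otimes>\<^sub>M borel)"
proof -
  have a: "(\<lambda>x. (max 0 (min (snd x) t), fst x)) \<in> measurable (M \<Otimes>\<^sub>M borel) (restrict_space borel {0..t} \<Otimes>\<^sub>M F t)"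
  proof (rule measurable_Pair)
    show "(\<lambda>x. max 0 (min (snd x) t)) \<in> measurable (M \<Otimes>\<^sub>M borel) (restrict_space borel {0..t})"
      using t by (intro measurable_restrict_space2) auto
    show "fst \<in> measurable (M \<Otimes>\<^sub>M borel) (F t)"
      by (rule measurable_compose[OF measurable_fst ident_measurable_F[OF t]])
  qed
  have b: "(\<lambda>(s, \<omega>). X s \<omega>) \<in> borel_measurable (restrict_space borel {0..t} \<Otimes>\<^sub>M F t)"
    using X t by (auto simp: progressively_measurable_def)
  from measurable_compose[OF a b] show ?thesis by simp
qed

lemma energy_measurable:
  fixes a b :: real
  assumes [measurable]: "(\<lambda>x. H (snd x) (fst x)) \<in> borel_measurable (M \<Otimes>\<^sub>M borel)"
  shows "(\<lambda>\<omega>. \<integral>\<^sup>+s\<in>{a..b}. ennreal ((H s \<omega>)\<^sup>2) \<partial>lborel) \<in> borel_measurable M"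
proof -
  have [measurable]: "(\<lambda>x. H (snd x) (fst x)) \<in> borel_measurable (M \<Otimes>\<^sub>M lborel)"
    using assms by (simp cong: measurable_cong_sets sets_pair_measure_cong)
  have "(\<lambda>\<omega>. \<integral>\<^sup>+s. (\<lambda>x. ennreal ((H (snd x) (fst x))\<^sup>2) * indicator {a..b} (snd x)) (\<omega>, s) \<partial>lborel) \<in> borel_measurable M"
    by (rule lborel.borel_measurable_nn_integral_fst) measurable
  then show ?thesis by simp
qed

lemma simple_integrand_partition:
  assumes "simple_integrand F t m p \<xi>" "i \<le> m"
  shows "p i \<in> {0..t}"
proof -
  have p: "p 0 = 0" "p m = t" "mono_on {0..m} p" using assms(1) by (auto simp: simple_integrand_def)
  then show ?thesis
    using mono_onD[OF p(3), of 0 i] mono_onD[OF p(3), of i m] assms(2) by auto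
qed

text \<open>A value \<open>\<xi> i\<close> contributes to a cell only if \<open>p i\<close> lies
  before its right end, hence, both being grid points, not after its left end. The process at the
  right end is therefore known at the left end.\<close>

lemma simple_process_predictable:
  assumes S: "simple_integrand F t m p \<xi>" and t: "t \<le> T"
    and q: "strict_mono_on {0..N} q" "q ` {0..N} \<subseteq> {0..T}" and pq: "p ` {0..m} \<subseteq> q ` {0..N}" and j: "j < N"
  shows "(\<lambda>\<omega>. simple_process m p \<xi> (q (Suc j)) \<omega>) \<in> borel_measurable (F (q j))"
    and "\<exists>C. \<forall>\<omega>\<in>space M. \<bar>simple_process m p \<xi> (q (Suc j)) \<omega>\<bar> \<le> C"
proof -
  have p: "mono_on {0..m} p" and \<xi>: "\<And>i. i < m \<Longrightarrow> \<xi> i \<in> borel_measurable (F (p i))"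
    and bd: "\<And>i. i < m \<Longrightarrow> \<exists>C. \<forall>\<omega>\<in>space (F (p i)). \<bar>\<xi> i \<omega>\<bar> \<le> C"
    using S by (auto simp: simple_integrand_def)
  have "q j \<in> q ` {0..N}" using j by simp
  then have qT: "q j \<in> {0..T}" using q(2) by blast
  have pT: "p i \<in> {0..T}" if "i < m" for i using simple_integrand_partition[OF S, of i] that t by auto
  show "(\<lambda>\<omega>. simple_process m p \<xi> (q (Suc j)) \<omega>) \<in> borel_measurable (F (q j))"
    unfolding simple_process_def
  proof (intro borel_measurable_sum)
    fix i assume i: "i \<in> {..<m}"
    show "(\<lambda>\<omega>. \<xi> i \<omega> * indicator {p i<..p (Suc i)} (q (Suc j))) \<in> borel_measurable (F (q j))"
    proof (cases "p i < q (Suc j)")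
      case True
      obtain a where a: "a \<le> N" "p i = q a" using partition_in_grid[OF q(1) pq p, of i] i by auto
      then have "a < Suc j" using True grid_less_iff[OF q(1) pq p, of a "Suc j"] j by auto
      then have "\<not> q j < q a" using grid_less_iff[OF q(1) pq p, of j a] a j by auto
      then have "p i \<le> q j" using a by simp
      moreover have "i < m" "0 \<le> p i" "q j \<le> T" using pT[of i] qT i by simp_all
      ultimately have "\<xi> i \<in> borel_measurable (F (q j))"
        using measurable_F_mono \<xi> by blast
      then show ?thesis by simp
    qed simp
  qed
  have "\<forall>i\<in>{..<m}. \<exists>C. \<forall>\<omega>\<in>space M. \<bar>\<xi> i \<omega>\<bar> \<le> C"
  proof
    fix i assume "i \<in> {..<m}"
    then have "i < m" by simp
    then show "\<exists>C. \<forall>\<omega>\<in>space M. \<bar>\<xi> i \<omega>\<bar> \<le> C"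
      using bd[of i] space_F[OF pT[of i]] by simp
  qed
  from bchoice[OF this] obtain C where "\<forall>i\<in>{..<m}. \<forall>\<omega>\<in>space M. \<bar>\<xi> i \<omega>\<bar> \<le> C i" ..
  then have C: "\<And>i \<omega>. i < m \<Longrightarrow> \<omega> \<in> space M \<Longrightarrow> \<bar>\<xi> i \<omega>\<bar> \<le> C i" by simp
  show "\<exists>C. \<forall>\<omega>\<in>space M. \<bar>simple_process m p \<xi> (q (Suc j)) \<omega>\<bar> \<le> C"
  proof (intro exI ballI)
    fix \<omega> assume \<omega>: "\<omega> \<in> space M"
    have "\<bar>simple_process m p \<xi> (q (Suc j)) \<omega>\<bar> \<le> (\<Sum>i<m. \<bar>\<xi> i \<omega> * indicator {p i<..p (Suc i)} (q (Suc j))\<bar>)"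
      unfolding simple_process_def by (rule sum_abs)
    also have "\<dots> \<le> (\<Sum>i<m. \<bar>C i\<bar>)"
    proof (intro sum_mono)
      fix i assume "i \<in> {..<m}"
      then have "\<bar>\<xi> i \<omega>\<bar> \<le> \<bar>C i\<bar>" using C[of i \<omega>] \<omega> by auto
      then show "\<bar>\<xi> i \<omega> * indicator {p i<..p (Suc i)} (q (Suc j))\<bar> \<le> \<bar>C i\<bar>"
        by (auto simp: indicator_def)
    qed
    finally show "\<bar>simple_process m p \<xi> (q (Suc j)) \<omega>\<bar> \<le> (\<Sum>i<m. \<bar>C i\<bar>)" .
  qed
qed

lemma simple_ito_measurable:
  assumes S: "simple_integrand F t m p \<xi>" and t: "t \<le> T"
  shows "simple_ito B m p \<xi> \<in> borel_measurable M"
    and "(\<lambda>x. simple_process m p \<xi> (snd x) (fst x)) \<in> borel_measurable (M \<Otimes>\<^sub>M borel)"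
proof -
  have [measurable]: "\<xi> i \<in> borel_measurable M" "B (p i) \<in> borel_measurable M"
    "B (p (Suc i)) \<in> borel_measurable M" if "i \<in> {..<m}" for i
  proof -
    have "p i \<in> {0..T}" "p (Suc i) \<in> {0..T}"
      using simple_integrand_partition[OF S, of i] simple_integrand_partition[OF S, of "Suc i"] that t by auto
    then show "\<xi> i \<in> borel_measurable M" "B (p i) \<in> borel_measurable M" "B (p (Suc i)) \<in> borel_measurable M"
      using S that measurable_F_M adapted by (auto simp: simple_integrand_def)
  qed
  show "simple_ito B m p \<xi> \<in> borel_measurable M"
    unfolding simple_ito_def[abs_def] by measurable
  show "(\<lambda>x. simple_process m p \<xi> (snd x) (fst x)) \<in> borel_measurable (M \<Otimes>\<^sub>M borel)"
    unfolding simple_process_def by measurable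
qed

lemma simple_integrand_tail:
  assumes r: "0 \<le> r" "r \<le> t" "t \<le> T" and "\<eta> \<in> borel_measurable (F r)" "\<And>\<omega>. \<omega> \<in> space M \<Longrightarrow> \<bar>\<eta> \<omega>\<bar> \<le> C"
  defines "p \<equiv> \<lambda>i::nat. if i = 0 then 0 else if i = 1 then r else t"
    and "\<xi> \<equiv> \<lambda>i::nat. if i = 0 then (\<lambda>_. 0) else \<eta>"
  shows "simple_integrand F t 2 p \<xi>"
    "simple_process 2 p \<xi> s \<omega> = \<eta> \<omega> * indicator {r<..t} s"
    "simple_ito B 2 p \<xi> \<omega> = \<eta> \<omega> * (B t \<omega> - B r \<omega>)"
proof -
  have "mono_on {0..2} p" using r by (intro mono_onI) (auto simp: p_def)
  then show "simple_integrand F t 2 p \<xi>"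
  proof -
    have "\<forall>\<omega>\<in>space (F r). \<bar>\<eta> \<omega>\<bar> \<le> \<bar>C\<bar>"
      using assms(5) space_F[of r] r by fastforce
    then have "\<forall>i<2. \<xi> i \<in> borel_measurable (F (p i)) \<and> (\<exists>C. \<forall>\<omega>\<in>space (F (p i)). \<bar>\<xi> i \<omega>\<bar> \<le> C)"
      using assms(4) by (auto simp: p_def \<xi>_def less_Suc_eq numeral_2_eq_2)
    then show ?thesis
      using \<open>mono_on {0..2} p\<close> by (simp add: simple_integrand_def p_def)
  qed
  show "simple_process 2 p \<xi> s \<omega> = \<eta> \<omega> * indicator {r<..t} s"
    by (simp add: simple_process_def p_def \<xi>_def numeral_2_eq_2)
  show "simple_ito B 2 p \<xi> \<omega> = \<eta> \<omega> * (B t \<omega> - B r \<omega>)"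
    by (simp add: simple_ito_def p_def \<xi>_def numeral_2_eq_2)
qed

lemma simple_difference_lenglart:
  assumes r: "0 \<le> r" "r \<le> t" "t \<le> T"
    and \<eta>: "\<eta> \<in> borel_measurable (F r)" "\<And>\<omega>. \<omega> \<in> space M \<Longrightarrow> \<bar>\<eta> \<omega>\<bar> \<le> C"
    and S: "simple_integrand F t m p \<xi>" and S': "simple_integrand F r m' p' \<xi>'"
    and e: "0 < e" and d: "0 \<le> d"
  shows "measure M {\<omega>\<in>space M.
      e < \<bar>simple_ito B m p \<xi> \<omega> - simple_ito B m' p' \<xi>' \<omega> - \<eta> \<omega> * (B t \<omega> - B r \<omega>)\<bar> \<and>
      (\<integral>\<^sup>+s\<in>{0..t}. ennreal ((simple_process m p \<xi> s \<omega> - simple_process m' p' \<xi>' s \<omega>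
         - \<eta> \<omega> * indicator {r<..t} s)\<^sup>2) \<partial>lborel) \<le> ennreal d} \<le> d / e\<^sup>2"
proof -
  define p3 where "p3 = (\<lambda>i::nat. if i = 0 then 0 else if i = 1 then r else t)"
  define \<xi>3 where "\<xi>3 = (\<lambda>i::nat. if i = 0 then (\<lambda>_. 0) else \<eta>)"
  note tail = simple_integrand_tail[OF r \<eta>, folded p3_def \<xi>3_def]
  have tail2: "simple_process 2 p3 \<xi>3 s \<omega> = \<eta> \<omega> * indicator {r<..t} s" for s \<omega>
    by (rule tail(2))
  define H where "H s \<omega> = simple_process m p \<xi> s \<omega> - simple_process m' p' \<xi>' s \<omega> - simple_process 2 p3 \<xi>3 s \<omega>" for s \<omega>
  let ?P = "p ` {0..m} \<union> p' ` {0..m'} \<union> p3 ` {0..2}"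
  have "finite ?P" "?P \<noteq> {}" by auto
  then obtain q and N :: nat where q: "strict_mono_on {0..N} q" "q ` {0..N} = ?P"
    by (rule finite_set_grid)
  have P: "?P \<subseteq> {0..t}"
    using simple_integrand_partition[OF S] simple_integrand_partition[OF S'] simple_integrand_partition[OF tail(1)] r
    by fastforce
  then have qt: "q j \<in> {0..t}" if "j \<le> N" for j
  proof -
    have "q j \<in> q ` {0..N}" using that by simp
    then show ?thesis using P q(2) by blast
  qed
  have qT: "q ` {0..N} \<subseteq> {0..T}" using qt r by fastforce
  have sub: "p ` {0..m} \<subseteq> q ` {0..N}" "p' ` {0..m'} \<subseteq> q ` {0..N}" "p3 ` {0..2} \<subseteq> q ` {0..N}"
    using q(2) by auto
  have mono: "mono_on {0..m} p" "mono_on {0..m'} p'" "mono_on {0..2} p3"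
    using S S' tail(1) by (auto simp: simple_integrand_def)
  have rT: "r \<le> T" using r by simp
  note grid = q(1) sub(1) mono(1) and grid' = q(1) sub(2) mono(2) and grid3 = q(1) sub(3) mono(3)
  have Hc: "H s \<omega> = H (q (Suc j)) \<omega>" if "j < N" "q j < s" "s \<le> q (Suc j)" for j s \<omega>
    unfolding H_def simple_process_grid[OF grid that, of \<xi> \<omega>] simple_process_grid[OF grid' that, of \<xi>' \<omega>]
      simple_process_grid[OF grid3 that, of \<xi>3 \<omega>] ..
  have HF: "(\<lambda>\<omega>. H (q (Suc j)) \<omega>) \<in> borel_measurable (F (q j))" if "j < N" for j
    unfolding H_def using simple_process_predictable(1)[OF S r(3) q(1) qT sub(1) that]
      simple_process_predictable(1)[OF S' rT q(1) qT sub(2) that]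
      simple_process_predictable(1)[OF tail(1) r(3) q(1) qT sub(3) that]
    by (intro borel_measurable_diff)
  have Hbd: "\<exists>C. \<forall>\<omega>\<in>space M. \<bar>H (q (Suc j)) \<omega>\<bar> \<le> C" if jN: "j < N" for j
  proof -
    obtain C1 C2 C3 where "\<forall>\<omega>\<in>space M. \<bar>simple_process m p \<xi> (q (Suc j)) \<omega>\<bar> \<le> C1"
      "\<forall>\<omega>\<in>space M. \<bar>simple_process m' p' \<xi>' (q (Suc j)) \<omega>\<bar> \<le> C2"
      "\<forall>\<omega>\<in>space M. \<bar>simple_process 2 p3 \<xi>3 (q (Suc j)) \<omega>\<bar> \<le> C3"
      using simple_process_predictable(2)[OF S r(3) q(1) qT sub(1) jN]
      simple_process_predictable(2)[OF S' rT q(1) qT sub(2) jN]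
      simple_process_predictable(2)[OF tail(1) r(3) q(1) qT sub(3) jN] by blast
    then have "\<forall>\<omega>\<in>space M. \<bar>H (q (Suc j)) \<omega>\<bar> \<le> C1 + C2 + C3"
      unfolding H_def by fastforce
    then show ?thesis by blast
  qed
  have Z: "simple_ito B m p \<xi> \<omega> - simple_ito B m' p' \<xi>' \<omega> - \<eta> \<omega> * (B t \<omega> - B r \<omega>) =
      (\<Sum>j<N. H (q (Suc j)) \<omega> * (B (q (Suc j)) \<omega> - B (q j) \<omega>))" for \<omega>
  proof -
    have "\<eta> \<omega> * (B t \<omega> - B r \<omega>) =
      (\<Sum>j<N. simple_process 2 p3 \<xi>3 (q (Suc j)) \<omega> * (B (q (Suc j)) \<omega> - B (q j) \<omega>))"
      using tail(3)[of \<omega>] simple_ito_grid[OF grid3, of B \<xi>3 \<omega>] by (simp only:)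
    then show ?thesis
      unfolding simple_ito_grid[OF grid] simple_ito_grid[OF grid'] H_def
      by (simp only: sum_subtractf[symmetric] left_diff_distrib)
  qed
  have qm: "mono_on {0..N} q" using q(1) by (rule strict_mono_on_imp_mono_on)
  have [measurable]: "(\<lambda>\<omega>. H (q (Suc j)) \<omega>) \<in> borel_measurable M" "B (q j) \<in> borel_measurable M"
    "B (q (Suc j)) \<in> borel_measurable M" if "j \<in> {..<N}" for j
  proof -
    have "q j \<in> {0..T}" "q (Suc j) \<in> {0..T}" "j < N" using qt[of j] qt[of "Suc j"] r that by auto
    then show "(\<lambda>\<omega>. H (q (Suc j)) \<omega>) \<in> borel_measurable M" "B (q j) \<in> borel_measurable M"
      "B (q (Suc j)) \<in> borel_measurable M"
      using HF measurable_F_M adapted by auto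
  qed
  have "measure M {\<omega>\<in>space M.
      e < \<bar>simple_ito B m p \<xi> \<omega> - simple_ito B m' p' \<xi>' \<omega> - \<eta> \<omega> * (B t \<omega> - B r \<omega>)\<bar> \<and>
      (\<integral>\<^sup>+s\<in>{0..t}. ennreal ((simple_process m p \<xi> s \<omega> - simple_process m' p' \<xi>' s \<omega>
         - \<eta> \<omega> * indicator {r<..t} s)\<^sup>2) \<partial>lborel) \<le> ennreal d}
    \<le> measure M {\<omega>\<in>space M. e < \<bar>\<Sum>j<N. H (q (Suc j)) \<omega> * (B (q (Suc j)) \<omega> - B (q j) \<omega>)\<bar> \<and>
      (\<Sum>j<N. (H (q (Suc j)) \<omega>)\<^sup>2 * (q (Suc j) - q j)) \<le> d}"
  proof (intro finite_measure_mono Collect_mono impI conjI)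
    fix \<omega> assume a: "\<omega> \<in> space M \<and> e < \<bar>simple_ito B m p \<xi> \<omega> - simple_ito B m' p' \<xi>' \<omega> - \<eta> \<omega> * (B t \<omega> - B r \<omega>)\<bar> \<and>
      (\<integral>\<^sup>+s\<in>{0..t}. ennreal ((simple_process m p \<xi> s \<omega> - simple_process m' p' \<xi>' s \<omega>
         - \<eta> \<omega> * indicator {r<..t} s)\<^sup>2) \<partial>lborel) \<le> ennreal d"
    then show "\<omega> \<in> space M" "e < \<bar>\<Sum>j<N. H (q (Suc j)) \<omega> * (B (q (Suc j)) \<omega> - B (q j) \<omega>)\<bar>"
      unfolding Z by auto
    have "ennreal (\<Sum>j<N. (H (q (Suc j)) \<omega>)\<^sup>2 * (q (Suc j) - q j)) \<le> (\<integral>\<^sup>+s\<in>{0..t}. ennreal ((H s \<omega>)\<^sup>2) \<partial>lborel)"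
    proof (rule grid_energy_le[OF q(1)])
      show "H s \<omega> = H (q (Suc j)) \<omega>" if "j < N" "q j < s" "s \<le> q (Suc j)" for j s
        using that by (rule Hc)
    qed (use qt[of 0] qt[of N] in auto)
    also have "\<dots> \<le> ennreal d" using a by (simp only: H_def tail2)
    finally show "(\<Sum>j<N. (H (q (Suc j)) \<omega>)\<^sup>2 * (q (Suc j) - q j)) \<le> d" using d by simp
  qed measurable
  also have "\<dots> \<le> d / e\<^sup>2"
    by (rule elementary_lenglart[OF qm _ _ HF Hbd e d]) (use qt[of 0] qt[of N] r in auto)
  finally show ?thesis .
qed

lemma simple_process_eq_0:
  assumes "simple_integrand F t m p \<xi>" "t < s"
  shows "simple_process m p \<xi> s \<omega> = 0"
  unfolding simple_process_def
proof (intro sum.neutral ballI)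
  fix i assume "i \<in> {..<m}"
  then have "p (Suc i) \<le> t" using simple_integrand_partition[OF assms(1), of "Suc i"] by auto
  then show "\<xi> i \<omega> * indicator {p i<..p (Suc i)} s = 0" using assms(2) by simp
qed

text \<open>Insert \<open>X\<close>: up to \<open>r\<close> the difference is (S - X) + (X - S'),
  after \<open>r\<close> it is (S - X) + (X - c). Either case costs a factor 2, rounded up to 4 for
  the approximation errors, which will tend to 0.\<close>

lemma energy_difference_le:
  fixes S S' X :: "real \<Rightarrow> real" and c :: real
  assumes [measurable]: "S \<in> borel_measurable borel" "S' \<in> borel_measurable borel" "X \<in> borel_measurable borel"
    and r: "r \<le> t" and S': "\<And>s. r < s \<Longrightarrow> S' s = 0"
  shows "(\<integral>\<^sup>+s\<in>{0..t}. ennreal ((S s - S' s - c * indicator {r<..t} s)\<^sup>2) \<partial>lborel) \<le>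
    2 * (\<integral>\<^sup>+s\<in>{r..t}. ennreal ((X s - c)\<^sup>2) \<partial>lborel) +
    4 * (\<integral>\<^sup>+s\<in>{0..t}. ennreal ((S s - X s)\<^sup>2) \<partial>lborel) +
    4 * (\<integral>\<^sup>+s\<in>{0..r}. ennreal ((S' s - X s)\<^sup>2) \<partial>lborel)"
proof -
  have sq: "(u + v)\<^sup>2 \<le> 2 * u\<^sup>2 + 2 * v\<^sup>2" for u v :: real
    using zero_le_power2[of "u - v"] by (simp add: power2_eq_square algebra_simps)
  have pw: "ennreal ((S s - S' s - c * indicator {r<..t} s)\<^sup>2) * indicator {0..t} s \<le>
    2 * (ennreal ((X s - c)\<^sup>2) * indicator {r..t} s) + 4 * (ennreal ((S s - X s)\<^sup>2) * indicator {0..t} s) +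
    4 * (ennreal ((S' s - X s)\<^sup>2) * indicator {0..r} s)" for s
  proof (cases "s \<in> {0..t}")
    case True
    define w where "w = ennreal (2 * ((X s - c)\<^sup>2 * indicator {r..t} s) + 4 * ((S s - X s)\<^sup>2) + 4 * ((S' s - X s)\<^sup>2 * indicator {0..r} s))"
    have "(S s - S' s - c * indicator {r<..t} s)\<^sup>2 \<le>
      2 * ((X s - c)\<^sup>2 * indicator {r..t} s) + 4 * ((S s - X s)\<^sup>2) + 4 * ((S' s - X s)\<^sup>2 * indicator {0..r} s)"
    proof (cases "s \<le> r")
      case le: True
      have "(S s - S' s - c * indicator {r<..t} s)\<^sup>2 \<le> 2 * (S s - X s)\<^sup>2 + 2 * (S' s - X s)\<^sup>2"
        using sq[of "S s - X s" "X s - S' s"] le by (simp add: power2_commute)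
      also have "\<dots> \<le> 2 * ((X s - c)\<^sup>2 * indicator {r..t} s) + 4 * ((S s - X s)\<^sup>2) + 4 * ((S' s - X s)\<^sup>2 * indicator {0..r} s)"
      proof -
        have "indicator {0..r} s = (1::real)" using le True by simp
        then show ?thesis by simp
      qed
      finally show ?thesis .
    next
      case False
      then have "(S s - S' s - c * indicator {r<..t} s)\<^sup>2 \<le> 2 * (X s - c)\<^sup>2 + 2 * (S s - X s)\<^sup>2"
        using sq[of "S s - X s" "X s - c"] True S'[of s] by simp
      also have "\<dots> \<le> 2 * ((X s - c)\<^sup>2 * indicator {r..t} s) + 4 * ((S s - X s)\<^sup>2) + 4 * ((S' s - X s)\<^sup>2 * indicator {0..r} s)"
        using False True by simp
      finally show ?thesis .
    qed
    then have "ennreal ((S s - S' s - c * indicator {r<..t} s)\<^sup>2) \<le> w"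
      unfolding w_def by (rule ennreal_leI)
    also have "w = 2 * (ennreal ((X s - c)\<^sup>2) * indicator {r..t} s) + 4 * (ennreal ((S s - X s)\<^sup>2) * indicator {0..t} s) +
      4 * (ennreal ((S' s - X s)\<^sup>2) * indicator {0..r} s)"
      unfolding w_def using True
      by (simp add: ennreal_mult ennreal_indicator[symmetric] ennreal_plus del: ennreal_indicator)
    finally show ?thesis using True by simp
  qed simp
  have "(\<integral>\<^sup>+s\<in>{0..t}. ennreal ((S s - S' s - c * indicator {r<..t} s)\<^sup>2) \<partial>lborel) \<le>
    (\<integral>\<^sup>+s. 2 * (ennreal ((X s - c)\<^sup>2) * indicator {r..t} s) + 4 * (ennreal ((S s - X s)\<^sup>2) * indicator {0..t} s) +
    4 * (ennreal ((S' s - X s)\<^sup>2) * indicator {0..r} s) \<partial>lborel)"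
    by (intro nn_integral_mono pw)
  also have "\<dots> = 2 * (\<integral>\<^sup>+s\<in>{r..t}. ennreal ((X s - c)\<^sup>2) \<partial>lborel) +
    4 * (\<integral>\<^sup>+s\<in>{0..t}. ennreal ((S s - X s)\<^sup>2) \<partial>lborel) +
    4 * (\<integral>\<^sup>+s\<in>{0..r}. ennreal ((S' s - X s)\<^sup>2) \<partial>lborel)"
    by (simp add: nn_integral_add nn_integral_cmult)
  finally show ?thesis .
qed

lemma progressively_measurable_section:
  assumes X: "progressively_measurable F t X" and t: "t \<in> {0..T}" and \<omega>: "\<omega> \<in> space M"
  shows "(\<lambda>s. X (max 0 (min s t)) \<omega>) \<in> borel_measurable borel"
  using measurable_compose[OF measurable_Pair1'[OF \<omega>] progressively_measurable_joint[OF X t]] by simp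

lemma progressively_measurable_energy:
  assumes X: "progressively_measurable F t X" and t: "t \<in> {0..T}" and [measurable]: "\<eta> \<in> borel_measurable M"
    and r: "0 \<le> r"
  shows "(\<lambda>\<omega>. \<integral>\<^sup>+s\<in>{r..t}. ennreal ((X s \<omega> - \<eta> \<omega>)\<^sup>2) \<partial>lborel) \<in> borel_measurable M"
proof -
  note [measurable] = progressively_measurable_joint[OF X t]
  have "(\<lambda>\<omega>. \<integral>\<^sup>+s\<in>{r..t}. ennreal ((X (max 0 (min s t)) \<omega> - \<eta> \<omega>)\<^sup>2) \<partial>lborel) \<in> borel_measurable M"
    by (rule energy_measurable) measurable
  also have "(\<lambda>\<omega>. \<integral>\<^sup>+s\<in>{r..t}. ennreal ((X (max 0 (min s t)) \<omega> - \<eta> \<omega>)\<^sup>2) \<partial>lborel) =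
    (\<lambda>\<omega>. \<integral>\<^sup>+s\<in>{r..t}. ennreal ((X s \<omega> - \<eta> \<omega>)\<^sup>2) \<partial>lborel)"
    using r by (intro ext nn_integral_cong) (auto split: split_indicator simp: min_def max_def)
  finally show ?thesis .
qed

lemma approximation_energy_measurable:
  assumes X: "progressively_measurable F t X" and t: "t \<in> {0..T}" and S: "simple_integrand F t m p \<xi>"
  shows "(\<lambda>\<omega>. \<integral>\<^sup>+s\<in>{0..t}. ennreal ((simple_process m p \<xi> s \<omega> - X s \<omega>)\<^sup>2) \<partial>lborel) \<in> borel_measurable M"
proof -
  have tT: "t \<le> T" using t by simp
  note [measurable] = progressively_measurable_joint[OF X t] simple_ito_measurable(2)[OF S tT]
  have "(\<lambda>\<omega>. \<integral>\<^sup>+s\<in>{0..t}. ennreal ((simple_process m p \<xi> s \<omega> - X (max 0 (min s t)) \<omega>)\<^sup>2) \<partial>lborel) \<in> borel_measurable M"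
    by (rule energy_measurable) measurable
  also have "(\<lambda>\<omega>. \<integral>\<^sup>+s\<in>{0..t}. ennreal ((simple_process m p \<xi> s \<omega> - X (max 0 (min s t)) \<omega>)\<^sup>2) \<partial>lborel) =
    (\<lambda>\<omega>. \<integral>\<^sup>+s\<in>{0..t}. ennreal ((simple_process m p \<xi> s \<omega> - X s \<omega>)\<^sup>2) \<partial>lborel)"
    by (intro ext nn_integral_cong) (auto split: split_indicator simp: min_def max_def)
  finally show ?thesis .
qed

text \<open>The estimate for simple integrands is applied to the k-th approximants at both times,
  and k tends to infinity. \<open>A\<close> may be any event, even one that depends on the future:
  it restricts the energy event and is dropped from the simple estimate. With \<open>\<eta>\<close>
  the coefficient at time \<open>r\<close> this is the cost of freezing; with \<open>\<eta>\<close>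
  zero it bounds increments of the integral.\<close>

lemma ito_difference_bound:
  assumes Y: "has_ito_integral M F B t X Y" and Y': "has_ito_integral M F B r X Y'"
    and r: "0 \<le> r" "r \<le> t" "t \<le> T"
    and \<eta>: "\<eta> \<in> borel_measurable (F r)" "\<And>\<omega>. \<omega> \<in> space M \<Longrightarrow> \<bar>\<eta> \<omega>\<bar> \<le> C"
    and A: "A \<in> sets M" and e: "0 < e" and d: "0 < d"
  shows "measure M {\<omega>\<in>A. e < \<bar>Y \<omega> - Y' \<omega> - \<eta> \<omega> * (B t \<omega> - B r \<omega>)\<bar>} \<le>
    measure M {\<omega>\<in>A. ennreal d < (\<integral>\<^sup>+s\<in>{r..t}. ennreal ((X s \<omega> - \<eta> \<omega>)\<^sup>2) \<partial>lborel)} + 16 * d / e\<^sup>2"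
proof -
  have tT: "t \<in> {0..T}" and rT: "r \<in> {0..T}" using r by auto
  have X: "progressively_measurable F t X" and X': "progressively_measurable F r X"
    and Ym [measurable]: "Y \<in> borel_measurable M" and Ym' [measurable]: "Y' \<in> borel_measurable M"
    using Y Y' by (auto simp: has_ito_integral_def)
  have [measurable]: "\<eta> \<in> borel_measurable M" "B t \<in> borel_measurable M" "B r \<in> borel_measurable M"
    using measurable_F_M[OF rT \<eta>(1)] measurable_F_M[OF tT adapted[OF tT]] measurable_F_M[OF rT adapted[OF rT]] .
  obtain m p \<xi> where S: "\<And>k. simple_integrand F t (m k) (p k) (\<xi> k)"
    and S1: "tendsto_zero_in_prob M
          (\<lambda>k \<omega>. \<integral>\<^sup>+s\<in>{0..t}. ennreal ((simple_process (m k) (p k) (\<xi> k) s \<omega> - X s \<omega>)\<^sup>2) \<partial>lborel)"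
    and S2: "tendsto_zero_in_prob M
          (\<lambda>k \<omega>. ennreal \<bar>simple_ito B (m k) (p k) (\<xi> k) \<omega> - Y \<omega>\<bar>)"
    using Y unfolding has_ito_integral_def by blast
  obtain m' p' \<xi>' where S': "\<And>k. simple_integrand F r (m' k) (p' k) (\<xi>' k)"
    and S1': "tendsto_zero_in_prob M
          (\<lambda>k \<omega>. \<integral>\<^sup>+s\<in>{0..r}. ennreal ((simple_process (m' k) (p' k) (\<xi>' k) s \<omega> - X s \<omega>)\<^sup>2) \<partial>lborel)"
    and S2': "tendsto_zero_in_prob M
          (\<lambda>k \<omega>. ennreal \<bar>simple_ito B (m' k) (p' k) (\<xi>' k) \<omega> - Y' \<omega>\<bar>)"
    using Y' unfolding has_ito_integral_def by blast
  define E0 where "E0 \<omega> = (\<integral>\<^sup>+s\<in>{r..t}. ennreal ((X s \<omega> - \<eta> \<omega>)\<^sup>2) \<partial>lborel)" for \<omega>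
  define E1 where "E1 k \<omega> = (\<integral>\<^sup>+s\<in>{0..t}. ennreal ((simple_process (m k) (p k) (\<xi> k) s \<omega> - X s \<omega>)\<^sup>2) \<partial>lborel)" for k \<omega>
  define E2 where "E2 k \<omega> = (\<integral>\<^sup>+s\<in>{0..r}. ennreal ((simple_process (m' k) (p' k) (\<xi>' k) s \<omega> - X s \<omega>)\<^sup>2) \<partial>lborel)" for k \<omega>
  define I1 where "I1 k = simple_ito B (m k) (p k) (\<xi> k)" for k
  define I2 where "I2 k = simple_ito B (m' k) (p' k) (\<xi>' k)" for k
  define En where "En k \<omega> = (\<integral>\<^sup>+s\<in>{0..t}. ennreal ((simple_process (m k) (p k) (\<xi> k) s \<omega>
      - simple_process (m' k) (p' k) (\<xi>' k) s \<omega> - \<eta> \<omega> * indicator {r<..t} s)\<^sup>2) \<partial>lborel)" for k \<omega>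
  have rT': "r \<le> T" using r by simp
  have [measurable]: "E0 \<in> borel_measurable M"
    unfolding E0_def using progressively_measurable_energy[OF X tT _ r(1)] by simp
  have [measurable]: "E1 k \<in> borel_measurable M" for k
    unfolding E1_def using approximation_energy_measurable[OF X tT S] by simp
  have [measurable]: "E2 k \<in> borel_measurable M" for k
    unfolding E2_def using approximation_energy_measurable[OF X' rT S'] by simp
  have [measurable]: "I1 k \<in> borel_measurable M" "I2 k \<in> borel_measurable M" for k
    unfolding I1_def I2_def using simple_ito_measurable(1)[OF S r(3)] simple_ito_measurable(1)[OF S' rT'] by auto
  have [measurable]: "En k \<in> borel_measurable M" for k
  proof -
    note [measurable] = simple_ito_measurable(2)[OF S r(3), of k] simple_ito_measurable(2)[OF S' rT', of k]
    have [measurable]: "{r<..t} \<in> sets borel" by simp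
    show ?thesis unfolding En_def by (rule energy_measurable) measurable
  qed
  let ?Z = "\<lambda>\<omega>. Y \<omega> - Y' \<omega> - \<eta> \<omega> * (B t \<omega> - B r \<omega>)"
  let ?Zk = "\<lambda>k \<omega>. I1 k \<omega> - I2 k \<omega> - \<eta> \<omega> * (B t \<omega> - B r \<omega>)"
  \<comment> \<open>Outside \<open>a1\<close>, ..., \<open>a5\<close> the energy is at most 2d + d +
    d = 4d, and the two approximations are off by at most e / 4 each. This leaves e / 2 for the
    simple integrals: the event \<open>a6\<close>, of probability at most 4d / (e / 2)^2.\<close>
  define a1 where "a1 = {\<omega>\<in>A. ennreal d < E0 \<omega>}"
  define a2 where "a2 k = {\<omega>\<in>space M. ennreal (d / 4) < E1 k \<omega>}" for k
  define a3 where "a3 k = {\<omega>\<in>space M. ennreal (d / 4) < E2 k \<omega>}" for k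
  define a4 where "a4 k = {\<omega>\<in>space M. ennreal (e / 4) < ennreal \<bar>I1 k \<omega> - Y \<omega>\<bar>}" for k
  define a5 where "a5 k = {\<omega>\<in>space M. ennreal (e / 4) < ennreal \<bar>I2 k \<omega> - Y' \<omega>\<bar>}" for k
  define a6 where "a6 k = {\<omega>\<in>space M. e / 2 < \<bar>?Zk k \<omega>\<bar> \<and> En k \<omega> \<le> ennreal (4 * d)}" for k
  have AM: "\<omega> \<in> space M" if "\<omega> \<in> A" for \<omega> using A that sets.sets_into_space by blast
  have [measurable]: "a1 \<in> sets M"
  proof -
    have "a1 = A \<inter> {\<omega>\<in>space M. ennreal d < E0 \<omega>}" using AM by (auto simp: a1_def)
    then show ?thesis using A by simp
  qed
  have [measurable]: "a2 k \<in> sets M" "a3 k \<in> sets M" "a4 k \<in> sets M" "a5 k \<in> sets M" "a6 k \<in> sets M" for k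
    unfolding a2_def a3_def a4_def a5_def a6_def by measurable
  have lims: "(\<lambda>k. measure M (a2 k)) \<longlonglongrightarrow> 0" "(\<lambda>k. measure M (a3 k)) \<longlonglongrightarrow> 0"
    "(\<lambda>k. measure M (a4 k)) \<longlonglongrightarrow> 0" "(\<lambda>k. measure M (a5 k)) \<longlonglongrightarrow> 0"
    using S1 S2 S1' S2' d e unfolding tendsto_zero_in_prob_def a2_def a3_def a4_def a5_def E1_def E2_def I1_def I2_def
    by auto
  have En_le: "En k \<omega> \<le> 2 * E0 \<omega> + 4 * E1 k \<omega> + 4 * E2 k \<omega>" if \<omega>: "\<omega> \<in> space M" for k \<omega>
  proof -
    let ?X = "\<lambda>s. X (max 0 (min s t)) \<omega>"
    have m: "(\<lambda>s. simple_process (m k) (p k) (\<xi> k) s \<omega>) \<in> borel_measurable borel"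
       "(\<lambda>s. simple_process (m' k) (p' k) (\<xi>' k) s \<omega>) \<in> borel_measurable borel"
      unfolding simple_process_def by measurable
    have "En k \<omega> \<le> 2 * (\<integral>\<^sup>+s\<in>{r..t}. ennreal ((?X s - \<eta> \<omega>)\<^sup>2) \<partial>lborel) +
      4 * (\<integral>\<^sup>+s\<in>{0..t}. ennreal ((simple_process (m k) (p k) (\<xi> k) s \<omega> - ?X s)\<^sup>2) \<partial>lborel) +
      4 * (\<integral>\<^sup>+s\<in>{0..r}. ennreal ((simple_process (m' k) (p' k) (\<xi>' k) s \<omega> - ?X s)\<^sup>2) \<partial>lborel)"
      unfolding En_def
      by (rule energy_difference_le[OF m progressively_measurable_section[OF X tT \<omega>] r(2)])
         (rule simple_process_eq_0[OF S'])
    also have "(\<integral>\<^sup>+s\<in>{r..t}. ennreal ((?X s - \<eta> \<omega>)\<^sup>2) \<partial>lborel) = E0 \<omega>"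
      unfolding E0_def using r by (intro nn_integral_cong) (auto split: split_indicator simp: min_def max_def)
    also have "(\<integral>\<^sup>+s\<in>{0..t}. ennreal ((simple_process (m k) (p k) (\<xi> k) s \<omega> - ?X s)\<^sup>2) \<partial>lborel) = E1 k \<omega>"
      unfolding E1_def by (intro nn_integral_cong) (auto split: split_indicator simp: min_def max_def)
    also have "(\<integral>\<^sup>+s\<in>{0..r}. ennreal ((simple_process (m' k) (p' k) (\<xi>' k) s \<omega> - ?X s)\<^sup>2) \<partial>lborel) = E2 k \<omega>"
      unfolding E2_def using r by (intro nn_integral_cong) (auto split: split_indicator simp: min_def max_def)
    finally show ?thesis .
  qed
  have bound: "measure M {\<omega>\<in>A. e < \<bar>?Z \<omega>\<bar>} \<le>
      measure M a1 + measure M (a2 k) + measure M (a3 k) + measure M (a4 k) + measure M (a5 k) + 16 * d / e\<^sup>2" for k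
  proof -
    have "{\<omega>\<in>A. e < \<bar>?Z \<omega>\<bar>} \<subseteq> a1 \<union> a2 k \<union> a3 k \<union> a4 k \<union> a5 k \<union> a6 k"
    proof
      fix \<omega> assume "\<omega> \<in> {\<omega>\<in>A. e < \<bar>?Z \<omega>\<bar>}"
      then have \<omega>: "\<omega> \<in> A" "\<omega> \<in> space M" "e < \<bar>?Z \<omega>\<bar>" using AM by auto
      show "\<omega> \<in> a1 \<union> a2 k \<union> a3 k \<union> a4 k \<union> a5 k \<union> a6 k"
      proof (rule ccontr)
        assume n: "\<omega> \<notin> a1 \<union> a2 k \<union> a3 k \<union> a4 k \<union> a5 k \<union> a6 k"
        then have le: "E0 \<omega> \<le> ennreal d" "E1 k \<omega> \<le> ennreal (d / 4)" "E2 k \<omega> \<le> ennreal (d / 4)"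
          using \<omega> by (auto simp: a1_def a2_def a3_def not_less)
        have "\<bar>I1 k \<omega> - Y \<omega>\<bar> \<le> e / 4" "\<bar>I2 k \<omega> - Y' \<omega>\<bar> \<le> e / 4"
          using n \<omega> e by (auto simp: a4_def a5_def not_less)
        then have "e / 2 < \<bar>?Zk k \<omega>\<bar>" using \<omega>(3) by linarith
        moreover have "En k \<omega> \<le> ennreal (4 * d)"
        proof -
          have "En k \<omega> \<le> 2 * ennreal d + 4 * ennreal (d / 4) + 4 * ennreal (d / 4)"
            using En_le[OF \<omega>(2), of k] le by (meson add_mono mult_left_mono order_trans zero_le)
          also have "\<dots> = ennreal (4 * d)"
          proof -
            have "2 * ennreal d = ennreal (2 * d)" "4 * ennreal (d / 4) = ennreal d"
              using d by (simp_all add: ennreal_mult''[symmetric] flip: ennreal_numeral)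
            then show ?thesis using d by (simp add: ennreal_plus[symmetric] del: ennreal_plus)
          qed
          finally show ?thesis .
        qed
        ultimately show False using n \<omega> by (auto simp: a6_def)
      qed
    qed
    then have "measure M {\<omega>\<in>A. e < \<bar>?Z \<omega>\<bar>} \<le> measure M (a1 \<union> a2 k \<union> a3 k \<union> a4 k \<union> a5 k \<union> a6 k)"
      by (intro finite_measure_mono) measurable
    also have "\<dots> \<le> measure M a1 + measure M (a2 k) + measure M (a3 k) + measure M (a4 k) + measure M (a5 k) + measure M (a6 k)"
      by (intro order_trans[OF measure_Un_le] add_mono) (auto intro!: sets.Un)
    also have "measure M (a6 k) \<le> 16 * d / e\<^sup>2"
    proof -
      have "measure M (a6 k) \<le> 4 * d / (e / 2)\<^sup>2"
        unfolding a6_def I1_def I2_def En_def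
        using d e by (intro simple_difference_lenglart[OF r \<eta> S S']) auto
      then show ?thesis by (simp add: power_divide)
    qed
    finally show ?thesis by simp
  qed
  have "(\<lambda>k. measure M a1 + measure M (a2 k) + measure M (a3 k) + measure M (a4 k) + measure M (a5 k) + 16 * d / e\<^sup>2)
    \<longlonglongrightarrow> measure M a1 + 0 + 0 + 0 + 0 + 16 * d / e\<^sup>2"
    by (intro tendsto_intros lims)
  then have "measure M {\<omega>\<in>A. e < \<bar>?Z \<omega>\<bar>} \<le> measure M a1 + 0 + 0 + 0 + 0 + 16 * d / e\<^sup>2"
    by (rule LIMSEQ_le_const) (use bound in blast)
  then show ?thesis by (simp add: a1_def E0_def)
qed

end

section \<open>Diagonal stochastic differential equations\<close>

text \<open>Rational times in the open interval are dense in [0, r] because \<open>r\<close> is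
  positive, and a continuous path inherits a closed bound from a dense set.\<close>

lemma continuous_bound_from_rationals:
  fixes f :: "real \<Rightarrow> real"
  assumes f: "continuous_on {0..T} f" and r: "0 < r" "r \<le> T"
    and bd: "\<And>s. s \<in> \<rat> \<Longrightarrow> 0 \<le> s \<Longrightarrow> s \<le> r \<Longrightarrow> \<bar>f s\<bar> \<le> R" and s: "0 \<le> s" "s \<le> r"
  shows "\<bar>f s\<bar> \<le> R"
proof -
  let ?S = "\<rat> \<inter> {0<..<r}"
  have cl: "closure ?S = {0..r}"
  proof
    show "closure ?S \<subseteq> {0..r}" by (rule closure_minimal) auto
    have "{0<..<r} \<subseteq> closure ?S"
    proof
      fix x assume x: "x \<in> {0<..<r}"
      show "x \<in> closure ?S"
        unfolding closure_approachable
      proof (intro allI impI)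
        fix e :: real assume "0 < e"
        then obtain y where "y \<in> \<rat>" "x < y" "y < min r (x + e)"
          using Rats_dense_in_real[of x "min r (x + e)"] x by auto
        then show "\<exists>y\<in>?S. dist y x < e" using x by (intro bexI[of _ y]) (auto simp: dist_real_def)
      qed
    qed
    then have "closure {0<..<r} \<subseteq> closure ?S" by (rule closure_minimal) simp
    then show "{0..r} \<subseteq> closure ?S" using r by simp
  qed
  have "continuous_on (closure ?S) (\<lambda>s. \<bar>f s\<bar>)"
    unfolding cl using f r by (intro continuous_intros continuous_on_subset[OF f]) auto
  moreover have "s \<in> closure ?S" unfolding cl using s by simp
  ultimately show ?thesis by (rule continuous_le_on_closure) (use bd in auto)
qed

text \<open>\<open>Y i\<close> is the stochastic integral in coordinate i. Its coefficient depends
  on that coordinate alone, so freezing gives a product of Gaussians. \<open>increments_law\<close>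
  combines two facts in one product formula: the normalised increments of all coordinates are
  jointly standard Gaussian, and they are independent of the past. The bound on the drift and the
  lower bound on \<open>g\<close> hold on balls only.\<close>

locale diagonal_sde = prob_space M for M :: "'a measure" +
  fixes F :: "real \<Rightarrow> 'a measure" and T :: real and I :: "'i::countable set"
    and B :: "'i \<Rightarrow> real \<Rightarrow> 'a \<Rightarrow> real" and U :: "real \<Rightarrow> 'a \<Rightarrow> 'i \<Rightarrow> real"
    and Y :: "'i \<Rightarrow> real \<Rightarrow> 'a \<Rightarrow> real" and b :: "('i \<Rightarrow> real) \<Rightarrow> 'i \<Rightarrow> real"
    and x0 :: "'i \<Rightarrow> real" and g :: "real \<Rightarrow> real" and K L :: real
  assumes finite_I: "finite I"
    and sub: "t \<in> {0..T} \<Longrightarrow> subalgebra M (F t)"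
    and F_mono: "0 \<le> s \<Longrightarrow> s \<le> t \<Longrightarrow> t \<le> T \<Longrightarrow> sets (F s) \<subseteq> sets (F t)"
    and brownian: "i \<in> I \<Longrightarrow> adapted_brownian_motion M F T (B i)"
    and increments_law: "0 \<le> r \<Longrightarrow> r < t \<Longrightarrow> t \<le> T \<Longrightarrow> A \<in> sets (F r) \<Longrightarrow> E \<in> sets (\<Pi>\<^sub>M i\<in>I. borel) \<Longrightarrow>
      emeasure M {\<omega>\<in>A. (\<lambda>i\<in>I. (B i t \<omega> - B i r \<omega>) / sqrt (t - r)) \<in> E} = emeasure M A * emeasure (std_gauss I) E"
    and U_adapted: "t \<in> {0..T} \<Longrightarrow> i \<in> I \<Longrightarrow> (\<lambda>\<omega>. U t \<omega> i) \<in> borel_measurable (F t)"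
    and U_continuous: "AE \<omega> in M. \<forall>i\<in>I. continuous_on {0..T} (\<lambda>t. U t \<omega> i)"
    and drift_integrable: "AE \<omega> in M. \<forall>i\<in>I. set_integrable lborel {0..T} (\<lambda>s. b (U s \<omega>) i)"
    and U_eq: "t \<in> {0..T} \<Longrightarrow> AE \<omega> in M. \<forall>i\<in>I. U t \<omega> i = x0 i + (LINT s:{0..t}|lborel. b (U s \<omega>) i) + Y i t \<omega>"
    and ito: "t \<in> {0..T} \<Longrightarrow> i \<in> I \<Longrightarrow> has_ito_integral M F (B i) t (\<lambda>s \<omega>. g (U s \<omega> i)) (Y i t)"
    and drift_bounded: "\<exists>C\<ge>0. \<forall>u. (\<forall>i\<in>I. \<bar>u i\<bar> \<le> R) \<longrightarrow> (\<forall>i\<in>I. \<bar>b u i\<bar> \<le> C)"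
    and g_bounded: "\<bar>g x\<bar> \<le> K" and g_lipschitz: "\<bar>g x - g y\<bar> \<le> L * \<bar>x - y\<bar>"
    and KL: "0 < K" "0 < L"
    and g_nondegenerate: "\<exists>c>0. \<forall>x. \<bar>x\<bar> \<le> R \<longrightarrow> c \<le> \<bar>g x\<bar>"
begin

lemma g_continuous: "continuous_on UNIV g"
proof -
  have "L-lipschitz_on UNIV g" using g_lipschitz KL by (auto simp: lipschitz_on_def dist_real_def)
  then show ?thesis by (rule lipschitz_on_continuous_on)
qed

lemma g_measurable [measurable]: "g \<in> borel_measurable borel"
  using g_continuous by (rule borel_measurable_continuous_onI)

lemma g_nonzero: "g x \<noteq> 0"
  using g_nondegenerate[of "\<bar>x\<bar>"] by force

lemma meas_F_M: "t \<in> {0..T} \<Longrightarrow> f \<in> borel_measurable (F t) \<Longrightarrow> f \<in> borel_measurable M"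
  using sub measurable_from_subalg by blast

lemma U_measurable: "t \<in> {0..T} \<Longrightarrow> i \<in> I \<Longrightarrow> (\<lambda>\<omega>. U t \<omega> i) \<in> borel_measurable M"
  using U_adapted meas_F_M by blast

lemma Y_measurable: "t \<in> {0..T} \<Longrightarrow> i \<in> I \<Longrightarrow> Y i t \<in> borel_measurable M"
  using ito by (auto simp: has_ito_integral_def)

lemma B_measurable: "t \<in> {0..T} \<Longrightarrow> i \<in> I \<Longrightarrow> B i t \<in> borel_measurable M"
  using adapted_brownian_motion.adapted[OF brownian] meas_F_M by blast

text \<open>Rational times keep the event measurable; the paths are only almost surely continuous.\<close>

definition confined :: "real \<Rightarrow> real \<Rightarrow> 'a set" where
  "confined R r = {\<omega>\<in>space M. \<forall>s\<in>\<rat> \<inter> {0..r}. \<forall>i\<in>I. \<bar>U s \<omega> i\<bar> \<le> R}"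

lemma confined_antimono: "r \<le> s \<Longrightarrow> confined R s \<subseteq> confined R r"
  by (auto simp: confined_def)

lemma confined_sets_F:
  assumes r: "r \<in> {0..T}" shows "confined R r \<in> sets (F r)"
proof -
  have U: "(\<lambda>\<omega>. U s \<omega> i) \<in> borel_measurable (F r)" if "s \<in> \<rat> \<inter> {0..r}" "i \<in> I" for s i
  proof -
    have "s \<in> {0..T}" using that r by auto
    then have "(\<lambda>\<omega>. U s \<omega> i) \<in> borel_measurable (F s)" using that by (intro U_adapted)
    moreover have "sets (F s) \<subseteq> sets (F r)" "space (F s) = space (F r)"
      using F_mono[of s r] that r sub[of s] sub[of r] \<open>s \<in> {0..T}\<close> by (auto simp: subalgebra_def)
    ultimately show ?thesis by (auto simp: measurable_def)
  qed
  have "(\<Union>s\<in>\<rat> \<inter> {0..r}. \<Union>i\<in>I. {\<omega>\<in>space (F r). R < \<bar>U s \<omega> i\<bar>}) \<in> sets (F r)"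
  proof (intro sets.countable_UN'')
    show "countable I" using finite_I by (rule countable_finite)
    show "countable (\<rat> \<inter> {0..r} :: real set)" by (simp add: countable_rat)
    fix s i assume "s \<in> \<rat> \<inter> {0..r}" "i \<in> I"
    note [measurable] = U[OF this]
    show "{\<omega>\<in>space (F r). R < \<bar>U s \<omega> i\<bar>} \<in> sets (F r)" by measurable
  qed
  then have "space (F r) - (\<Union>s\<in>\<rat> \<inter> {0..r}. \<Union>i\<in>I. {\<omega>\<in>space (F r). R < \<bar>U s \<omega> i\<bar>}) \<in> sets (F r)"
    by (rule sets.compl_sets)
  also have "space (F r) - (\<Union>s\<in>\<rat> \<inter> {0..r}. \<Union>i\<in>I. {\<omega>\<in>space (F r). R < \<bar>U s \<omega> i\<bar>}) = confined R r"
    using sub[OF r] unfolding confined_def subalgebra_def not_le[symmetric] by blast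
  finally show ?thesis .
qed

lemma confined_sets_M: "r \<in> {0..T} \<Longrightarrow> confined R r \<in> sets M"
  using confined_sets_F[of r R] sub[of r] by (auto simp: subalgebra_def)

lemma confined_AE_bound:
  "AE \<omega> in M. \<forall>r\<in>{0<..T}. \<omega> \<in> confined R r \<longrightarrow> (\<forall>s\<in>{0..r}. \<forall>i\<in>I. \<bar>U s \<omega> i\<bar> \<le> R)"
  using U_continuous
proof eventually_elim
  case (elim \<omega>)
  show ?case
  proof (intro ballI impI)
    fix r s i assume r: "r \<in> {0<..T}" and \<omega>: "\<omega> \<in> confined R r" and s: "s \<in> {0..r}" and i: "i \<in> I"
    have bd: "\<bar>U u \<omega> i\<bar> \<le> R" if "u \<in> \<rat>" "0 \<le> u" "u \<le> r" for u
      using \<omega> i that by (simp add: confined_def)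
    have "continuous_on {0..T} (\<lambda>t. U t \<omega> i)" using elim i by blast
    then show "\<bar>U s \<omega> i\<bar> \<le> R"
    proof (rule continuous_bound_from_rationals)
      show "\<bar>U u \<omega> i\<bar> \<le> R" if "u \<in> \<rat>" "0 \<le> u" "u \<le> r" for u
        using that by (rule bd)
    qed (use r s in auto)
  qed
qed

text \<open>Freeze at the coefficient 0. The energy on [r, s] is then at most K^2 h on every path,
  so only the Chebyshev term remains.\<close>

lemma ito_increment_tail:
  assumes r: "0 \<le> r" "r \<le> s" "s \<le> T" and h: "s - r \<le> h" "0 < h" and q: "0 < q" and i: "i \<in> I"
  shows "measure M {\<omega>\<in>space M. q < \<bar>Y i s \<omega> - Y i r \<omega>\<bar>} \<le> 16 * (K\<^sup>2 * h) / q\<^sup>2"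
proof -
  interpret adapted_brownian_motion M F T "B i" by (rule brownian[OF i])
  have "(\<integral>\<^sup>+u\<in>{r..s}. ennreal ((g (U u \<omega> i) - 0)\<^sup>2) \<partial>lborel) \<le> ennreal (K\<^sup>2 * h)" for \<omega>
  proof -
    have "(\<integral>\<^sup>+u\<in>{r..s}. ennreal ((g (U u \<omega> i) - 0)\<^sup>2) \<partial>lborel) \<le> (\<integral>\<^sup>+u. ennreal (K\<^sup>2) * indicator {r..s} u \<partial>lborel)"
      using g_bounded KL
      by (intro nn_integral_mono) (auto split: split_indicator intro!: ennreal_leI simp: abs_le_square_iff[symmetric])
    also have "\<dots> = ennreal (K\<^sup>2 * (s - r))"
      using r by (subst nn_integral_cmult_indicator) (auto simp: ennreal_mult)
    also have "\<dots> \<le> ennreal (K\<^sup>2 * h)" using h by (intro ennreal_leI mult_left_mono) auto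
    finally show ?thesis .
  qed
  then have none: "{\<omega>\<in>space M. ennreal (K\<^sup>2 * h) < (\<integral>\<^sup>+u\<in>{r..s}. ennreal ((g (U u \<omega> i) - 0)\<^sup>2) \<partial>lborel)} = {}"
    unfolding Collect_empty_eq not_less by (simp add: leD)
  have "measure M {\<omega>\<in>space M. q < \<bar>Y i s \<omega> - Y i r \<omega> - 0 * (B i s \<omega> - B i r \<omega>)\<bar>} \<le>
    measure M {\<omega>\<in>space M. ennreal (K\<^sup>2 * h) < (\<integral>\<^sup>+u\<in>{r..s}. ennreal ((g (U u \<omega> i) - 0)\<^sup>2) \<partial>lborel)} +
      16 * (K\<^sup>2 * h) / q\<^sup>2"
    using r i h q KL by (intro ito_difference_bound[where C = 0] ito) auto
  then show ?thesis unfolding none by simp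
qed

text \<open>Subtract the integral equations at \<open>s\<close> and \<open>r\<close>. Confinement
  refers to the later time \<open>r'\<close>, so that one event serves all \<open>s\<close> in
  between.\<close>

lemma drift_increment:
  assumes C: "\<forall>u. (\<forall>i\<in>I. \<bar>u i\<bar> \<le> R) \<longrightarrow> (\<forall>i\<in>I. \<bar>b u i\<bar> \<le> C)"
    and r: "0 \<le> r" "r \<le> s" "s \<le> r'" "r' \<le> T" "0 < r'"
  shows "AE \<omega> in M. \<omega> \<in> confined R r' \<longrightarrow> (\<forall>i\<in>I.
    \<bar>U s \<omega> i - U r \<omega> i - (Y i s \<omega> - Y i r \<omega>)\<bar> \<le> C * (s - r))"
proof -
  have "AE \<omega> in M. \<forall>i\<in>I. U s \<omega> i = x0 i + (LINT s:{0..s}|lborel. b (U s \<omega>) i) + Y i s \<omega>"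
    "AE \<omega> in M. \<forall>i\<in>I. U r \<omega> i = x0 i + (LINT s:{0..r}|lborel. b (U s \<omega>) i) + Y i r \<omega>"
    using r by (auto intro!: U_eq)
  then show ?thesis
    using confined_AE_bound[of R] drift_integrable
  proof eventually_elim
    case (elim \<omega>)
    show ?case
    proof (intro impI ballI)
      fix i assume \<omega>: "\<omega> \<in> confined R r'" and i: "i \<in> I"
      let ?b = "\<lambda>s. b (U s \<omega>) i"
      have int: "set_integrable lborel {0..s} ?b" "set_integrable lborel {0..r} ?b" "set_integrable lborel {r<..s} ?b"
        using elim(4) i r by (auto intro: set_integrable_subset)
      have "(LINT s:{0..s}|lborel. ?b s) = (LINT s:{0..r} \<union> {r<..s}|lborel. ?b s)"
        using r by (intro arg_cong2[where f = "\<lambda>A f. set_lebesgue_integral lborel A f"]) auto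
      also have "\<dots> = (LINT s:{0..r}|lborel. ?b s) + (LINT s:{r<..s}|lborel. ?b s)"
        using int by (intro set_integral_Un) auto
      finally have eq: "U s \<omega> i - U r \<omega> i - (Y i s \<omega> - Y i r \<omega>) = (LINT s:{r<..s}|lborel. ?b s)"
        using elim(1,2) i by simp
      have bd: "\<bar>?b u\<bar> \<le> C" if "u \<in> {r<..s}" for u
        using elim(3) \<omega> that r i C by auto
      have "\<bar>LINT s:{r<..s}|lborel. ?b s\<bar> \<le> (LINT s:{r<..s}|lborel. \<bar>?b s\<bar>)"
        using set_integral_norm_bound[OF int(3)] by simp
      also have "\<dots> \<le> (LINT u:{r<..s}|lborel. C)"
        using bd r by (intro set_integral_mono set_integrable_abs int(3)) (auto simp: set_integrable_def)
      also have "\<dots> = C * (s - r)" using r by (simp add: set_lebesgue_integral_def)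
      finally show "\<bar>U s \<omega> i - U r \<omega> i - (Y i s \<omega> - Y i r \<omega>)\<bar> \<le> C * (s - r)" unfolding eq .
    qed
  qed
qed

text \<open>Split at the event that the stochastic integral moves by more than \<open>q\<close>. Off
  it, \<open>U\<close> moves by at most 2q and the Lipschitz bound applies; on it, the square is at
  most (2K)^2 and the tail estimate bounds the probability. \<open>q\<close> stays free to balance
  the two terms.\<close>

lemma g_increment_second_moment:
  assumes C: "\<forall>u. (\<forall>i\<in>I. \<bar>u i\<bar> \<le> R) \<longrightarrow> (\<forall>i\<in>I. \<bar>b u i\<bar> \<le> C)" "0 \<le> C"
    and r: "0 \<le> r" "r \<le> s" "s \<le> r'" "r' \<le> T" "0 < r'"
    and h: "r' - r \<le> h" "0 < h" "C * h \<le> q" and q: "0 < q" and i: "i \<in> I"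
  shows "(\<integral>\<^sup>+\<omega>\<in>confined R r'. ennreal ((g (U s \<omega> i) - g (U r \<omega> i))\<^sup>2) \<partial>M) \<le>
    ennreal (4 * L\<^sup>2 * q\<^sup>2 + 64 * K ^ 4 * h / q\<^sup>2)"
proof -
  let ?A = "{\<omega>\<in>space M. q < \<bar>Y i s \<omega> - Y i r \<omega>\<bar>}"
  have [measurable]: "Y i s \<in> borel_measurable M" "Y i r \<in> borel_measurable M" using r i by (auto intro!: Y_measurable)
  have "(\<integral>\<^sup>+\<omega>\<in>confined R r'. ennreal ((g (U s \<omega> i) - g (U r \<omega> i))\<^sup>2) \<partial>M) \<le>
    (\<integral>\<^sup>+\<omega>. ennreal (4 * L\<^sup>2 * q\<^sup>2) + ennreal (4 * K\<^sup>2) * indicator ?A \<omega> \<partial>M)"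
  proof (intro nn_integral_mono_AE)
    show "AE \<omega> in M. ennreal ((g (U s \<omega> i) - g (U r \<omega> i))\<^sup>2) * indicator (confined R r') \<omega> \<le>
        ennreal (4 * L\<^sup>2 * q\<^sup>2) + ennreal (4 * K\<^sup>2) * indicator ?A \<omega>"
      using drift_increment[OF C(1) r] AE_space
    proof eventually_elim
      case (elim \<omega>)
      show ?case
      proof (cases "\<omega> \<in> confined R r'")
        case True
        let ?d = "g (U s \<omega> i) - g (U r \<omega> i)"
        show ?thesis
        proof (cases "\<omega> \<in> ?A")
          case A: True
          have "\<bar>?d\<bar> \<le> 2 * K" using g_bounded[of "U s \<omega> i"] g_bounded[of "U r \<omega> i"] by linarith
          then have "\<bar>?d\<bar> \<le> \<bar>2 * K\<bar>" using KL by simp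
          then have "?d\<^sup>2 \<le> (2 * K)\<^sup>2" unfolding abs_le_square_iff .
          then have "ennreal (?d\<^sup>2) \<le> ennreal (4 * K\<^sup>2)" by (intro ennreal_leI) (simp add: power_mult_distrib)
          then show ?thesis using True A by (simp add: add_increasing)
        next
          case A: False
          have "\<bar>U s \<omega> i - U r \<omega> i\<bar> \<le> C * (s - r) + \<bar>Y i s \<omega> - Y i r \<omega>\<bar>"
            using elim True i by fastforce
          also have "C * (s - r) \<le> C * h" using r h C by (intro mult_left_mono) auto
          finally have "\<bar>U s \<omega> i - U r \<omega> i\<bar> \<le> 2 * q" using A elim h by auto
          then have "\<bar>?d\<bar> \<le> L * (2 * q)"
            using g_lipschitz[of "U s \<omega> i" "U r \<omega> i"] KL by (meson mult_left_mono less_imp_le order_trans)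
          then have "\<bar>?d\<bar> \<le> \<bar>L * (2 * q)\<bar>" using KL q by simp
          then have "?d\<^sup>2 \<le> (L * (2 * q))\<^sup>2" unfolding abs_le_square_iff .
          then have "ennreal (?d\<^sup>2) \<le> ennreal (4 * L\<^sup>2 * q\<^sup>2)" by (intro ennreal_leI) (simp add: power_mult_distrib)
          then show ?thesis using True A by simp
        qed
      qed simp
    qed
  qed
  also have "\<dots> = ennreal (4 * L\<^sup>2 * q\<^sup>2) + ennreal (4 * K\<^sup>2) * emeasure M ?A"
    by (subst nn_integral_add) (auto simp: nn_integral_cmult_indicator emeasure_space_1)
  also have "\<dots> = ennreal (4 * L\<^sup>2 * q\<^sup>2 + 4 * K\<^sup>2 * measure M ?A)"
    by (simp add: emeasure_eq_measure ennreal_mult ennreal_plus)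
  also have "\<dots> \<le> ennreal (4 * L\<^sup>2 * q\<^sup>2 + 4 * K\<^sup>2 * (16 * (K\<^sup>2 * h) / q\<^sup>2))"
    using r h q i by (intro ennreal_leI add_left_mono mult_left_mono ito_increment_tail) auto
  also have "4 * K\<^sup>2 * (16 * (K\<^sup>2 * h) / q\<^sup>2) = 64 * K ^ 4 * h / q\<^sup>2"
    by (simp add: power2_eq_square power4_eq_xxxx)
  finally show ?thesis .
qed

text \<open>The threshold \<open>e\<close> is split evenly between the drift and the freezing of the
  coefficient. For the latter, Markov's inequality at level \<open>d\<close> turns the time integral
  of the second moment into a bound for the energy event.\<close>

lemma frozen_coefficient_error:
  assumes C: "\<forall>u. (\<forall>i\<in>I. \<bar>u i\<bar> \<le> R) \<longrightarrow> (\<forall>i\<in>I. \<bar>b u i\<bar> \<le> C)" "0 \<le> C"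
    and r: "0 \<le> r" "r \<le> r'" "r' \<le> T" "0 < r'"
    and h: "r' - r \<le> h" "0 < h" "C * h \<le> q" "C * h \<le> e / 2" and q: "0 < q" and e: "0 < e" and d: "0 < d" and i: "i \<in> I"
  shows "measure M {\<omega>\<in>confined R r'. e < \<bar>U r' \<omega> i - (U r \<omega> i + g (U r \<omega> i) * (B i r' \<omega> - B i r \<omega>))\<bar>} \<le>
    h * (4 * L\<^sup>2 * q\<^sup>2 + 64 * K ^ 4 * h / q\<^sup>2) / d + 64 * d / e\<^sup>2"
proof -
  interpret bm: adapted_brownian_motion M F T "B i" by (rule brownian[OF i])
  let ?G = "confined R r'"
  let ?X = "\<lambda>s \<omega>. g (U s \<omega> i)"
  let ?E = "\<lambda>\<omega>. \<integral>\<^sup>+s\<in>{r..r'}. ennreal ((?X s \<omega> - ?X r \<omega>)\<^sup>2) \<partial>lborel"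
  let ?c = "4 * L\<^sup>2 * q\<^sup>2 + 64 * K ^ 4 * h / q\<^sup>2"
  have c0: "0 \<le> ?c" using h KL by simp
  have rT: "r \<in> {0..T}" "r' \<in> {0..T}" using r by auto
  have G [measurable]: "?G \<in> sets M" using rT by (intro confined_sets_M)
  have pm: "progressively_measurable F r' ?X" using ito[OF rT(2) i] by (auto simp: has_ito_integral_def)
  have [measurable]: "(\<lambda>\<omega>. U r \<omega> i) \<in> borel_measurable M" "(\<lambda>\<omega>. U r' \<omega> i) \<in> borel_measurable M"
    "B i r \<in> borel_measurable M" "B i r' \<in> borel_measurable M" "Y i r \<in> borel_measurable M" "Y i r' \<in> borel_measurable M"
    using rT i by (auto intro: U_measurable B_measurable Y_measurable)
  have [measurable]: "?E \<in> borel_measurable M"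
    using r by (intro bm.progressively_measurable_energy[OF pm rT(2)]) auto
  note [measurable] = bm.progressively_measurable_joint[OF pm rT(2)]
  have "(\<integral>\<^sup>+\<omega>\<in>?G. ?E \<omega> \<partial>M) = (\<integral>\<^sup>+\<omega>. \<integral>\<^sup>+s. ennreal ((?X (max 0 (min s r')) \<omega> - ?X r \<omega>)\<^sup>2) * indicator {r..r'} s * indicator ?G \<omega> \<partial>lborel \<partial>M)"
  proof (intro nn_integral_cong)
    fix \<omega> assume \<omega>: "\<omega> \<in> space M"
    have [measurable]: "(\<lambda>s. ?X (max 0 (min s r')) \<omega>) \<in> borel_measurable borel"
      by (rule bm.progressively_measurable_section[OF pm rT(2) \<omega>])
    have "?E \<omega> = (\<integral>\<^sup>+s\<in>{r..r'}. ennreal ((?X (max 0 (min s r')) \<omega> - ?X r \<omega>)\<^sup>2) \<partial>lborel)"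
      using r by (intro nn_integral_cong) (auto split: split_indicator simp: min_def max_def)
    then show "?E \<omega> * indicator ?G \<omega> = (\<integral>\<^sup>+s. ennreal ((?X (max 0 (min s r')) \<omega> - ?X r \<omega>)\<^sup>2) * indicator {r..r'} s * indicator ?G \<omega> \<partial>lborel)"
      by (simp add: nn_integral_multc)
  qed
  \<comment> \<open>The second moment is bounded at each fixed time, hence the exchange of time and
    expectation.\<close>
  also have "\<dots> = (\<integral>\<^sup>+s. \<integral>\<^sup>+\<omega>. ennreal ((?X (max 0 (min s r')) \<omega> - ?X r \<omega>)\<^sup>2) * indicator {r..r'} s * indicator ?G \<omega> \<partial>M \<partial>lborel)"
  proof -
    interpret P: pair_sigma_finite M lborel ..
    have [measurable]: "(\<lambda>x. ?X (max 0 (min (snd x) r')) (fst x)) \<in> borel_measurable (M \<Otimes>\<^sub>M lborel)"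
      using bm.progressively_measurable_joint[OF pm rT(2)] by (simp cong: measurable_cong_sets sets_pair_measure_cong)
    show ?thesis
      by (rule P.Fubini'[symmetric]) measurable
  qed
  also have "\<dots> \<le> (\<integral>\<^sup>+s. ennreal ?c * indicator {r..r'} s \<partial>lborel)"
  proof (intro nn_integral_mono)
    fix s :: real
    show "(\<integral>\<^sup>+\<omega>. ennreal ((?X (max 0 (min s r')) \<omega> - ?X r \<omega>)\<^sup>2) * indicator {r..r'} s * indicator ?G \<omega> \<partial>M) \<le> ennreal ?c * indicator {r..r'} s"
    proof (cases "s \<in> {r..r'}")
      case True
      then have "max 0 (min s r') = s" using r by auto
      then show ?thesis
        using True g_increment_second_moment[OF C r(1) _ _ r(3,4) h(1-3) q i, of s] by simp
    qed simp
  qed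
  also have "\<dots> = ennreal (?c * (r' - r))"
    using r c0 by (subst nn_integral_cmult_indicator) (auto simp: ennreal_mult)
  also have "\<dots> \<le> ennreal (?c * h)" using c0 h by (intro ennreal_leI mult_left_mono) auto
  finally have EE: "(\<integral>\<^sup>+\<omega>\<in>?G. ?E \<omega> \<partial>M) \<le> ennreal (?c * h)" .
  have "emeasure M {\<omega>\<in>?G. ennreal d < ?E \<omega>} \<le> emeasure M {\<omega>\<in>?G. 1 \<le> ennreal (1 / d) * ?E \<omega>}"
  proof (intro emeasure_mono subsetI)
    fix \<omega> assume "\<omega> \<in> {\<omega>\<in>?G. ennreal d < ?E \<omega>}"
    then have \<omega>: "\<omega> \<in> ?G" "ennreal d \<le> ?E \<omega>" by auto
    have "1 = ennreal (1 / d) * ennreal d" using d by (simp add: ennreal_mult[symmetric])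
    also have "\<dots> \<le> ennreal (1 / d) * ?E \<omega>" using \<omega> by (intro mult_left_mono) auto
    finally show "\<omega> \<in> {\<omega>\<in>?G. 1 \<le> ennreal (1 / d) * ?E \<omega>}" using \<omega> by simp
  qed measurable
  also have "\<dots> \<le> ennreal (1 / d) * (\<integral>\<^sup>+\<omega>\<in>?G. ?E \<omega> \<partial>M)"
    by (intro nn_integral_Markov_inequality) measurable
  also have "\<dots> \<le> ennreal (1 / d) * ennreal (?c * h)" using EE by (rule mult_left_mono) simp
  also have "\<dots> = ennreal (h * ?c / d)" using d c0 h by (simp add: ennreal_mult[symmetric] mult.commute)
  finally have markov: "measure M {\<omega>\<in>?G. ennreal d < ?E \<omega>} \<le> h * ?c / d"
    unfolding emeasure_eq_measure using c0 h d by simp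
  let ?Z = "\<lambda>\<omega>. Y i r' \<omega> - Y i r \<omega> - ?X r \<omega> * (B i r' \<omega> - B i r \<omega>)"
  have "measure M {\<omega>\<in>?G. e < \<bar>U r' \<omega> i - (U r \<omega> i + ?X r \<omega> * (B i r' \<omega> - B i r \<omega>))\<bar>} \<le>
    measure M {\<omega>\<in>?G. e / 2 < \<bar>?Z \<omega>\<bar>}"
  proof (intro finite_measure_mono_AE)
    show "AE \<omega> in M. \<omega> \<in> {\<omega>\<in>?G. e < \<bar>U r' \<omega> i - (U r \<omega> i + ?X r \<omega> * (B i r' \<omega> - B i r \<omega>))\<bar>} \<longrightarrow>
       \<omega> \<in> {\<omega>\<in>?G. e / 2 < \<bar>?Z \<omega>\<bar>}"
      using drift_increment[OF C(1) r(1,2) order_refl r(3,4)]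
    proof eventually_elim
      case (elim \<omega>)
      have "C * (r' - r) \<le> C * h" using C h by (intro mult_left_mono) auto
      then have "\<bar>U r' \<omega> i - U r \<omega> i - (Y i r' \<omega> - Y i r \<omega>)\<bar> \<le> e / 2" if "\<omega> \<in> ?G"
        using elim that i h by fastforce
      moreover have "\<bar>u - (v + p)\<bar> \<le> \<bar>u - v - y\<bar> + \<bar>y - p\<bar>" for u v p y :: real by linarith
      ultimately show ?case
        by (smt (verit) mem_Collect_eq field_sum_of_halves)
    qed
  qed measurable
  also have "\<dots> \<le> measure M {\<omega>\<in>?G. ennreal d < ?E \<omega>} + 16 * d / (e / 2)\<^sup>2"
  proof (rule bm.ito_difference_bound[OF ito[OF rT(2) i] ito[OF rT(1) i] r(1-3)])
    show "?X r \<in> borel_measurable (F r)" using measurable_compose[OF U_adapted[OF rT(1) i] g_measurable] .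
  qed (use g_bounded d e in auto)
  also have "\<dots> \<le> h * ?c / d + 64 * d / e\<^sup>2"
    using markov by (simp add: power_divide)
  finally show ?thesis .
qed

end

section \<open>One step of the frozen Gaussian approximation\<close>

lemma gauss_prod_cong:
  assumes "\<And>i. i \<in> I \<Longrightarrow> m i = m' i" "\<And>i. i \<in> I \<Longrightarrow> s i = s' i"
  shows "gauss_prod I m s A = gauss_prod I m' s' A"
  unfolding gauss_prod_def using assms by (intro nn_integral_cong arg_cong2[where f = "(*)"] prod.cong refl) auto

text \<open>Arithmetic of one step; \<open>ga\<close> and \<open>gb\<close> are the coefficients at
  the earlier and the later freezing time. \<open>s\<close> is the deviation at scale x / 2.
  \<open>s'\<close> is the deviation at scale x with the Brownian increment over time x^8 - y split
  off: y + x^9 plus that time is x^8 * (1 + x). Since x^8 = 256 * y, the variances are y * (1 + x /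
  2) and y * (1 + 256 * x) up to the squared coefficients.\<close>

lemma kernel_ratio:
  fixes ga gb c x dm :: real
  assumes x: "0 < x" "x \<le> 1" and c: "0 < c" "c \<le> ga" "c \<le> gb" and d: "\<bar>ga - gb\<bar> \<le> c * x" and dm: "\<bar>dm\<bar> \<le> x ^ 5"
  defines "y \<equiv> (x / 2) ^ 8"
  defines "s \<equiv> gb * sqrt (y * (1 + x / 2))" and "s' \<equiv> ga * sqrt (y + x ^ 9)"
  shows "0 < s" "s < s'" "s' / s * exp (dm\<^sup>2 / (2 * (s'\<^sup>2 - s\<^sup>2))) \<le> exp ((129 + 1 / c\<^sup>2) * x)"
proof -
  have y: "0 < y" "x ^ 8 = 256 * y" using x by (auto simp: y_def power_divide)
  have x9: "x ^ 9 = y * (256 * x)"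
  proof -
    have "x ^ 9 = x ^ 8 * x" by (simp add: power_Suc2[symmetric])
    then show ?thesis using y by simp
  qed
  have g: "0 < ga" "0 < gb" using c by auto
  show s: "0 < s" using g y x by (simp add: s_def)
  have cx: "c * x \<le> ga * x" "c * x \<le> gb * x" using c x by (auto intro: mult_right_mono)
  have ab: "gb \<le> ga * (1 + x)" "ga \<le> gb * (1 + x)" using d cx by (auto simp: algebra_simps)
  have s2: "s\<^sup>2 = gb\<^sup>2 * (y * (1 + x / 2))" "s'\<^sup>2 = ga\<^sup>2 * (y * (1 + 256 * x))"
    using y x by (simp_all add: s_def s'_def power_mult_distrib x9 algebra_simps)
  have "s\<^sup>2 \<le> (ga * (1 + x))\<^sup>2 * (y * (1 + x / 2))"
    unfolding s2 using ab g y x by (intro mult_right_mono power_mono) auto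
  also have "\<dots> = ga\<^sup>2 * y * ((1 + x)\<^sup>2 * (1 + x / 2))" by (simp add: power_mult_distrib)
  \<comment> \<open>The cubic has coefficients 5/2, 2 and 1/2 beyond the constant term; they add up
    to 5, and x is at most 1.\<close>
  also have "\<dots> \<le> ga\<^sup>2 * y * (1 + 5 * x)"
  proof (intro mult_left_mono)
    have "x * x \<le> x" using x mult_left_le[of x x] by simp
    moreover have "x * (x * x) \<le> x * x" using calculation x by (intro mult_left_mono) auto
    ultimately show "(1 + x)\<^sup>2 * (1 + x / 2) \<le> 1 + 5 * x" by (simp add: power2_eq_square algebra_simps)
  qed (use y in auto)
  finally have "s'\<^sup>2 - s\<^sup>2 \<ge> ga\<^sup>2 * y * (251 * x)" unfolding s2 by (simp add: algebra_simps)
  moreover have "c\<^sup>2 * y * (128 * x) \<le> ga\<^sup>2 * y * (251 * x)"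
    using c y x by (intro mult_mono power_mono) auto
  moreover have "c\<^sup>2 * x ^ 9 / 2 = c\<^sup>2 * y * (128 * x)" by (simp add: x9)
  ultimately have diff: "c\<^sup>2 * x ^ 9 / 2 \<le> s'\<^sup>2 - s\<^sup>2" by linarith
  have pos: "0 < c\<^sup>2 * x ^ 9 / 2" using c x by simp
  have s'0: "0 < s'" using g y x by (simp add: s'_def add_pos_pos)
  have "s\<^sup>2 < s'\<^sup>2" using diff pos by linarith
  then show "s < s'" using s'0 by (simp add: power_less_imp_less_base)
  have "\<bar>dm\<bar>\<^sup>2 \<le> (x ^ 5)\<^sup>2" using dm by (rule power_mono) simp
  then have "dm\<^sup>2 \<le> (x ^ 5)\<^sup>2" by simp
  also have "\<dots> = x ^ 9 * x" by (simp add: power_mult[symmetric] power_Suc2[symmetric])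
  finally have "dm\<^sup>2 \<le> x ^ 9 * x" .
  then have "dm\<^sup>2 / (2 * (s'\<^sup>2 - s\<^sup>2)) \<le> (x ^ 9 * x) / (2 * (c\<^sup>2 * x ^ 9 / 2))"
    using diff pos x by (intro frac_le) auto
  also have "\<dots> = x / c\<^sup>2" using x by simp
  finally have e1: "exp (dm\<^sup>2 / (2 * (s'\<^sup>2 - s\<^sup>2))) \<le> exp (x / c\<^sup>2)" by simp
  have "sqrt (1 + 256 * x) \<le> 1 + 128 * x"
    by (rule real_le_lsqrt) (use x in \<open>auto simp: power2_eq_square algebra_simps\<close>)
  also have "\<dots> \<le> exp (128 * x)" by (simp add: exp_ge_add_one_self)
  finally have q: "sqrt (1 + 256 * x) \<le> exp (128 * x)" .
  \<comment> \<open>The constant 129 is 1 from the ratio of the coefficients plus 128 from the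
    square root of 1 + 256 * x.\<close>
  have "ga \<le> gb * exp x" using ab(2) g exp_ge_add_one_self[of x] by (meson mult_left_mono less_imp_le order_trans)
  moreover have "sqrt (y + x ^ 9) \<le> sqrt y * exp (128 * x)"
  proof -
    have "sqrt (y + x ^ 9) = sqrt y * sqrt (1 + 256 * x)"
      unfolding real_sqrt_mult[symmetric] by (simp add: x9 distrib_left)
    then show ?thesis using q y by simp
  qed
  ultimately have "s' \<le> (gb * exp x) * (sqrt y * exp (128 * x))"
    unfolding s'_def using y x g by (intro mult_mono) auto
  also have "\<dots> = (gb * sqrt y) * exp (129 * x)" by (simp add: exp_add[symmetric])
  also have "\<dots> \<le> s * exp (129 * x)"
    unfolding s_def using g y x by (intro mult_right_mono mult_left_mono) auto
  finally have "s' / s \<le> exp (129 * x)" using s by (simp add: field_simps)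
  then have "s' / s * exp (dm\<^sup>2 / (2 * (s'\<^sup>2 - s\<^sup>2))) \<le> exp (129 * x) * exp (x / c\<^sup>2)"
    using e1 s s'0 by (intro mult_mono) auto
  also have "\<dots> = exp ((129 + 1 / c\<^sup>2) * x)" by (simp add: exp_add[symmetric] algebra_simps)
  finally show "s' / s * exp (dm\<^sup>2 / (2 * (s'\<^sup>2 - s\<^sup>2))) \<le> exp ((129 + 1 / c\<^sup>2) * x)" .
qed

context diagonal_sde
begin

text \<open>The law of U r + g (U r) v N, with N standard Gaussian and independent, restricted to
  confined paths. \<open>v\<close> is a deviation; its square plays the role of elapsed
  time.\<close>

definition frozen_mass :: "real \<Rightarrow> real \<Rightarrow> real \<Rightarrow> ('i \<Rightarrow> real) set \<Rightarrow> ennreal" where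
  "frozen_mass R r v A =
     (\<integral>\<^sup>+\<omega>\<in>confined R r. gauss_prod I (U r \<omega>) (\<lambda>i. \<bar>g (U r \<omega> i)\<bar> * v) A \<partial>M)"

lemma g_U_measurable: "r \<in> {0..T} \<Longrightarrow> i \<in> I \<Longrightarrow> (\<lambda>\<omega>. g (U r \<omega> i)) \<in> borel_measurable (F r)"
  using measurable_compose[OF U_adapted g_measurable] .

lemma frozen_mass_le_1:
  assumes "0 < v"
  shows "frozen_mass R r v A \<le> 1"
proof -
  have "frozen_mass R r v A \<le> (\<integral>\<^sup>+\<omega>. 1 \<partial>M)"
    unfolding frozen_mass_def using assms g_nonzero
    by (intro nn_integral_mono) (auto split: split_indicator intro!: gauss_prod_le_1 finite_I)
  then show ?thesis by (simp add: emeasure_space_1)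
qed

text \<open>The sample point, seen through \<open>F r\<close>, and the normalised increment form a
  pair with product law. Tonelli separates the two averages, and the one over the increment adds r'
  - r to the variance.\<close>

lemma frozen_increment_convolution:
  assumes r: "0 \<le> r" "r < r'" "r' \<le> T" and v: "0 < v" and A: "A \<in> sets (\<Pi>\<^sub>M i\<in>I. borel)"
  shows "(\<integral>\<^sup>+\<omega>\<in>confined R r. gauss_prod I (\<lambda>i. U r \<omega> i + g (U r \<omega> i) * (B i r' \<omega> - B i r \<omega>))
      (\<lambda>i. \<bar>g (U r \<omega> i)\<bar> * v) A \<partial>M) = frozen_mass R r (sqrt (v\<^sup>2 + (r' - r))) A"
proof -
  define h where "h = r' - r"
  have h: "0 < h" using r by (simp add: h_def)
  have rT: "r \<in> {0..T}" "r' \<in> {0..T}" using r by auto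
  let ?P = "\<Pi>\<^sub>M i\<in>I. (borel :: real measure)"
  define W where "W \<omega> = (\<lambda>i\<in>I. (B i r' \<omega> - B i r \<omega>) / sqrt h)" for \<omega>
  define Q where "Q = restr_to_subalg M (F r)"
  have subr: "subalgebra M (F r)" using rT by (intro sub)
  have [measurable_cong]: "sets Q = sets (F r)" unfolding Q_def by (rule sets_restr_to_subalg[OF subr])
  have [simp]: "space Q = space M" unfolding Q_def by (rule space_restr_to_subalg)
  interpret Q: prob_space Q unfolding Q_def by (rule prob_space_restr_to_subalg[OF subr prob_space_axioms])
  interpret N: prob_space "std_gauss I :: ('i \<Rightarrow> real) measure"
    unfolding std_gauss_def by (intro prob_space_PiM prob_space_normal_density) simp
  have Bm: "i \<in> I \<Longrightarrow> B i r' \<in> borel_measurable M" "i \<in> I \<Longrightarrow> B i r \<in> borel_measurable M" for i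
    using rT B_measurable by auto
  have W [measurable]: "W \<in> measurable M ?P"
    unfolding W_def using Bm by (intro measurable_restrict) auto
  have idF [measurable]: "(\<lambda>\<omega>. \<omega>) \<in> measurable M (F r)"
    using subr by (intro measurableI) (auto simp: subalgebra_def)
  have setsQ: "sets (Q \<Otimes>\<^sub>M std_gauss I) = sets (F r \<Otimes>\<^sub>M ?P)"
    by (intro sets_pair_measure_cong) (simp_all add: sets_std_gauss \<open>sets Q = sets (F r)\<close>)
  have law: "Q \<Otimes>\<^sub>M std_gauss I = distr M (F r \<Otimes>\<^sub>M ?P) (\<lambda>\<omega>. (\<omega>, W \<omega>))"
  proof (rule pair_measure_eqI)
    show "sigma_finite_measure Q" "sigma_finite_measure (std_gauss I :: ('i \<Rightarrow> real) measure)"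
      by unfold_locales
    show "sets (Q \<Otimes>\<^sub>M std_gauss I) = sets (distr M (F r \<Otimes>\<^sub>M ?P) (\<lambda>\<omega>. (\<omega>, W \<omega>)))"
      unfolding sets_distr by (rule setsQ)
    fix G E assume "G \<in> sets Q" "E \<in> sets (std_gauss I :: ('i \<Rightarrow> real) measure)"
    then have G [measurable]: "G \<in> sets (F r)" and E [measurable]: "E \<in> sets ?P"
      by (simp_all add: sets_std_gauss \<open>sets Q = sets (F r)\<close>)
    have GM: "G \<subseteq> space M" using subr G sets.sets_into_space[OF G] by (auto simp: subalgebra_def)
    have "emeasure (distr M (F r \<Otimes>\<^sub>M ?P) (\<lambda>\<omega>. (\<omega>, W \<omega>))) (G \<times> E) =
        emeasure M ((\<lambda>\<omega>. (\<omega>, W \<omega>)) -` (G \<times> E) \<inter> space M)"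
      by (intro emeasure_distr) measurable
    also have "(\<lambda>\<omega>. (\<omega>, W \<omega>)) -` (G \<times> E) \<inter> space M = {\<omega>\<in>G. W \<omega> \<in> E}" using GM by auto
    also have "emeasure M \<dots> = emeasure M G * emeasure (std_gauss I) E"
      unfolding W_def h_def by (rule increments_law[OF r G E])
    also have "emeasure M G = emeasure Q G" unfolding Q_def by (rule emeasure_restr_to_subalg[OF subr G, symmetric])
    finally show "emeasure Q G * emeasure (std_gauss I) E = emeasure (distr M (F r \<Otimes>\<^sub>M ?P) (\<lambda>\<omega>. (\<omega>, W \<omega>))) (G \<times> E)" ..
  qed
  let ?f = "\<lambda>x. indicator (confined R r) (fst x) * gauss_prod I (\<lambda>i. U r (fst x) i + g (U r (fst x) i) * sqrt h * snd x i)
      (\<lambda>i. \<bar>g (U r (fst x) i)\<bar> * v) A"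
  have cF [measurable]: "confined R r \<in> sets (F r)" by (rule confined_sets_F[OF rT(1)])
  have U' [measurable]: "i \<in> I \<Longrightarrow> (\<lambda>\<omega>. U r \<omega> i) \<in> borel_measurable (F r)" for i
    using rT by (intro U_adapted)
  have fm [measurable]: "?f \<in> borel_measurable (F r \<Otimes>\<^sub>M ?P)"
  proof (intro borel_measurable_times_ennreal)
    show "(\<lambda>x. gauss_prod I (\<lambda>i. U r (fst x) i + g (U r (fst x) i) * sqrt h * snd x i)
      (\<lambda>i. \<bar>g (U r (fst x) i)\<bar> * v) A) \<in> borel_measurable (F r \<Otimes>\<^sub>M ?P)"
      by (intro gauss_prod_measurable[OF finite_I _ _ A]) measurable
  qed measurable
  have fm' [measurable]: "?f \<in> borel_measurable (Q \<Otimes>\<^sub>M std_gauss I)"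
    by (subst measurable_cong_sets[OF setsQ refl]) (rule fm)
  have "(\<integral>\<^sup>+\<omega>\<in>confined R r. gauss_prod I (\<lambda>i. U r \<omega> i + g (U r \<omega> i) * (B i r' \<omega> - B i r \<omega>))
      (\<lambda>i. \<bar>g (U r \<omega> i)\<bar> * v) A \<partial>M) = (\<integral>\<^sup>+\<omega>. ?f (\<omega>, W \<omega>) \<partial>M)"
    using h by (intro nn_integral_cong) (auto simp: W_def mult.commute intro!: arg_cong2[where f = "(*)"] gauss_prod_cong)
  also have "\<dots> = (\<integral>\<^sup>+x. ?f x \<partial>distr M (F r \<Otimes>\<^sub>M ?P) (\<lambda>\<omega>. (\<omega>, W \<omega>)))"
    by (subst nn_integral_distr) auto
  also have "\<dots> = (\<integral>\<^sup>+x. ?f x \<partial>(Q \<Otimes>\<^sub>M std_gauss I))" unfolding law ..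
  also have "\<dots> = (\<integral>\<^sup>+\<omega>. \<integral>\<^sup>+w. ?f (\<omega>, w) \<partial>std_gauss I \<partial>Q)"
    by (rule N.nn_integral_fst[symmetric]) (rule fm')
  also have "\<dots> = (\<integral>\<^sup>+\<omega>. gauss_prod I (U r \<omega>) (\<lambda>i. \<bar>g (U r \<omega> i)\<bar> * sqrt (v\<^sup>2 + h)) A * indicator (confined R r) \<omega> \<partial>Q)"
  proof (intro nn_integral_cong)
    fix \<omega> assume \<omega>: "\<omega> \<in> space Q"
    have "(\<lambda>w. gauss_prod I (\<lambda>i. U r \<omega> i + g (U r \<omega> i) * sqrt h * w i) (\<lambda>i. \<bar>g (U r \<omega> i)\<bar> * v) A) \<in> borel_measurable (std_gauss I)"
      by (intro gauss_prod_measurable[OF finite_I _ _ A]) measurable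
    then have "(\<integral>\<^sup>+w. ?f (\<omega>, w) \<partial>std_gauss I) = indicator (confined R r) \<omega> *
      (\<integral>\<^sup>+w. gauss_prod I (\<lambda>i. U r \<omega> i + g (U r \<omega> i) * sqrt h * w i) (\<lambda>i. \<bar>g (U r \<omega> i)\<bar> * v) A \<partial>std_gauss I)"
      by (simp add: nn_integral_cmult)
    also have "(\<integral>\<^sup>+w. gauss_prod I (\<lambda>i. U r \<omega> i + g (U r \<omega> i) * sqrt h * w i) (\<lambda>i. \<bar>g (U r \<omega> i)\<bar> * v) A \<partial>std_gauss I) =
      gauss_prod I (U r \<omega>) (\<lambda>i. sqrt ((\<bar>g (U r \<omega> i)\<bar> * v)\<^sup>2 + (g (U r \<omega> i) * sqrt h)\<^sup>2)) A"
      using v h g_nonzero by (intro gauss_prod_convolution[OF finite_I _ _ A]) auto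
    also have "\<dots> = gauss_prod I (U r \<omega>) (\<lambda>i. \<bar>g (U r \<omega> i)\<bar> * sqrt (v\<^sup>2 + h)) A"
    proof (intro gauss_prod_cong refl)
      fix i
      have "(\<bar>g (U r \<omega> i)\<bar> * v)\<^sup>2 + (g (U r \<omega> i) * sqrt h)\<^sup>2 = (g (U r \<omega> i))\<^sup>2 * (v\<^sup>2 + h)"
        using h by (simp add: power_mult_distrib algebra_simps)
      then show "sqrt ((\<bar>g (U r \<omega> i)\<bar> * v)\<^sup>2 + (g (U r \<omega> i) * sqrt h)\<^sup>2) = \<bar>g (U r \<omega> i)\<bar> * sqrt (v\<^sup>2 + h)"
        by (simp add: real_sqrt_mult)
    qed
    finally show "(\<integral>\<^sup>+w. ?f (\<omega>, w) \<partial>std_gauss I) =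
      gauss_prod I (U r \<omega>) (\<lambda>i. \<bar>g (U r \<omega> i)\<bar> * sqrt (v\<^sup>2 + h)) A * indicator (confined R r) \<omega>"
      by (simp add: mult.commute)
  qed
  also have "\<dots> = frozen_mass R r (sqrt (v\<^sup>2 + h)) A"
    unfolding frozen_mass_def
  proof (rule nn_integral_subalgebra)
    show "(\<lambda>\<omega>. gauss_prod I (U r \<omega>) (\<lambda>i. \<bar>g (U r \<omega> i)\<bar> * sqrt (v\<^sup>2 + h)) A * indicator (confined R r) \<omega>) \<in> borel_measurable Q"
      unfolding measurable_cong_sets[OF \<open>sets Q = sets (F r)\<close> refl]
      using cF by (intro borel_measurable_times_ennreal gauss_prod_measurable[OF finite_I _ _ A]
          borel_measurable_indicator U' borel_measurable_times borel_measurable_abs borel_measurable_const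
          g_U_measurable[OF rT(1)])
    show "sets Q \<subseteq> sets M" using subr by (simp add: \<open>sets Q = sets (F r)\<close> subalgebra_def)
    show "emeasure Q X = emeasure M X" if "X \<in> sets Q" for X
      unfolding Q_def using that by (intro emeasure_restr_to_subalg[OF subr]) (simp add: \<open>sets Q = sets (F r)\<close>)
  qed simp
  finally show ?thesis by (simp add: h_def)
qed

end

section \<open>Absolute continuity of the marginal laws\<close>

context diagonal_sde
begin

text \<open>With \<open>\<epsilon> = x\<^sup>8\<close>, the Gaussian frozen at time \<open>t - \<epsilon>\<close> gets the variance \<open>\<epsilon> (1 + x)\<close> instead of \<open>\<epsilon>\<close>. The
  excess shrinks relative to \<open>\<epsilon>\<close> when \<open>x\<close> is halved, which leaves room for the errors of the step.\<close>

definition scale_mass :: "real \<Rightarrow> real \<Rightarrow> real \<Rightarrow> ('i \<Rightarrow> real) set \<Rightarrow> ennreal" where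
  "scale_mass R t x A = frozen_mass R (t - x ^ 8) (sqrt (x ^ 8 * (1 + x))) A"

text \<open>With h = x^8, q = x^2, e = x^5 and d = x^11 all three terms are multiples of x: x^8 *
  x^4 / x^11 twice, and x^11 / x^10.\<close>

lemma frozen_coefficient_error_scaled:
  assumes C: "\<forall>u. (\<forall>i\<in>I. \<bar>u i\<bar> \<le> R) \<longrightarrow> (\<forall>i\<in>I. \<bar>b u i\<bar> \<le> C)" "0 \<le> C"
    and r: "0 \<le> r" "r \<le> r'" "r' \<le> T" "0 < r'"
    and x: "0 < x" "x \<le> 1" "r' - r \<le> x ^ 8" "C * x \<le> 1 / 2" and i: "i \<in> I"
  shows "measure M {\<omega>\<in>confined R r'. x ^ 5 < \<bar>U r' \<omega> i - (U r \<omega> i + g (U r \<omega> i) * (B i r' \<omega> - B i r \<omega>))\<bar>} \<le>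
    (4 * L\<^sup>2 + 64 * K ^ 4 + 64) * x"
proof -
  have Ch: "C * x ^ 8 = (C * x) * x ^ 7" by (simp add: power_Suc[symmetric])
  have "C * x ^ 8 \<le> (1 / 2) * x ^ 7" unfolding Ch using x by (intro mult_right_mono) auto
  moreover have "x ^ 7 \<le> x ^ 5" "x ^ 7 \<le> x\<^sup>2" using x by (auto intro!: power_decreasing)
  moreover have "0 \<le> x ^ 7" using x by simp
  ultimately have small: "C * x ^ 8 \<le> x\<^sup>2" "C * x ^ 8 \<le> x ^ 5 / 2" by linarith+
  have "measure M {\<omega>\<in>confined R r'. x ^ 5 < \<bar>U r' \<omega> i - (U r \<omega> i + g (U r \<omega> i) * (B i r' \<omega> - B i r \<omega>))\<bar>} \<le>
    x ^ 8 * (4 * L\<^sup>2 * (x\<^sup>2)\<^sup>2 + 64 * K ^ 4 * x ^ 8 / (x\<^sup>2)\<^sup>2) / x ^ 11 + 64 * x ^ 11 / (x ^ 5)\<^sup>2"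
    using x small by (intro frozen_coefficient_error[OF C r] i) auto
  also have "\<dots> = (4 * L\<^sup>2 + 64 * K ^ 4 + 64) * x"
    using x by (simp add: field_simps power_mult[symmetric]) (simp add: algebra_simps power_numeral_reduce)
  finally show ?thesis .
qed

text \<open>A change of \<open>g\<close> by more than c * x forces \<open>U\<close> to move by more
  than 2q, where q = c * x / (2 * L). The drift accounts for at most q, so the stochastic integral
  moves by more than q.\<close>

lemma coefficient_increment_scaled:
  assumes C: "\<forall>u. (\<forall>i\<in>I. \<bar>u i\<bar> \<le> R) \<longrightarrow> (\<forall>i\<in>I. \<bar>b u i\<bar> \<le> C)" "0 \<le> C"
    and r: "0 \<le> r" "r \<le> r'" "r' \<le> T" "0 < r'"
    and x: "0 < x" "x \<le> 1" "r' - r \<le> x ^ 8" and c: "0 < c" "C * x \<le> c / (2 * L)" and i: "i \<in> I"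
  shows "measure M {\<omega>\<in>confined R r'. c * x < \<bar>g (U r' \<omega> i) - g (U r \<omega> i)\<bar>} \<le> 64 * K\<^sup>2 * L\<^sup>2 / c\<^sup>2 * x"
proof -
  have rT: "r \<in> {0..T}" "r' \<in> {0..T}" using r by auto
  have [measurable]: "Y i r' \<in> borel_measurable M" "Y i r \<in> borel_measurable M" using rT i by (auto intro: Y_measurable)
  let ?q = "c * x / (2 * L)"
  have q: "0 < ?q" using c x KL by simp
  have "C * x ^ 8 = (C * x) * x ^ 7" by (simp add: power_Suc[symmetric])
  also have "\<dots> \<le> (c / (2 * L)) * x"
  proof (rule mult_mono)
    show "x ^ 7 \<le> x" using x power_decreasing[of 1 7 x] by simp
  qed (use x c KL C in auto)
  finally have small: "C * x ^ 8 \<le> ?q" by simp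
  have "measure M {\<omega>\<in>confined R r'. c * x < \<bar>g (U r' \<omega> i) - g (U r \<omega> i)\<bar>} \<le>
    measure M {\<omega>\<in>space M. ?q < \<bar>Y i r' \<omega> - Y i r \<omega>\<bar>}"
  proof (rule finite_measure_mono_AE)
    show "AE \<omega> in M. \<omega> \<in> {\<omega>\<in>confined R r'. c * x < \<bar>g (U r' \<omega> i) - g (U r \<omega> i)\<bar>} \<longrightarrow>
      \<omega> \<in> {\<omega>\<in>space M. ?q < \<bar>Y i r' \<omega> - Y i r \<omega>\<bar>}"
      using drift_increment[OF C(1) r(1,2) order_refl r(3,4)] AE_space
    proof eventually_elim
      case (elim \<omega>)
      show ?case
      proof
        assume "\<omega> \<in> {\<omega>\<in>confined R r'. c * x < \<bar>g (U r' \<omega> i) - g (U r \<omega> i)\<bar>}"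
        then have \<omega>: "\<omega> \<in> confined R r'" "c * x < \<bar>g (U r' \<omega> i) - g (U r \<omega> i)\<bar>" by auto
        have "c * x < L * \<bar>U r' \<omega> i - U r \<omega> i\<bar>" using \<omega>(2) g_lipschitz by (rule less_le_trans)
        then have "c * x / L < \<bar>U r' \<omega> i - U r \<omega> i\<bar>" using KL by (simp add: field_simps)
        moreover have "c * x / L = 2 * ?q" by simp
        moreover have "\<bar>U r' \<omega> i - U r \<omega> i - (Y i r' \<omega> - Y i r \<omega>)\<bar> \<le> C * (r' - r)"
          using elim(1) \<omega>(1) i by blast
        moreover have "C * (r' - r) \<le> C * x ^ 8" using x C by (intro mult_left_mono) auto
        ultimately have "?q < \<bar>Y i r' \<omega> - Y i r \<omega>\<bar>" using small by linarith
        then show "\<omega> \<in> {\<omega>\<in>space M. ?q < \<bar>Y i r' \<omega> - Y i r \<omega>\<bar>}" using elim(2) by simp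
      qed
    qed
  qed measurable
  also have "\<dots> \<le> 16 * (K\<^sup>2 * x ^ 8) / ?q\<^sup>2"
    using r x q i by (intro ito_increment_tail) auto
  also have "\<dots> = 64 * K\<^sup>2 * L\<^sup>2 / c\<^sup>2 * x ^ 6"
    using x c KL by (simp add: field_simps power_mult_distrib)
  also have "\<dots> \<le> 64 * K\<^sup>2 * L\<^sup>2 / c\<^sup>2 * x"
    using x power_decreasing[of 1 6 x] by (intro mult_left_mono) auto
  finally show ?thesis .
qed

text \<open>Masses are at most 1, so a factor close to 1 costs only an additive error, and errors of
  successive scales can be summed.\<close>

lemma ennreal_exp_mult_le:
  fixes m :: ennreal
  assumes m: "m \<le> 1" and u: "0 \<le> u"
  shows "ennreal (exp u) * m \<le> m + ennreal (u * exp u)"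
proof -
  have "exp u * (1 + - u) \<le> exp u * exp (- u)"
    by (intro mult_left_mono exp_ge_add_one_self) simp
  then have e: "exp u - 1 \<le> u * exp u" by (simp add: exp_minus algebra_simps)
  have "ennreal (exp u) = 1 + ennreal (exp u - 1)"
    using u by (subst ennreal_1[symmetric], subst ennreal_plus[symmetric]) auto
  then have "ennreal (exp u) * m = m + ennreal (exp u - 1) * m" by (simp add: distrib_right)
  also have "\<dots> \<le> m + ennreal (u * exp u) * 1"
    using m e by (intro add_left_mono mult_mono ennreal_leI) auto
  finally show ?thesis by simp
qed

text \<open>Outside \<open>Bad\<close>, the finer Gaussian is dominated pathwise, up to the factor
  exp (D * x), by the coarser one centred at \<open>V\<close>. Confinement up to \<open>r'\<close>
  serves this comparison and is then relaxed to confinement up to \<open>r\<close>, an event of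
  \<open>F r\<close>, as averaging over the increment requires. \<open>C\<close> depends neither on
  \<open>A\<close> nor on x.\<close>

lemma scale_mass_step:
  assumes t: "t \<in> {0<..T}"
  obtains C x1 where "0 \<le> C" "0 < x1" "x1 \<le> 1" "x1 < t"
    "\<And>x A. 0 < x \<Longrightarrow> x \<le> x1 \<Longrightarrow> A \<in> sets (\<Pi>\<^sub>M i\<in>I. borel) \<Longrightarrow>
      scale_mass R t (x / 2) A \<le> scale_mass R t x A + ennreal (C * x)"
proof -
  obtain Cb where Cb: "\<forall>u. (\<forall>i\<in>I. \<bar>u i\<bar> \<le> R) \<longrightarrow> (\<forall>i\<in>I. \<bar>b u i\<bar> \<le> Cb)" "0 \<le> Cb"
    using drift_bounded[of R] by auto
  obtain c where c: "0 < c" "\<And>x. \<bar>x\<bar> \<le> R \<Longrightarrow> c \<le> \<bar>g x\<bar>"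
    using g_nondegenerate[of R] by auto
  define C1 where "C1 = 4 * L\<^sup>2 + 64 * K ^ 4 + 64 + 64 * K\<^sup>2 * L\<^sup>2 / c\<^sup>2"
  define D where "D = real (card I) * (129 + 1 / c\<^sup>2)"
  \<comment> \<open>The bound by t / 2 keeps the freezing times positive; the last two terms give
    the smallness of Cb * x required by the two error estimates. Dividing by Cb + 1 covers Cb =
    0.\<close>
  define x1 where "x1 = min (min 1 (t / 2)) (min (1 / 2 / (Cb + 1)) (c / (2 * L) / (Cb + 1)))"
  have D: "0 \<le> D" by (simp add: D_def)
  have C1: "0 \<le> C1" by (simp add: C1_def)
  have x1: "0 < x1" "x1 \<le> 1" "x1 < t" using t Cb(2) c KL by (auto simp: x1_def)
  have step: "scale_mass R t (x / 2) A \<le> scale_mass R t x A + ennreal ((D * exp D + real (card I) * C1) * x)"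
    if x: "0 < x" "x \<le> x1" and A: "A \<in> sets (\<Pi>\<^sub>M i\<in>I. borel)" for x A
  proof -
    have x': "x \<le> 1" "x < t" using x x1 by auto
    have Cx: "Cb * x \<le> 1 / 2" "Cb * x \<le> c / (2 * L)"
    proof -
      have "x \<le> 1 / 2 / (Cb + 1)" "x \<le> c / (2 * L) / (Cb + 1)"
        using x(2) unfolding x1_def by linarith+
      then have "x * (Cb + 1) \<le> 1 / 2" "x * (Cb + 1) \<le> c / (2 * L)"
        using Cb(2) pos_le_divide_eq[of "Cb + 1" x "1 / 2"] pos_le_divide_eq[of "Cb + 1" x "c / (2 * L)"] by linarith+
      moreover have "Cb * x \<le> x * (Cb + 1)" using x by (simp add: algebra_simps)
      ultimately show "Cb * x \<le> 1 / 2" "Cb * x \<le> c / (2 * L)" by linarith+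
    qed
    define r r' y where "r = t - x ^ 8" and "r' = t - (x / 2) ^ 8" and "y = (x / 2) ^ 8"
    have pw: "x ^ 8 \<le> x" "(x / 2) ^ 8 < x ^ 8" "0 < y"
      using x x' power_decreasing[of 1 8 x] by (auto simp: y_def power_divide)
    have r: "0 \<le> r" "r < r'" "r' \<le> T" "0 < r'" "r' - r \<le> x ^ 8"
      using pw x x' t unfolding r_def r'_def y_def greaterThanAtMost_iff by linarith+
    have rT: "r \<in> {0..T}" "r' \<in> {0..T}" using r by auto
    \<comment> \<open>Centre of the Gaussian frozen at \<open>r\<close>, once the Brownian increment
      up to \<open>r'\<close> is revealed.\<close>
    define V where "V \<omega> i = U r \<omega> i + g (U r \<omega> i) * (B i r' \<omega> - B i r \<omega>)" for \<omega> i
    define bad where "bad i = {\<omega>\<in>confined R r'. x ^ 5 < \<bar>U r' \<omega> i - V \<omega> i\<bar>} \<union>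
      {\<omega>\<in>confined R r'. c * x < \<bar>g (U r' \<omega> i) - g (U r \<omega> i)\<bar>}" for i
    have Gm [measurable]: "confined R r \<in> sets M" "confined R r' \<in> sets M" using rT confined_sets_M by auto
    have Um [measurable]: "(\<lambda>\<omega>. U r \<omega> i) \<in> borel_measurable M" "(\<lambda>\<omega>. U r' \<omega> i) \<in> borel_measurable M"
      "B i r \<in> borel_measurable M" "B i r' \<in> borel_measurable M" if "i \<in> I" for i
      using rT that by (auto intro: U_measurable B_measurable)
    have Vm [measurable]: "(\<lambda>\<omega>. V \<omega> i) \<in> borel_measurable M" if "i \<in> I" for i
      unfolding V_def using that by measurable
    have badm: "{\<omega>\<in>confined R r'. x ^ 5 < \<bar>U r' \<omega> i - V \<omega> i\<bar>} \<in> sets M"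
      "{\<omega>\<in>confined R r'. c * x < \<bar>g (U r' \<omega> i) - g (U r \<omega> i)\<bar>} \<in> sets M" if "i \<in> I" for i
      using that by measurable
    have bad_le: "measure M (bad i) \<le> C1 * x" if i: "i \<in> I" for i
    proof -
      have "measure M (bad i) \<le> measure M {\<omega>\<in>confined R r'. x ^ 5 < \<bar>U r' \<omega> i - V \<omega> i\<bar>} +
        measure M {\<omega>\<in>confined R r'. c * x < \<bar>g (U r' \<omega> i) - g (U r \<omega> i)\<bar>}"
        unfolding bad_def using badm[OF i] by (rule measure_Un_le)
      also have "\<dots> \<le> (4 * L\<^sup>2 + 64 * K ^ 4 + 64) * x + 64 * K\<^sup>2 * L\<^sup>2 / c\<^sup>2 * x"
        unfolding V_def using r x x' Cx c i
        by (intro add_mono frozen_coefficient_error_scaled[OF Cb] coefficient_increment_scaled[OF Cb]) auto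
      finally show ?thesis by (simp add: C1_def algebra_simps)
    qed
    define Bad where "Bad = (\<Union>i\<in>I. bad i)"
    have bm: "bad i \<in> sets M" if "i \<in> I" for i unfolding bad_def using badm[OF that] by auto
    have Bm [measurable]: "Bad \<in> sets M" unfolding Bad_def using bm finite_I by auto
    have "measure M Bad \<le> (\<Sum>i\<in>I. measure M (bad i))"
      unfolding Bad_def using bm finite_I by (intro finite_measure_subadditive_finite) auto
    also have "\<dots> \<le> (\<Sum>i\<in>I. C1 * x)" using bad_le by (rule sum_mono)
    finally have Bad_le: "measure M Bad \<le> real (card I) * C1 * x" by simp
    let ?s = "\<lambda>\<omega> i. \<bar>g (U r' \<omega> i)\<bar> * sqrt (y * (1 + x / 2))"
    let ?s' = "\<lambda>\<omega> i. \<bar>g (U r \<omega> i)\<bar> * sqrt (y + x ^ 9)"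
    let ?rhs = "\<lambda>\<omega>. indicator Bad \<omega> + ennreal (exp (D * x)) * (gauss_prod I (V \<omega>) (?s' \<omega>) A * indicator (confined R r) \<omega>)"
    have "scale_mass R t (x / 2) A = (\<integral>\<^sup>+\<omega>\<in>confined R r'. gauss_prod I (U r' \<omega>) (?s \<omega>) A \<partial>M)"
      by (simp add: scale_mass_def frozen_mass_def r'_def y_def)
    also have "\<dots> \<le> (\<integral>\<^sup>+\<omega>. ?rhs \<omega> \<partial>M)"
    proof (rule nn_integral_mono_AE)
      show "AE \<omega> in M. gauss_prod I (U r' \<omega>) (?s \<omega>) A * indicator (confined R r') \<omega> \<le> ?rhs \<omega>"
        using confined_AE_bound[of R]
      proof eventually_elim
        case (elim \<omega>)
        have s0: "0 < ?s \<omega> i" for i using pw x g_nonzero by simp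
        show ?case
        proof (cases "\<omega> \<in> confined R r'")
          case G: True
          then have Gr: "\<omega> \<in> confined R r" using confined_antimono[of r r' R] r by auto
          show ?thesis
          proof (cases "\<omega> \<in> Bad")
            case True
            have "gauss_prod I (U r' \<omega>) (?s \<omega>) A \<le> 1" using s0 finite_I by (intro gauss_prod_le_1) auto
            then show ?thesis using True G by (simp add: add_increasing2)
          next
            case nb: False
            have rat: "0 < ?s \<omega> i" "?s \<omega> i < ?s' \<omega> i"
              "?s' \<omega> i / ?s \<omega> i * exp ((U r' \<omega> i - V \<omega> i)\<^sup>2 / (2 * ((?s' \<omega> i)\<^sup>2 - (?s \<omega> i)\<^sup>2))) \<le> exp ((129 + 1 / c\<^sup>2) * x)"
              if i: "i \<in> I" for i
            proof -
              have "\<bar>U r' \<omega> i\<bar> \<le> R" "\<bar>U r \<omega> i\<bar> \<le> R" using elim G r i by auto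
              then have gc: "c \<le> \<bar>g (U r \<omega> i)\<bar>" "c \<le> \<bar>g (U r' \<omega> i)\<bar>" using c(2) by auto
              have "\<omega> \<notin> bad i" using nb i by (auto simp: Bad_def)
              then have "\<bar>g (U r' \<omega> i) - g (U r \<omega> i)\<bar> \<le> c * x" and dm: "\<bar>U r' \<omega> i - V \<omega> i\<bar> \<le> x ^ 5"
                using G by (auto simp: bad_def not_less)
              then have gd: "\<bar>\<bar>g (U r \<omega> i)\<bar> - \<bar>g (U r' \<omega> i)\<bar>\<bar> \<le> c * x" by linarith
              show "0 < ?s \<omega> i" "?s \<omega> i < ?s' \<omega> i"
                "?s' \<omega> i / ?s \<omega> i * exp ((U r' \<omega> i - V \<omega> i)\<^sup>2 / (2 * ((?s' \<omega> i)\<^sup>2 - (?s \<omega> i)\<^sup>2))) \<le> exp ((129 + 1 / c\<^sup>2) * x)"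
                using kernel_ratio[OF x(1) x'(1) c(1) gc gd dm] unfolding y_def by auto
            qed
            have "gauss_prod I (U r' \<omega>) (?s \<omega>) A \<le> ennreal (exp ((129 + 1 / c\<^sup>2) * x) ^ card I) * gauss_prod I (V \<omega>) (?s' \<omega>) A"
              using rat by (intro gauss_prod_le_wider[OF finite_I _ _ _ _ A]) auto
            also have "exp ((129 + 1 / c\<^sup>2) * x) ^ card I = exp (D * x)"
              by (simp add: D_def exp_of_nat_mult[symmetric] mult.assoc)
            finally show ?thesis using G Gr by (simp add: add_increasing)
          qed
        qed simp
      qed
    qed
    also have "\<dots> = ennreal (measure M Bad) + ennreal (exp (D * x)) *
      (\<integral>\<^sup>+\<omega>\<in>confined R r. gauss_prod I (V \<omega>) (?s' \<omega>) A \<partial>M)"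
    proof -
      have [measurable]: "(\<lambda>\<omega>. gauss_prod I (V \<omega>) (?s' \<omega>) A) \<in> borel_measurable M"
        by (intro gauss_prod_measurable[OF finite_I _ _ A]) measurable
      show ?thesis
        by (simp add: nn_integral_add nn_integral_cmult emeasure_eq_measure)
    qed
    also have "(\<integral>\<^sup>+\<omega>\<in>confined R r. gauss_prod I (V \<omega>) (?s' \<omega>) A \<partial>M) = scale_mass R t x A"
    proof -
      have "0 < sqrt (y + x ^ 9)" using pw x by (simp add: add_pos_pos)
      moreover have "(sqrt (y + x ^ 9))\<^sup>2 + (r' - r) = x ^ 8 * (1 + x)"
      proof -
        have "(sqrt (y + x ^ 9))\<^sup>2 = y + x ^ 9" using pw x by simp
        moreover have "x ^ 9 = x ^ 8 * x" by (simp add: power_Suc2[symmetric])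
        ultimately show ?thesis by (simp add: r_def r'_def y_def algebra_simps)
      qed
      ultimately show ?thesis
        unfolding V_def scale_mass_def using frozen_increment_convolution[OF r(1-3) _ A, of "sqrt (y + x ^ 9)" R]
        by (simp add: r_def)
    qed
    also have "ennreal (measure M Bad) + ennreal (exp (D * x)) * scale_mass R t x A \<le>
      ennreal (real (card I) * C1 * x) + (scale_mass R t x A + ennreal ((D * x) * exp (D * x)))"
    proof (intro add_mono ennreal_leI Bad_le ennreal_exp_mult_le)
      show "scale_mass R t x A \<le> 1" unfolding scale_mass_def using x by (intro frozen_mass_le_1) simp
    qed (use D x in auto)
    also have "\<dots> \<le> ennreal (real (card I) * C1 * x) + (scale_mass R t x A + ennreal ((D * x) * exp D))"
      using D x x' by (intro add_left_mono ennreal_leI mult_left_mono) (auto simp: mult_left_le)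
    also have "\<dots> = scale_mass R t x A + (ennreal (real (card I) * C1 * x) + ennreal ((D * x) * exp D))"
      by (simp add: ac_simps)
    also have "ennreal (real (card I) * C1 * x) + ennreal ((D * x) * exp D) = ennreal ((D * exp D + real (card I) * C1) * x)"
      using D x C1 by (subst ennreal_plus[symmetric]) (auto simp: algebra_simps)
    finally show ?thesis .
  qed
  show ?thesis
    by (rule that[of "D * exp D + real (card I) * C1" x1]) (use D C1 x1 step in auto)
qed

text \<open>The errors add up to C x (1 + 1/2 + 1/4 + ...). The induction carries the exact partial
  sum, because the limit 2 C x leaves no room for the next term.\<close>

lemma scale_mass_iterate:
  assumes C: "0 \<le> C" and x: "0 < x" "x \<le> x1"
    and step: "\<And>x. 0 < x \<Longrightarrow> x \<le> x1 \<Longrightarrow> scale_mass R t (x / 2) A \<le> scale_mass R t x A + ennreal (C * x)"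
  shows "scale_mass R t (x / 2 ^ k) A \<le> scale_mass R t x A + ennreal (2 * C * x)"
proof -
  have "scale_mass R t (x / 2 ^ k) A \<le> scale_mass R t x A + ennreal (2 * C * x * (1 - 1 / 2 ^ k))"
  proof (induction k)
    case (Suc k)
    have le: "x / 2 ^ k \<le> x" using x by (simp add: field_simps)
    have "scale_mass R t (x / 2 ^ Suc k) A = scale_mass R t (x / 2 ^ k / 2) A" by (simp add: field_simps)
    also have "\<dots> \<le> scale_mass R t (x / 2 ^ k) A + ennreal (C * (x / 2 ^ k))"
      using x le by (intro step) auto
    also have "\<dots> \<le> scale_mass R t x A + ennreal (2 * C * x * (1 - 1 / 2 ^ k)) + ennreal (C * (x / 2 ^ k))"
      by (intro add_right_mono Suc)
    also have "\<dots> = scale_mass R t x A + ennreal (2 * C * x * (1 - 1 / 2 ^ Suc k))"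
    proof -
      have "0 \<le> 2 * C * x * (1 - 1 / 2 ^ k)" "0 \<le> C * (x / 2 ^ k)"
        using C x by (auto intro!: mult_nonneg_nonneg)
      moreover have "2 * C * x * (1 - 1 / 2 ^ k) + C * (x / 2 ^ k) = 2 * C * x * (1 - 1 / 2 ^ Suc k)"
        by (simp add: field_simps)
      ultimately show ?thesis unfolding add.assoc by (metis ennreal_plus)
    qed
    finally show ?case .
  qed simp
  also have "\<dots> \<le> scale_mass R t x A + ennreal (2 * C * x)"
    using x C by (intro add_left_mono ennreal_leI) (simp add: mult_left_le)
  finally show ?thesis .
qed

text \<open>Fatou's lemma. On a confined path ending in \<open>A\<close>, continuity makes the
  centres converge to the endpoint while the deviations tend to 0, so the Gaussian mass of
  \<open>A\<close> tends to 1. Confinement up to \<open>t\<close> implies it at earlier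
  times.\<close>

lemma mass_le_liminf:
  assumes t: "t \<in> {0<..T}" and x: "0 < x" "x \<le> 1" "x < t"
    and A: "A \<in> sets (\<Pi>\<^sub>M i\<in>I. borel)"
    and A_open: "\<And>y. y \<in> A \<Longrightarrow> \<exists>r>0. \<forall>f\<in>extensional I. (\<forall>i\<in>I. \<bar>f i - y i\<bar> < r) \<longrightarrow> f \<in> A"
  shows "emeasure M {\<omega>\<in>confined R t. (\<lambda>i\<in>I. U t \<omega> i) \<in> A} \<le> liminf (\<lambda>k. scale_mass R t (x / 2 ^ k) A)"
proof -
  define z where "z k = x / 2 ^ k" for k :: nat
  have z: "0 < z k" "z k \<le> x" for k using x by (auto simp: z_def field_simps)
  have z0: "z \<longlonglongrightarrow> 0"
    unfolding z_def using tendsto_mult_right[OF LIMSEQ_power_zero[of "1 / 2 :: real"], of x]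
    by (simp add: power_divide)
  have z8: "z k ^ 8 < t" for k
    using z[of k] x power_decreasing[of 1 8 "z k"] by auto
  have rT: "t - z k ^ 8 \<in> {0..T}" "t \<in> {0..T}" for k
  proof -
    have "0 \<le> z k ^ 8" by simp
    then show "t - z k ^ 8 \<in> {0..T}" "t \<in> {0..T}"
      using z8[of k] t unfolding atLeastAtMost_iff greaterThanAtMost_iff by linarith+
  qed
  let ?u = "\<lambda>k \<omega>. gauss_prod I (U (t - z k ^ 8) \<omega>) (\<lambda>i. \<bar>g (U (t - z k ^ 8) \<omega> i)\<bar> * sqrt (z k ^ 8 * (1 + z k))) A
     * indicator (confined R (t - z k ^ 8)) \<omega>"
  have um [measurable]: "?u k \<in> borel_measurable M" for k
  proof -
    have [measurable]: "confined R (t - z k ^ 8) \<in> sets M" using rT by (intro confined_sets_M)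
    have [measurable]: "(\<lambda>\<omega>. U (t - z k ^ 8) \<omega> i) \<in> borel_measurable M" if "i \<in> I" for i
      using rT that by (intro U_measurable)
    have [measurable]: "(\<lambda>\<omega>. gauss_prod I (U (t - z k ^ 8) \<omega>) (\<lambda>i. \<bar>g (U (t - z k ^ 8) \<omega> i)\<bar> * sqrt (z k ^ 8 * (1 + z k))) A) \<in> borel_measurable M"
      by (intro gauss_prod_measurable[OF finite_I _ _ A]) measurable
    show ?thesis by measurable
  qed
  let ?E = "{\<omega>\<in>confined R t. (\<lambda>i\<in>I. U t \<omega> i) \<in> A}"
  have [measurable]: "?E \<in> sets M"
  proof -
    have [measurable]: "confined R t \<in> sets M" using rT by (intro confined_sets_M)
    have "(\<lambda>\<omega>. \<lambda>i\<in>I. U t \<omega> i) \<in> measurable M (\<Pi>\<^sub>M i\<in>I. borel)"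
      using rT U_measurable by (intro measurable_restrict) auto
    from measurable_sets[OF this A] have "(\<lambda>\<omega>. \<lambda>i\<in>I. U t \<omega> i) -` A \<inter> space M \<in> sets M" .
    moreover have "?E = confined R t \<inter> ((\<lambda>\<omega>. \<lambda>i\<in>I. U t \<omega> i) -` A \<inter> space M)"
      by (auto simp: confined_def)
    ultimately show ?thesis by simp
  qed
  have "emeasure M ?E = (\<integral>\<^sup>+\<omega>. indicator ?E \<omega> \<partial>M)" by simp
  also have "\<dots> \<le> (\<integral>\<^sup>+\<omega>. liminf (\<lambda>k. ?u k \<omega>) \<partial>M)"
  proof (rule nn_integral_mono_AE)
    show "AE \<omega> in M. indicator ?E \<omega> \<le> liminf (\<lambda>k. ?u k \<omega>)"
      using U_continuous
    proof eventually_elim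
      case (elim \<omega>)
      show ?case
      proof (cases "\<omega> \<in> ?E")
        case True
        then have \<omega>: "\<omega> \<in> confined R t" "(\<lambda>i\<in>I. U t \<omega> i) \<in> A" by auto
        from A_open[OF \<omega>(2)] obtain d where d: "0 < d"
          "\<And>f. f \<in> extensional I \<Longrightarrow> (\<And>i. i \<in> I \<Longrightarrow> \<bar>f i - (\<lambda>i\<in>I. U t \<omega> i) i\<bar> < d) \<Longrightarrow> f \<in> A" by blast
        have tz: "(\<lambda>k. t - z k ^ 8) \<longlonglongrightarrow> t"
          using tendsto_diff[OF tendsto_const tendsto_power[OF z0, of 8], of t] by simp
        have "(\<lambda>k. gauss_prod I (U (t - z k ^ 8) \<omega>) (\<lambda>i. \<bar>g (U (t - z k ^ 8) \<omega> i)\<bar> * sqrt (z k ^ 8 * (1 + z k))) A) \<longlonglongrightarrow> 1"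
        proof (rule gauss_prod_tendsto_1[OF finite_I A d(1), where y = "\<lambda>i\<in>I. U t \<omega> i"])
          show "f \<in> A" if "f \<in> extensional I" "\<And>i. i \<in> I \<Longrightarrow> \<bar>f i - (\<lambda>i\<in>I. U t \<omega> i) i\<bar> < d" for f
            using that by (rule d(2))
          fix i assume i: "i \<in> I"
          have "continuous_on {0..T} (\<lambda>t. U t \<omega> i)" using elim i by blast
          from continuous_on_tendsto_compose[OF this tz]
          show "(\<lambda>k. U (t - z k ^ 8) \<omega> i) \<longlonglongrightarrow> (\<lambda>i\<in>I. U t \<omega> i) i" using rT i by simp
          have v0: "(\<lambda>k. K * sqrt (z k ^ 8 * (1 + z k))) \<longlonglongrightarrow> K * sqrt (0 ^ 8 * (1 + 0))"
            by (intro tendsto_intros z0)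
          show "(\<lambda>k. \<bar>g (U (t - z k ^ 8) \<omega> i)\<bar> * sqrt (z k ^ 8 * (1 + z k))) \<longlonglongrightarrow> 0"
          proof (rule tendsto_sandwich[where f = "\<lambda>_. 0" and h = "\<lambda>k. K * sqrt (z k ^ 8 * (1 + z k))"])
            show "(\<lambda>k. K * sqrt (z k ^ 8 * (1 + z k))) \<longlonglongrightarrow> 0" using v0 by simp
            show "\<forall>\<^sub>F k in sequentially. \<bar>g (U (t - z k ^ 8) \<omega> i)\<bar> * sqrt (z k ^ 8 * (1 + z k)) \<le> K * sqrt (z k ^ 8 * (1 + z k))"
              using g_bounded z(1) by (intro always_eventually allI mult_right_mono) (auto simp: less_imp_le)
            show "\<forall>\<^sub>F k in sequentially. 0 \<le> \<bar>g (U (t - z k ^ 8) \<omega> i)\<bar> * sqrt (z k ^ 8 * (1 + z k))"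
              using z(1) by (intro always_eventually allI mult_nonneg_nonneg) (auto simp: less_imp_le)
          qed simp
          show "0 < \<bar>g (U (t - z k ^ 8) \<omega> i)\<bar> * sqrt (z k ^ 8 * (1 + z k))" for k
            using z(1)[of k] g_nonzero by simp
        qed
        moreover have "\<omega> \<in> confined R (t - z k ^ 8)" for k
          using \<omega>(1) confined_antimono[of "t - z k ^ 8" t R] z(1)[of k] by auto
        ultimately have "(\<lambda>k. ?u k \<omega>) \<longlonglongrightarrow> 1" by simp
        then have "liminf (\<lambda>k. ?u k \<omega>) = 1" by (intro lim_imp_Liminf) auto
        then show ?thesis using True by simp
      qed simp
    qed
  qed
  also have "\<dots> \<le> liminf (\<lambda>k. \<integral>\<^sup>+\<omega>. ?u k \<omega> \<partial>M)"
    by (rule nn_integral_liminf) (rule um)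
  also have "(\<lambda>k. \<integral>\<^sup>+\<omega>. ?u k \<omega> \<partial>M) = (\<lambda>k. scale_mass R t (x / 2 ^ k) A)"
    unfolding scale_mass_def frozen_mass_def z_def ..
  finally show ?thesis .
qed

text \<open>As a function of the set, \<open>scale_mass\<close> is a finite measure: the second
  marginal of a density on the product of \<open>M\<close> with Lebesgue measure. It vanishes on
  \<open>N\<close>, and outer regularity provides \<open>A\<close>.\<close>

lemma scale_mass_outer_approx:
  assumes t: "t \<in> {0<..T}" and x: "0 < x" "x \<le> 1" "x < t" and e: "0 < e"
    and N: "N \<in> null_sets (\<Pi>\<^sub>M i\<in>I. lborel)"
  obtains A where "A \<in> sets (\<Pi>\<^sub>M i\<in>I. borel)" "N \<subseteq> A" "scale_mass R t x A < e"
    "\<And>y. y \<in> A \<Longrightarrow> \<exists>r>0. \<forall>f\<in>extensional I. (\<forall>i\<in>I. \<bar>f i - y i\<bar> < r) \<longrightarrow> f \<in> A"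
proof -
  define r where "r = t - x ^ 8"
  define v where "v = sqrt (x ^ 8 * (1 + x))"
  have "x ^ 8 \<le> x" "0 < x ^ 8" using x power_decreasing[of 1 8 x] by auto
  then have rT: "r \<in> {0..T}"
    using x t unfolding r_def atLeastAtMost_iff greaterThanAtMost_iff by linarith
  have v: "0 < v" using x by (simp add: v_def)
  let ?P = "\<Pi>\<^sub>M i\<in>I. (lborel :: real measure)"
  interpret L: product_sigma_finite "\<lambda>_::'i. lborel :: real measure"
    by (rule product_sigma_finite_lborel)
  interpret P: sigma_finite_measure ?P using finite_I by (rule L.sigma_finite)
  have [measurable]: "confined R r \<in> sets M" using rT by (rule confined_sets_M)
  have [measurable]: "(\<lambda>\<omega>. U r \<omega> i) \<in> borel_measurable M" if "i \<in> I" for i using rT that by (rule U_measurable)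
  have [measurable]: "(\<lambda>x. snd x i) \<in> borel_measurable (M \<Otimes>\<^sub>M ?P)" if "i \<in> I" for i using that by measurable
  define p where "p x = (\<Prod>i\<in>I. ennreal (normal_density (U r (fst x) i) (\<bar>g (U r (fst x) i)\<bar> * v) (snd x i))) *
     indicator (confined R r) (fst x)" for x
  have [measurable]: "p \<in> borel_measurable (M \<Otimes>\<^sub>M ?P)" unfolding p_def by measurable
  define Q where "Q = distr (density (M \<Otimes>\<^sub>M ?P) p) ?P snd"
  have Q: "emeasure Q A = scale_mass R t x A" if A: "A \<in> sets (\<Pi>\<^sub>M i\<in>I. borel)" for A
  proof -
    have A' [measurable]: "A \<in> sets ?P" using A by (simp only: sets_PiM_lborel)
    have "emeasure Q A = emeasure (density (M \<Otimes>\<^sub>M ?P) p) (snd -` A \<inter> space (M \<Otimes>\<^sub>M ?P))"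
      unfolding Q_def by (subst emeasure_distr) auto
    also have "\<dots> = (\<integral>\<^sup>+x. p x * indicator (snd -` A \<inter> space (M \<Otimes>\<^sub>M ?P)) x \<partial>(M \<Otimes>\<^sub>M ?P))"
      by (rule emeasure_density) measurable
    also have "\<dots> = (\<integral>\<^sup>+x. p x * indicator A (snd x) \<partial>(M \<Otimes>\<^sub>M ?P))"
      by (intro nn_integral_cong) (auto split: split_indicator)
    also have "\<dots> = (\<integral>\<^sup>+\<omega>. \<integral>\<^sup>+f. p (\<omega>, f) * indicator A f \<partial>?P \<partial>M)"
      by (subst P.nn_integral_fst[symmetric]) auto
    also have "\<dots> = scale_mass R t x A"
      unfolding scale_mass_def frozen_mass_def r_def[symmetric] v_def[symmetric] gauss_prod_def
    proof (intro nn_integral_cong)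
      fix \<omega> assume \<omega>: "\<omega> \<in> space M"
      have [measurable]: "i \<in> I \<Longrightarrow> (\<lambda>f. f i) \<in> borel_measurable ?P" for i by measurable
      show "(\<integral>\<^sup>+f. p (\<omega>, f) * indicator A f \<partial>?P) =
        (\<integral>\<^sup>+f. (\<Prod>i\<in>I. ennreal (normal_density (U r \<omega> i) (\<bar>g (U r \<omega> i)\<bar> * v) (f i))) * indicator A f \<partial>?P) * indicator (confined R r) \<omega>"
        by (subst nn_integral_multc[symmetric]) (auto simp: p_def mult_ac)
    qed
    finally show ?thesis .
  qed
  have sQ: "sets Q = sets (\<Pi>\<^sub>M i\<in>I. borel)" unfolding Q_def sets_distr by (rule sets_PiM_lborel)
  have fin: "emeasure Q (space Q) \<noteq> \<infinity>"
  proof -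
    have sp: "space Q \<in> sets (\<Pi>\<^sub>M i\<in>I. borel)" unfolding sQ[symmetric] by (rule sets.top)
    have "emeasure Q (space Q) \<le> 1"
      unfolding Q[OF sp] scale_mass_def using v by (intro frozen_mass_le_1) (simp add: v_def)
    then show ?thesis by (auto simp: top_unique)
  qed
  have NB: "N \<in> sets (\<Pi>\<^sub>M i\<in>I. borel)" using N by (auto simp: null_sets_def sets_PiM_lborel)
  have "emeasure Q N = 0"
    unfolding Q[OF NB] scale_mass_def frozen_mass_def using gauss_prod_null[OF finite_I N] by simp
  then have "emeasure Q N < e" using e by simp
  from outer_approx_PiM_borel[OF finite_I sQ fin NB this]
  show ?thesis using Q that by (metis (no_types, lifting))
qed

text \<open>For each x choose an open \<open>A\<close> with \<open>scale_mass\<close> below x. The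
  iterated step bounds the limit inferior by x + 2 C x, with \<open>C\<close> the same for every
  choice of \<open>A\<close>, and x tends to 0.\<close>

lemma confined_null:
  assumes t: "t \<in> {0<..T}" and N: "N \<in> null_sets (\<Pi>\<^sub>M i\<in>I. lborel)"
  shows "emeasure M {\<omega>\<in>confined R t. (\<lambda>i\<in>I. U t \<omega> i) \<in> N} = 0"
proof -
  obtain C x1 where C: "0 \<le> C" and x1: "0 < x1" "x1 \<le> 1" "x1 < t"
    and step: "\<And>x A. 0 < x \<Longrightarrow> x \<le> x1 \<Longrightarrow> A \<in> sets (\<Pi>\<^sub>M i\<in>I. borel) \<Longrightarrow>
      scale_mass R t (x / 2) A \<le> scale_mass R t x A + ennreal (C * x)"
    using scale_mass_step[OF t, of R] by metis
  have le: "emeasure M {\<omega>\<in>confined R t. (\<lambda>i\<in>I. U t \<omega> i) \<in> N} \<le> ennreal ((1 + 2 * C) * x)"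
    if x: "0 < x" "x \<le> x1" for x
  proof -
    have x': "x \<le> 1" "x < t" using x x1 by auto
    obtain A where A: "A \<in> sets (\<Pi>\<^sub>M i\<in>I. borel)" "N \<subseteq> A" "scale_mass R t x A < ennreal x"
      "\<And>y. y \<in> A \<Longrightarrow> \<exists>r>0. \<forall>f\<in>extensional I. (\<forall>i\<in>I. \<bar>f i - y i\<bar> < r) \<longrightarrow> f \<in> A"
      using scale_mass_outer_approx[OF t x(1) x' _ N, of "ennreal x" R] x by (metis ennreal_less_zero_iff)
    have tT: "t \<in> {0..T}" using t by auto
    have "emeasure M {\<omega>\<in>confined R t. (\<lambda>i\<in>I. U t \<omega> i) \<in> N} \<le> emeasure M {\<omega>\<in>confined R t. (\<lambda>i\<in>I. U t \<omega> i) \<in> A}"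
    proof (rule emeasure_mono)
      have "(\<lambda>\<omega>. \<lambda>i\<in>I. U t \<omega> i) \<in> measurable M (\<Pi>\<^sub>M i\<in>I. borel)"
        using tT U_measurable by (intro measurable_restrict) auto
      from measurable_sets[OF this A(1)] have "(\<lambda>\<omega>. \<lambda>i\<in>I. U t \<omega> i) -` A \<inter> space M \<in> sets M" .
      moreover have "{\<omega>\<in>confined R t. (\<lambda>i\<in>I. U t \<omega> i) \<in> A} = confined R t \<inter> ((\<lambda>\<omega>. \<lambda>i\<in>I. U t \<omega> i) -` A \<inter> space M)"
        by (auto simp: confined_def)
      ultimately show "{\<omega>\<in>confined R t. (\<lambda>i\<in>I. U t \<omega> i) \<in> A} \<in> sets M"
        using confined_sets_M[OF tT] by simp
    qed (use A(2) in auto)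
    also have "\<dots> \<le> liminf (\<lambda>k. scale_mass R t (x / 2 ^ k) A)"
      by (rule mass_le_liminf[OF t x(1) x' A(1,4)])
    also have "\<dots> \<le> scale_mass R t x A + ennreal (2 * C * x)"
    proof -
      have "scale_mass R t (x / 2 ^ k) A \<le> scale_mass R t x A + ennreal (2 * C * x)" for k
        using C x by (rule scale_mass_iterate) (rule step[OF _ _ A(1)])
      then have "limsup (\<lambda>k. scale_mass R t (x / 2 ^ k) A) \<le> scale_mass R t x A + ennreal (2 * C * x)"
        by (intro Limsup_bounded always_eventually allI)
      then show ?thesis using Liminf_le_Limsup[of sequentially "\<lambda>k. scale_mass R t (x / 2 ^ k) A"] by (auto intro: order_trans)
    qed
    also have "\<dots> \<le> ennreal x + ennreal (2 * C * x)" using A(3) by (intro add_right_mono less_imp_le)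
    also have "\<dots> = ennreal ((1 + 2 * C) * x)"
      using C x by (subst ennreal_plus[symmetric]) (auto simp: algebra_simps)
    finally show ?thesis .
  qed
  have "(\<lambda>k. ennreal ((1 + 2 * C) * (x1 / real (Suc k)))) \<longlonglongrightarrow> ennreal ((1 + 2 * C) * 0)"
    by (intro tendsto_ennrealI tendsto_intros tendsto_divide_0[OF tendsto_const] filterlim_at_top_imp_at_infinity
      filterlim_compose[OF filterlim_real_sequentially filterlim_Suc])
  then have "emeasure M {\<omega>\<in>confined R t. (\<lambda>i\<in>I. U t \<omega> i) \<in> N} \<le> ennreal ((1 + 2 * C) * 0)"
  proof (rule LIMSEQ_le_const, intro exI allI impI)
    fix k
    show "emeasure M {\<omega>\<in>confined R t. (\<lambda>i\<in>I. U t \<omega> i) \<in> N} \<le> ennreal ((1 + 2 * C) * (x1 / real (Suc k)))"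
      using x1 by (intro le) (auto simp: field_simps)
  qed
  then show ?thesis by simp
qed

text \<open>Continuous paths are bounded on [0, t], so the countably many events
  \<open>confined n t\<close> exhaust the space up to a null set.\<close>

theorem marginal_absolutely_continuous:
  assumes t: "t \<in> {0<..T}"
  shows "absolutely_continuous (\<Pi>\<^sub>M i\<in>I. lborel)
    (distr M (\<Pi>\<^sub>M i\<in>I. borel) (\<lambda>\<omega>. \<lambda>i\<in>I. U t \<omega> i))"
  unfolding absolutely_continuous_def
proof
  fix N assume N: "N \<in> null_sets (\<Pi>\<^sub>M i\<in>I. (lborel :: real measure))"
  have NB: "N \<in> sets (\<Pi>\<^sub>M i\<in>I. borel)" using N by (auto simp: null_sets_def sets_PiM_lborel)
  have tT: "t \<in> {0..T}" using t by auto
  have m [measurable]: "(\<lambda>\<omega>. \<lambda>i\<in>I. U t \<omega> i) \<in> measurable M (\<Pi>\<^sub>M i\<in>I. borel)"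
    using tT U_measurable by (intro measurable_restrict) auto
  have "AE \<omega> in M. \<forall>n::nat. \<omega> \<in> confined n t \<longrightarrow> (\<lambda>i\<in>I. U t \<omega> i) \<notin> N"
    unfolding AE_all_countable
  proof
    fix n :: nat
    have "{\<omega>\<in>confined n t. (\<lambda>i\<in>I. U t \<omega> i) \<in> N} = confined n t \<inter> ((\<lambda>\<omega>. \<lambda>i\<in>I. U t \<omega> i) -` N \<inter> space M)"
      by (auto simp: confined_def)
    then have "{\<omega>\<in>confined n t. (\<lambda>i\<in>I. U t \<omega> i) \<in> N} \<in> sets M"
      using measurable_sets[OF m NB] confined_sets_M[OF tT] by simp
    then have "{\<omega>\<in>confined n t. (\<lambda>i\<in>I. U t \<omega> i) \<in> N} \<in> null_sets M"
      using confined_null[OF t N] by (auto simp: null_sets_def)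
    from AE_not_in[OF this] show "AE \<omega> in M. \<omega> \<in> confined n t \<longrightarrow> (\<lambda>i\<in>I. U t \<omega> i) \<notin> N"
      by eventually_elim auto
  qed
  moreover have "AE \<omega> in M. \<exists>n::nat. \<omega> \<in> confined n t"
    using U_continuous AE_space
  proof eventually_elim
    case (elim \<omega>)
    have "\<exists>C. \<forall>s\<in>{0..t}. \<bar>U s \<omega> i\<bar> \<le> C" if "i \<in> I" for i
    proof -
      have "continuous_on {0..t} (\<lambda>s. U s \<omega> i)"
        using elim(1) that t by (auto intro: continuous_on_subset)
      then have "bounded ((\<lambda>s. U s \<omega> i) ` {0..t})"
        by (intro compact_imp_bounded compact_continuous_image) auto
      then show ?thesis by (auto simp: bounded_iff)
    qed
    then obtain C where C: "\<And>i s. i \<in> I \<Longrightarrow> s \<in> {0..t} \<Longrightarrow> \<bar>U s \<omega> i\<bar> \<le> C i" by metis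
    obtain n :: nat where n: "(\<Sum>i\<in>I. \<bar>C i\<bar>) \<le> n" using real_arch_simple by blast
    have "\<bar>U s \<omega> i\<bar> \<le> n" if "i \<in> I" "s \<in> {0..t}" for i s
    proof -
      have "\<bar>C i\<bar> \<le> (\<Sum>i\<in>I. \<bar>C i\<bar>)" using finite_I that(1) by (intro member_le_sum) auto
      then show ?thesis using C[OF that] n by linarith
    qed
    then show ?case using elim(2) by (intro exI[of _ n]) (auto simp: confined_def)
  qed
  ultimately have "AE \<omega> in M. (\<lambda>i\<in>I. U t \<omega> i) \<notin> N" by eventually_elim blast
  then have "AE \<omega> in M. \<omega> \<notin> (\<lambda>\<omega>. \<lambda>i\<in>I. U t \<omega> i) -` N \<inter> space M"
    by eventually_elim auto
  then have "(\<lambda>\<omega>. \<lambda>i\<in>I. U t \<omega> i) -` N \<inter> space M \<in> null_sets M"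
    unfolding AE_iff_null_sets[OF measurable_sets[OF m NB]] .
  then show "N \<in> null_sets (distr M (\<Pi>\<^sub>M i\<in>I. borel) (\<lambda>\<omega>. \<lambda>i\<in>I. U t \<omega> i))"
    using NB by (simp add: null_sets_distr_iff[OF m])
qed

end

section \<open>Increments of the Brownian sheet\<close>

text \<open>The formula includes v = 0, where both sides are 1, so degenerate linear combinations
  fit into the identification of the joint law.\<close>

lemma (in prob_space) centered_gaussian_char:
  assumes X: "centered_gaussian M X v"
  shows "X \<in> borel_measurable M" "(CLINT \<omega>|M. iexp (X \<omega>)) = complex_of_real (exp (- v / 2))"
proof -
  have "X \<in> borel_measurable M \<and> (CLINT \<omega>|M. iexp (X \<omega>)) = complex_of_real (exp (- v / 2))"
  proof (cases "v = 0")
    case True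
    then have m [measurable]: "X \<in> borel_measurable M" and ae: "AE \<omega> in M. X \<omega> = 0"
      using X by (auto simp: centered_gaussian_def)
    have "(CLINT \<omega>|M. iexp (X \<omega>)) = (CLINT \<omega>|M. 1)"
      using ae by (intro integral_cong_AE) (auto elim: AE_mp)
    then show ?thesis using True m by (simp add: prob_space)
  next
    case False
    then have v: "0 < v" and d: "distributed M lborel X (normal_density 0 (sqrt v))"
      using X by (auto simp: centered_gaussian_def)
    have m [measurable]: "X \<in> borel_measurable M" using distributed_measurable[OF d] by simp
    let ?Z = "\<lambda>\<omega>. X \<omega> / sqrt v"
    have dZ: "distributed M lborel ?Z std_normal_density"
      using d v by (subst (asm) normal_standard_normal_convert) auto
    have "distr M borel ?Z = distr M lborel ?Z" by (intro distr_cong) auto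
    also have "\<dots> = density lborel std_normal_density" using distributed_distr_eq_density[OF dZ] .
    finally have "(CLINT \<omega>|M. iexp (sqrt v * ?Z \<omega>)) = complex_of_real (exp (- (sqrt v)\<^sup>2 / 2))"
      by (intro char_std_normal_rv) measurable
    moreover have "sqrt v * ?Z \<omega> = X \<omega>" for \<omega> using v by simp
    ultimately show ?thesis using m v by simp
  qed
  then show "X \<in> borel_measurable M" "(CLINT \<omega>|M. iexp (X \<omega>)) = complex_of_real (exp (- v / 2))" by auto
qed

lemma (in prob_space) centered_gaussian_moments:
  assumes X: "centered_gaussian M X v" and v: "0 < v"
  shows "integrable M (\<lambda>\<omega>. (X \<omega>)\<^sup>2)" "(LINT \<omega>|M. X \<omega>) = 0" "(LINT \<omega>|M. (X \<omega>)\<^sup>2) = v"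
proof -
  have s: "0 < sqrt v" and d: "distributed M lborel X (normal_density 0 (sqrt v))"
    using X v by (auto simp: centered_gaussian_def)
  have i: "has_bochner_integral lborel (\<lambda>x. normal_density 0 (sqrt v) x * x\<^sup>2) v"
    using normal_moment_even[OF s, of 0 1] v by simp
  show "integrable M (\<lambda>\<omega>. (X \<omega>)\<^sup>2)"
    using distributed_integrable[OF d, of "\<lambda>x. x\<^sup>2"] i by (auto simp: has_bochner_integral_iff)
  show "(LINT \<omega>|M. (X \<omega>)\<^sup>2) = v"
    using distributed_integral[OF d, of "\<lambda>x. x\<^sup>2"] i by (auto simp: has_bochner_integral_iff)
  show "(LINT \<omega>|M. X \<omega>) = 0"
    using distributed_integral[OF d, of "\<lambda>x. x"] integral_normal_moment_nz_1[OF s, of 0] by simp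
qed

lemma Int_stable_vimages: "Int_stable {Y -` A \<inter> \<Omega> |A. A \<in> sets N}"
proof (rule Int_stableI)
  fix a b assume "a \<in> {Y -` A \<inter> \<Omega> |A. A \<in> sets N}" "b \<in> {Y -` A \<inter> \<Omega> |A. A \<in> sets N}"
  then obtain A B where "a = Y -` A \<inter> \<Omega>" "b = Y -` B \<inter> \<Omega>" "A \<in> sets N" "B \<in> sets N" by auto
  moreover from this have "a \<inter> b = Y -` (A \<inter> B) \<inter> \<Omega>" by auto
  ultimately show "a \<inter> b \<in> {Y -` A \<inter> \<Omega> |A. A \<in> sets N}" by blast
qed

text \<open>Coefficients of the sheet values at the grid points after summation by parts.\<close>

definition sheet_coeff :: "nat \<Rightarrow> (nat \<Rightarrow> real) \<Rightarrow> nat \<Rightarrow> real" where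
  "sheet_coeff n \<xi> k = (if 2 \<le> k then \<xi> (k - 1) else 0) - (if k \<le> n - 1 then \<xi> k else 0)"

lemma sheet_coeff_sum:
  assumes n: "2 \<le> n"
  shows "(\<Sum>k\<in>{1..n}. sheet_coeff n \<xi> k * w k) = (\<Sum>i\<in>{1..n - 1}. \<xi> i * (w (Suc i) - w i))"
proof -
  have "(\<Sum>k\<in>{1..n}. (if 2 \<le> k then \<xi> (k - 1) else 0) * w k) = (\<Sum>k\<in>{Suc 1..Suc (n - 1)}. \<xi> (k - 1) * w k)"
    using n by (intro sum.mono_neutral_cong_right) auto
  also have "\<dots> = (\<Sum>i\<in>{1..n - 1}. \<xi> i * w (Suc i))"
    by (subst sum.shift_bounds_cl_Suc_ivl) simp
  finally have a: "(\<Sum>k\<in>{1..n}. (if 2 \<le> k then \<xi> (k - 1) else 0) * w k) = (\<Sum>i\<in>{1..n - 1}. \<xi> i * w (Suc i))" .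
  have b: "(\<Sum>k\<in>{1..n}. (if k \<le> n - 1 then \<xi> k else 0) * w k) = (\<Sum>i\<in>{1..n - 1}. \<xi> i * w i)"
    using n by (intro sum.mono_neutral_cong_right) auto
  show ?thesis
    unfolding sheet_coeff_def left_diff_distrib sum_subtractf a b right_diff_distrib ..
qed

text \<open>min k l counts the indices m that are at most both k and l, so the quadratic form is the
  sum over m of squared tail sums of the coefficients. The m-th tail sum telescopes to
  \<open>\<xi> (m - 1)\<close>, and to 0 for m = 1.\<close>

lemma sheet_coeff_min_sum:
  assumes n: "2 \<le> n"
  shows "(\<Sum>k\<in>{1..n}. \<Sum>l\<in>{1..n}. sheet_coeff n \<xi> k * sheet_coeff n \<xi> l * real (min k l)) = (\<Sum>i\<in>{1..n - 1}. (\<xi> i)\<^sup>2)"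
proof -
  let ?E = "sheet_coeff n \<xi>"
  let ?o = "\<lambda>m k::nat. if m \<le> k then 1 else 0 :: real"
  have min: "real (min k l) = (\<Sum>m\<in>{1..n}. ?o m k * ?o m l)" if "k \<in> {1..n}" "l \<in> {1..n}" for k l
  proof -
    have "(\<Sum>m\<in>{1..n}. ?o m k * ?o m l) = (\<Sum>m\<in>{1..min k l}. 1)"
      using that by (intro sum.mono_neutral_cong_right) auto
    then show ?thesis by simp
  qed
  have tail: "(\<Sum>k\<in>{1..n}. ?E k * ?o m k) = (if 2 \<le> m then \<xi> (m - 1) else 0)" if m: "m \<in> {1..n}" for m
  proof -
    have "(\<Sum>k\<in>{1..n}. ?E k * ?o m k) = (\<Sum>i\<in>{1..n - 1}. \<xi> i * (?o m (Suc i) - ?o m i))"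
      by (rule sheet_coeff_sum[OF n])
    also have "\<dots> = (\<Sum>i\<in>{1..n - 1}. if i = m - 1 then \<xi> i else 0)"
      using m by (intro sum.cong refl) auto
    also have "\<dots> = (if 2 \<le> m then \<xi> (m - 1) else 0)" using m by auto
    finally show ?thesis .
  qed
  have "(\<Sum>k\<in>{1..n}. \<Sum>l\<in>{1..n}. ?E k * ?E l * real (min k l)) =
    (\<Sum>k\<in>{1..n}. \<Sum>l\<in>{1..n}. \<Sum>m\<in>{1..n}. (?E k * ?o m k) * (?E l * ?o m l))"
    by (intro sum.cong refl, simp only: min sum_distrib_left) (simp only: mult_ac)
  also have "\<dots> = (\<Sum>k\<in>{1..n}. \<Sum>m\<in>{1..n}. \<Sum>l\<in>{1..n}. (?E k * ?o m k) * (?E l * ?o m l))"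
    by (intro sum.cong refl sum.swap)
  also have "\<dots> = (\<Sum>m\<in>{1..n}. \<Sum>k\<in>{1..n}. \<Sum>l\<in>{1..n}. (?E k * ?o m k) * (?E l * ?o m l))"
    by (rule sum.swap)
  also have "\<dots> = (\<Sum>m\<in>{1..n}. (\<Sum>k\<in>{1..n}. ?E k * ?o m k) * (\<Sum>l\<in>{1..n}. ?E l * ?o m l))"
    by (simp only: sum_product)
  also have "\<dots> = (\<Sum>m\<in>{1..n}. (if 2 \<le> m then \<xi> (m - 1) else 0)\<^sup>2)"
    by (intro sum.cong refl) (simp only: tail power2_eq_square)
  also have "\<dots> = (\<Sum>m\<in>{Suc 1..Suc (n - 1)}. (\<xi> (m - 1))\<^sup>2)"
    using n by (intro sum.mono_neutral_cong_right) auto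
  also have "\<dots> = (\<Sum>i\<in>{1..n - 1}. (\<xi> i)\<^sup>2)"
    by (subst sum.shift_bounds_cl_Suc_ivl) simp
  finally show ?thesis .
qed

section \<open>The noise coordinates as independent Brownian motions\<close>

lemma mesh_pos: "2 \<le> n \<Longrightarrow> 0 < mesh n"
  by (simp add: mesh_def)

lemma grid_point_in_interval: "2 \<le> n \<Longrightarrow> k \<le> n \<Longrightarrow> real k * mesh n \<in> {0..pi}"
  by (auto simp: mesh_def field_simps)

text \<open>The sheet is Gaussian through linear combinations of its values at finitely many points,
  here {r, t} times the grid. The covariance factors: time contributes t - 2r + r = t - r, space the
  sum of squares.\<close>

lemma noise_combination_gaussian:
  assumes W: "brownian_sheet M F T pi W" and n: "2 \<le> n" and r: "0 \<le> r" "r < t" "t \<le> T"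
  shows "centered_gaussian M (\<lambda>\<omega>. \<Sum>i\<in>{1..n - 1}. \<xi> i * (noise n W i t \<omega> - noise n W i r \<omega>))
    ((t - r) * (\<Sum>i\<in>{1..n - 1}. (\<xi> i)\<^sup>2))"
proof -
  define c where "c = sqrt (real n / pi)"
  define f where "f k = real k * mesh n" for k :: nat
  define E where "E = sheet_coeff n \<xi>"
  define s where "s \<tau> = (if \<tau> = t then 1 else - 1 :: real)" for \<tau>
  \<comment> \<open>Coefficients belong to points of the interval rather than to indices, hence the
    inverse of the injective grid map.\<close>
  define e where "e x = c * E (the_inv_into {1..n} f x)" for x
  define J where "J = {r, t} \<times> f ` {1..n}"
  have inj: "inj_on f {1..n}" using mesh_pos[OF n] by (auto simp: inj_on_def f_def)
  have ef: "e (f k) = c * E k" if "k \<in> {1..n}" for k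
    unfolding e_def using the_inv_into_f_f[OF inj that] by simp
  have J: "finite J" "J \<subseteq> {0..T} \<times> {0..pi}"
    using r grid_point_in_interval[OF n] by (auto simp: J_def f_def)
  have sumJ: "(\<Sum>(\<tau>, x)\<in>J. H \<tau> x) = (\<Sum>k\<in>{1..n}. H t (f k) + H r (f k))" for H :: "real \<Rightarrow> real \<Rightarrow> real"
  proof -
    have "(\<Sum>(\<tau>, x)\<in>J. H \<tau> x) = (\<Sum>\<tau>\<in>{r, t}. \<Sum>x\<in>f ` {1..n}. H \<tau> x)"
      unfolding J_def by (rule sum.cartesian_product[symmetric])
    also have "\<dots> = (\<Sum>x\<in>f ` {1..n}. H r x) + (\<Sum>x\<in>f ` {1..n}. H t x)" using r by simp
    also have "\<dots> = (\<Sum>k\<in>{1..n}. H t (f k) + H r (f k))"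
      using inj by (simp add: sum.reindex sum.distrib)
    finally show ?thesis .
  qed
  have cg: "centered_gaussian M (\<lambda>\<omega>. \<Sum>(\<tau>, x)\<in>J. (case (\<tau>, x) of (\<tau>, x) \<Rightarrow> s \<tau> * e x) * W \<tau> x \<omega>)
          (\<Sum>(\<tau>, x)\<in>J. \<Sum>(\<tau>', y)\<in>J. (case (\<tau>, x) of (\<tau>, x) \<Rightarrow> s \<tau> * e x) * (case (\<tau>', y) of (\<tau>, x) \<Rightarrow> s \<tau> * e x) * (min \<tau> \<tau>' * min x y))"
    using W J unfolding brownian_sheet_def by blast
  have st: "s t = 1" "s r = - 1" using r by (auto simp: s_def)
  have "(\<lambda>\<omega>. \<Sum>(\<tau>, x)\<in>J. (case (\<tau>, x) of (\<tau>, x) \<Rightarrow> s \<tau> * e x) * W \<tau> x \<omega>) =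
    (\<lambda>\<omega>. \<Sum>i\<in>{1..n - 1}. \<xi> i * (noise n W i t \<omega> - noise n W i r \<omega>))"
  proof
    fix \<omega>
    have "(\<Sum>(\<tau>, x)\<in>J. (case (\<tau>, x) of (\<tau>, x) \<Rightarrow> s \<tau> * e x) * W \<tau> x \<omega>) =
      (\<Sum>k\<in>{1..n}. E k * (c * (W t (f k) \<omega> - W r (f k) \<omega>)))"
      unfolding prod.case sumJ st by (intro sum.cong refl) (simp add: ef algebra_simps)
    also have "\<dots> = (\<Sum>i\<in>{1..n - 1}. \<xi> i * (c * (W t (f (Suc i)) \<omega> - W r (f (Suc i)) \<omega>) - c * (W t (f i) \<omega> - W r (f i) \<omega>)))"
      unfolding E_def by (rule sheet_coeff_sum[OF n])
    also have "\<dots> = (\<Sum>i\<in>{1..n - 1}. \<xi> i * (noise n W i t \<omega> - noise n W i r \<omega>))"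
      by (intro sum.cong refl) (simp add: noise_def c_def f_def algebra_simps)
    finally show "(\<Sum>(\<tau>, x)\<in>J. (case (\<tau>, x) of (\<tau>, x) \<Rightarrow> s \<tau> * e x) * W \<tau> x \<omega>) =
      (\<Sum>i\<in>{1..n - 1}. \<xi> i * (noise n W i t \<omega> - noise n W i r \<omega>))" .
  qed
  moreover have "(\<Sum>(\<tau>, x)\<in>J. \<Sum>(\<tau>', y)\<in>J. (case (\<tau>, x) of (\<tau>, x) \<Rightarrow> s \<tau> * e x) * (case (\<tau>', y) of (\<tau>, x) \<Rightarrow> s \<tau> * e x) * (min \<tau> \<tau>' * min x y))
    = (t - r) * (\<Sum>i\<in>{1..n - 1}. (\<xi> i)\<^sup>2)"
  proof -
    have mins: "min t t = t" "min t r = r" "min r t = r" "min r r = r" using r by auto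
    \<comment> \<open>The factor sqrt (n / pi) of the noise normalises the mesh width to 1.\<close>
    have c2: "c * c * mesh n = 1" using n by (simp add: c_def mesh_def)
    have mm: "min (f k) (f l) = real (min k l) * mesh n" for k l
      using mesh_pos[OF n] by (simp add: f_def min_mult_distrib_right of_nat_min)
    have "(\<Sum>(\<tau>, x)\<in>J. \<Sum>(\<tau>', y)\<in>J. (case (\<tau>, x) of (\<tau>, x) \<Rightarrow> s \<tau> * e x) * (case (\<tau>', y) of (\<tau>, x) \<Rightarrow> s \<tau> * e x) * (min \<tau> \<tau>' * min x y)) =
      (\<Sum>k\<in>{1..n}. \<Sum>l\<in>{1..n}. (t - r) * (e (f k) * e (f l) * min (f k) (f l)))"
      unfolding prod.case sumJ st mins sum.distrib[symmetric]
      by (intro sum.cong refl) (simp add: algebra_simps)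
    also have "\<dots> = (\<Sum>k\<in>{1..n}. \<Sum>l\<in>{1..n}. (t - r) * (E k * E l * real (min k l)))"
    proof (intro sum.cong refl)
      fix k l assume "k \<in> {1..n}" "l \<in> {1..n}"
      then have "e (f k) * e (f l) * min (f k) (f l) = (c * c * mesh n) * (E k * E l * real (min k l))"
        by (simp only: ef mm mult_ac)
      then show "(t - r) * (e (f k) * e (f l) * min (f k) (f l)) = (t - r) * (E k * E l * real (min k l))"
        unfolding c2 by simp
    qed
    also have "\<dots> = (t - r) * (\<Sum>i\<in>{1..n - 1}. (\<xi> i)\<^sup>2)"
      unfolding sum_distrib_left[symmetric] E_def sheet_coeff_min_sum[OF n] ..
    finally show ?thesis .
  qed
  ultimately show ?thesis using cg by simp
qed

context complete_filtered_prob_space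
begin

context
  fixes W :: "real \<Rightarrow> real \<Rightarrow> 'a \<Rightarrow> real" and n :: nat
  assumes W: "brownian_sheet M F T pi W" and n: "2 \<le> n"
begin

abbreviation "sheet_increments s t \<equiv>
  {(\<lambda>\<omega>. W t x \<omega> - W s x \<omega>) -` B \<inter> space M | x B. x \<in> {0..pi} \<and> B \<in> sets borel}"

lemma measurable_F_M: "t \<in> {0..T} \<Longrightarrow> f \<in> measurable (F t) N \<Longrightarrow> f \<in> measurable M N"
  using subalgebra_F measurable_from_subalg by blast

lemma noise_adapted:
  assumes "t \<in> {0..T}" "i \<in> {1..n - 1}"
  shows "noise n W i t \<in> borel_measurable (F t)"
proof -
  have "(real i + 1) * mesh n \<in> {0..pi}" "real i * mesh n \<in> {0..pi}"
    using grid_point_in_interval[OF n, of "Suc i"] grid_point_in_interval[OF n, of i] assms by (auto simp: add.commute)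
  then have [measurable]: "W t ((real i + 1) * mesh n) \<in> borel_measurable (F t)" "W t (real i * mesh n) \<in> borel_measurable (F t)"
    using W assms by (auto simp: brownian_sheet_def)
  show ?thesis unfolding noise_def[abs_def] by measurable
qed

text \<open>Independence from the past is known for the sigma-algebra generated by the sheet
  increments, so measurability with respect to \<open>M\<close> would not be enough.\<close>

lemma noise_increment_measurable:
  assumes "0 \<le> s" "s \<le> t" "t \<le> T" "i \<in> {1..n - 1}"
  shows "(\<lambda>\<omega>. noise n W i t \<omega> - noise n W i s \<omega>) \<in> borel_measurable (sigma (space M) (sheet_increments s t))"
proof -
  let ?S = "sigma (space M) (sheet_increments s t)"
  have gen: "(\<lambda>\<omega>. W t x \<omega> - W s x \<omega>) \<in> borel_measurable ?S" if x: "x \<in> {0..pi}" for x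
  proof (rule measurableI)
    fix B :: "real set" assume B: "B \<in> sets borel"
    have sub: "sheet_increments s t \<subseteq> Pow (space M)" by auto
    have "(\<lambda>\<omega>. W t x \<omega> - W s x \<omega>) -` B \<inter> space M \<in> sigma_sets (space M) (sheet_increments s t)"
      using x B by (intro sigma_sets.Basic) blast
    then show "(\<lambda>\<omega>. W t x \<omega> - W s x \<omega>) -` B \<inter> space ?S \<in> sets ?S"
      unfolding space_measure_of_conv sets_measure_of[OF sub] .
  qed simp
  have pts: "(real i + 1) * mesh n \<in> {0..pi}" "real i * mesh n \<in> {0..pi}"
    using grid_point_in_interval[OF n, of "Suc i"] grid_point_in_interval[OF n, of i] assms by (auto simp: add.commute)
  have eq: "(\<lambda>\<omega>. noise n W i t \<omega> - noise n W i s \<omega>) = (\<lambda>\<omega>. sqrt (real n / pi) *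
    ((W t ((real i + 1) * mesh n) \<omega> - W s ((real i + 1) * mesh n) \<omega>) - (W t (real i * mesh n) \<omega> - W s (real i * mesh n) \<omega>)))"
    by (simp add: noise_def fun_eq_iff algebra_simps)
  show ?thesis
    unfolding eq by (intro borel_measurable_times borel_measurable_diff borel_measurable_const gen pts)
qed

lemma increments_independent:
  assumes s: "0 \<le> s" "s \<le> t" "t \<le> T" and A: "A \<in> sets (F s)"
    and X: "X \<in> measurable (sigma (space M) (sheet_increments s t)) N" and E: "E \<in> sets N"
  shows "prob (A \<inter> (X -` E \<inter> space M)) = prob A * prob (X -` E \<inter> space M)"
proof -
  have ind: "indep_set (sets (F s)) (sigma_sets (space M) (sheet_increments s t))"
    using W s unfolding brownian_sheet_def by blast
  have sub: "sheet_increments s t \<subseteq> Pow (space M)" by auto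
  have "X -` E \<inter> space M \<in> sigma_sets (space M) (sheet_increments s t)"
    using measurable_sets[OF X E] unfolding space_measure_of_conv sets_measure_of[OF sub] .
  then show ?thesis using indep_setD[OF ind A] by simp
qed

lemma increment_gaussian:
  assumes r: "0 \<le> r" "r < t" "t \<le> T" and i: "i \<in> {1..n - 1}"
  shows "centered_gaussian M (\<lambda>\<omega>. noise n W i t \<omega> - noise n W i r \<omega>) (t - r)"
proof -
  have "(\<Sum>k\<in>{1..n - 1}. (if k = i then 1 else 0) * w k) = w i"
    "(\<Sum>k\<in>{1..n - 1}. (if k = i then 1 else 0 :: real)\<^sup>2) = 1" for w :: "nat \<Rightarrow> real"
    using i by (simp_all add: if_distrib[of "\<lambda>x. x * _"] if_distrib[of "\<lambda>x. x\<^sup>2"] cong: if_cong)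
  then show ?thesis
    using noise_combination_gaussian[OF W n r, of "\<lambda>k. if k = i then 1 else 0"] by simp
qed

lemma increment_moments:
  assumes r: "0 \<le> r" "r \<le> t" "t \<le> T" and i: "i \<in> {1..n - 1}"
  shows "integrable M (\<lambda>\<omega>. (noise n W i t \<omega> - noise n W i r \<omega>)\<^sup>2)"
    "(LINT \<omega>|M. noise n W i t \<omega> - noise n W i r \<omega>) = 0"
    "(LINT \<omega>|M. (noise n W i t \<omega> - noise n W i r \<omega>)\<^sup>2) = t - r"
proof -
  have "integrable M (\<lambda>\<omega>. (noise n W i t \<omega> - noise n W i r \<omega>)\<^sup>2) \<and>
    (LINT \<omega>|M. noise n W i t \<omega> - noise n W i r \<omega>) = 0 \<and>
    (LINT \<omega>|M. (noise n W i t \<omega> - noise n W i r \<omega>)\<^sup>2) = t - r"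
  proof (cases "r = t")
    case False
    then have "r < t" using r by simp
    from centered_gaussian_moments[OF increment_gaussian[OF r(1) this r(3) i]] this show ?thesis by simp
  qed simp
  then show "integrable M (\<lambda>\<omega>. (noise n W i t \<omega> - noise n W i r \<omega>)\<^sup>2)"
    "(LINT \<omega>|M. noise n W i t \<omega> - noise n W i r \<omega>) = 0"
    "(LINT \<omega>|M. (noise n W i t \<omega> - noise n W i r \<omega>)\<^sup>2) = t - r" by auto
qed

lemma noise_brownian:
  assumes i: "i \<in> {1..n - 1}"
  shows "adapted_brownian_motion M F T (noise n W i)"
proof
  fix s t assume st: "0 \<le> s" "s \<le> t" "t \<le> T"
  fix Y :: "'a \<Rightarrow> real" assume Y: "Y \<in> borel_measurable (F s)"
  have sT: "s \<in> {0..T}" "t \<in> {0..T}" using st by auto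
  let ?D = "\<lambda>\<omega>. noise n W i t \<omega> - noise n W i s \<omega>"
  have D: "?D \<in> borel_measurable M"
    using measurable_F_M[OF sT(1) noise_adapted[OF sT(1) i]] measurable_F_M[OF sT(2) noise_adapted[OF sT(2) i]]
    by (intro borel_measurable_diff)
  have YM: "Y \<in> borel_measurable M" using sT(1) Y by (rule measurable_F_M)
  have sp: "space (F s) = space M" using subalgebra_F[OF sT(1)] by (simp add: subalgebra_def)
  show "indep_var borel Y borel ?D"
    unfolding indep_var_eq
  proof (intro conjI YM D indep_set_sigma_sets)
    show "indep_set {Y -` A \<inter> space M |A. A \<in> sets borel} {?D -` A \<inter> space M |A. A \<in> sets borel}"
    proof (rule indep_setI)
      show "{Y -` A \<inter> space M |A. A \<in> sets borel} \<subseteq> events" "{?D -` A \<inter> space M |A. A \<in> sets borel} \<subseteq> events"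
        using measurable_sets[OF YM] measurable_sets[OF D] by auto
      fix a b assume "a \<in> {Y -` A \<inter> space M |A. A \<in> sets borel}" "b \<in> {?D -` A \<inter> space M |A. A \<in> sets borel}"
      then obtain A E where a: "a = Y -` A \<inter> space M" "A \<in> sets borel" and b: "b = ?D -` E \<inter> space M" "E \<in> sets borel"
        by auto
      have "a \<in> sets (F s)" using measurable_sets[OF Y a(2)] by (simp add: a(1) sp)
      then show "prob (a \<inter> b) = prob a * prob b"
        unfolding b(1) by (intro increments_independent[OF st _ noise_increment_measurable[OF st i] b(2)])
    qed
    show "Int_stable {Y -` A \<inter> space M |A. A \<in> sets borel}" "Int_stable {?D -` A \<inter> space M |A. A \<in> sets borel}"
      by (rule Int_stable_vimages)+
  qed
next
  fix t assume "t \<in> {0..T}"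
  then show "subalgebra M (F t)" "noise n W i t \<in> borel_measurable (F t)"
    using i by (auto intro: subalgebra_F noise_adapted)
next
  fix s t assume st: "0 \<le> s" "s \<le> t" "t \<le> T"
  then show "sets (F s) \<subseteq> sets (F t)" by (rule F_mono)
  from increment_moments[OF st i]
  show "integrable M (\<lambda>\<omega>. (noise n W i t \<omega> - noise n W i s \<omega>)\<^sup>2)"
    "(LINT \<omega>|M. noise n W i t \<omega> - noise n W i s \<omega>) = 0"
    "(LINT \<omega>|M. (noise n W i t \<omega> - noise n W i s \<omega>)\<^sup>2) = t - s" by auto
qed

text \<open>Independence from the past is that of the sheet increments. The joint law, including
  independence between coordinates, comes from the characteristic function: the combination with
  coefficients \<open>\<xi> i / sqrt (t - r)\<close> has variance the sum of the
  \<open>(\<xi> i)\<^sup>2\<close>.\<close>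

lemma noise_increments_law:
  assumes r: "0 \<le> r" "r < t" "t \<le> T" and A: "A \<in> sets (F r)" and E: "E \<in> sets (\<Pi>\<^sub>M i\<in>{1..n - 1}. borel)"
  shows "emeasure M {\<omega>\<in>A. (\<lambda>i\<in>{1..n - 1}. (noise n W i t \<omega> - noise n W i r \<omega>) / sqrt (t - r)) \<in> E} =
    emeasure M A * emeasure (std_gauss {1..n - 1}) E"
proof -
  let ?I = "{1..n - 1}"
  let ?D = "\<lambda>i \<omega>. (noise n W i t \<omega> - noise n W i r \<omega>) / sqrt (t - r)"
  let ?X = "\<lambda>\<omega>. \<lambda>i\<in>?I. ?D i \<omega>"
  have le: "r \<le> t" and rT: "r \<in> {0..T}" "t \<in> {0..T}" using r by auto
  have h: "0 < sqrt (t - r)" using r by simp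
  have Dm: "?D i \<in> borel_measurable (sigma (space M) (sheet_increments r t))" if "i \<in> ?I" for i
    using noise_increment_measurable[OF r(1) le r(3) that] by (intro borel_measurable_divide borel_measurable_const)
  have DM: "?D i \<in> borel_measurable M" if "i \<in> ?I" for i
    using measurable_F_M[OF rT(1) noise_adapted[OF rT(1) that]] measurable_F_M[OF rT(2) noise_adapted[OF rT(2) that]]
    by (intro borel_measurable_divide borel_measurable_diff borel_measurable_const)
  have law: "distr M (\<Pi>\<^sub>M i\<in>?I. borel) ?X = std_gauss ?I"
  proof (rule distr_std_gauss_from_char)
    fix \<xi> :: "nat \<Rightarrow> real"
    have "(\<Sum>i\<in>?I. \<xi> i * ?D i \<omega>) = (\<Sum>i\<in>?I. (\<xi> i / sqrt (t - r)) * (noise n W i t \<omega> - noise n W i r \<omega>))" for \<omega>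
      by simp
    moreover have "(t - r) * (\<Sum>i\<in>?I. (\<xi> i / sqrt (t - r))\<^sup>2) = (\<Sum>i\<in>?I. (\<xi> i)\<^sup>2)"
      using r by (simp add: power_divide sum_divide_distrib[symmetric])
    ultimately show "(CLINT \<omega>|M. iexp (\<Sum>i\<in>?I. \<xi> i * ?D i \<omega>)) = complex_of_real (exp (- (\<Sum>i\<in>?I. (\<xi> i)\<^sup>2) / 2))"
      using centered_gaussian_char(2)[OF noise_combination_gaussian[OF W n r, of "\<lambda>i. \<xi> i / sqrt (t - r)"]] by (simp only:)
  qed (use DM in auto)
  have XM: "?X \<in> measurable M (\<Pi>\<^sub>M i\<in>?I. borel)" using DM by (intro measurable_restrict) auto
  have X: "?X \<in> measurable (sigma (space M) (sheet_increments r t)) (\<Pi>\<^sub>M i\<in>?I. borel)"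
    using Dm by (intro measurable_restrict) auto
  have AM: "A \<subseteq> space M" using subalgebra_F[OF rT(1)] sets.sets_into_space[OF A] by (auto simp: subalgebra_def)
  have "emeasure M {\<omega>\<in>A. ?X \<omega> \<in> E} = emeasure M (A \<inter> (?X -` E \<inter> space M))"
    using AM by (intro arg_cong[where f = "emeasure M"]) auto
  also have "\<dots> = emeasure M A * emeasure M (?X -` E \<inter> space M)"
    using increments_independent[OF r(1) le r(3) A X E] by (simp add: emeasure_eq_measure ennreal_mult)
  also have "emeasure M (?X -` E \<inter> space M) = emeasure (std_gauss ?I) E"
    unfolding law[symmetric] using emeasure_distr[OF XM E] by simp
  finally show ?thesis .
qed

end

end

text \<open>An integral is specified only through approximation, so the off-diagonal integrals of a
  diagonal equation must be shown to vanish. Compare with the zero variable, itself such an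
  integral, over the degenerate interval from t to t: the energy is 0 and \<open>d\<close> is
  arbitrary.\<close>

lemma (in adapted_brownian_motion) ito_integral_zero:
  assumes Y: "has_ito_integral M F B t (\<lambda>s \<omega>. 0) Y" and t: "t \<in> {0..T}"
  shows "AE \<omega> in M. Y \<omega> = 0"
proof -
  have Z: "has_ito_integral M F B t (\<lambda>s \<omega>. 0) (\<lambda>\<omega>. 0)"
    unfolding has_ito_integral_def
  proof (intro conjI)
    show "progressively_measurable F t (\<lambda>s \<omega>. 0)" by (simp add: progressively_measurable_def)
    let ?p = "\<lambda>i::nat. if i = 0 then 0 else t"
    have "simple_integrand F t 1 ?p (\<lambda>_ _. 0)"
      using t by (auto simp: simple_integrand_def intro!: mono_onI exI[of _ 0])
    moreover have "simple_process 1 ?p (\<lambda>_ _. 0) s \<omega> = 0" "simple_ito B 1 ?p (\<lambda>_ _. 0) \<omega> = 0" for s and \<omega> :: 'a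
      by (simp_all add: simple_process_def simple_ito_def)
    ultimately show "\<exists>m p \<xi>. (\<forall>k. simple_integrand F t (m k) (p k) (\<xi> k)) \<and>
        tendsto_zero_in_prob M (\<lambda>k \<omega>. \<integral>\<^sup>+s\<in>{0..t}. ennreal ((simple_process (m k) (p k) (\<xi> k) s \<omega> - 0)\<^sup>2) \<partial>lborel) \<and>
        tendsto_zero_in_prob M (\<lambda>k \<omega>. ennreal \<bar>simple_ito B (m k) (p k) (\<xi> k) \<omega> - 0\<bar>)"
      by (intro exI[of _ "\<lambda>_. 1"] exI[of _ "\<lambda>_. ?p"] exI[of _ "\<lambda>_ _ _. 0"]) (simp add: tendsto_zero_in_prob_def)
  qed auto
  have [measurable]: "Y \<in> borel_measurable M" using Y by (simp add: has_ito_integral_def)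
  have small: "measure M {\<omega>\<in>space M. e < \<bar>Y \<omega>\<bar>} = 0" if e: "0 < e" for e
  proof -
    have "measure M {\<omega>\<in>space M. e < \<bar>Y \<omega>\<bar>} \<le> 16 * d / e\<^sup>2" if "0 < d" for d
      using ito_difference_bound[OF Y Z, where \<eta> = "\<lambda>_. 0" and C = 0 and A = "space M" and e = e and d = d] t e that by simp
    from this[of "_ * e\<^sup>2 / 16"] have "measure M {\<omega>\<in>space M. e < \<bar>Y \<omega>\<bar>} \<le> 0 + d" if "0 < d" for d
      using that e by simp
    then have "measure M {\<omega>\<in>space M. e < \<bar>Y \<omega>\<bar>} \<le> 0" by (rule field_le_epsilon)
    then show ?thesis by (simp add: measure_le_0_iff)
  qed
  have "AE \<omega> in M. \<forall>k::nat. \<bar>Y \<omega>\<bar> \<le> 1 / real (Suc k)"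
    unfolding AE_all_countable
  proof
    fix k :: nat
    have "{\<omega>\<in>space M. 1 / real (Suc k) < \<bar>Y \<omega>\<bar>} \<in> null_sets M"
      using small[of "1 / real (Suc k)"] by (auto simp: null_sets_def emeasure_eq_measure)
    from AE_not_in[OF this] AE_space show "AE \<omega> in M. \<bar>Y \<omega>\<bar> \<le> 1 / real (Suc k)"
      by eventually_elim auto
  qed
  then show ?thesis
  proof eventually_elim
    case (elim \<omega>)
    show ?case
    proof (rule ccontr)
      assume "Y \<omega> \<noteq> 0"
      then have "0 < \<bar>Y \<omega>\<bar>" by simp
      then obtain k where "inverse (real (Suc k)) < \<bar>Y \<omega>\<bar>" using reals_Archimedean by blast
      then show False using elim[rule_format, of k] by (simp add: inverse_eq_divide)
    qed
  qed
qed

section \<open>The finite difference scheme\<close>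

lemma mat_vec_bound:
  assumes "\<And>j. j \<in> {1..d} \<Longrightarrow> \<bar>v j\<bar> \<le> C"
  shows "\<bar>mat_vec d A v i\<bar> \<le> (\<Sum>j\<in>{1..d}. \<bar>A i j\<bar> * C)"
proof -
  have "\<bar>mat_vec d A v i\<bar> \<le> (\<Sum>j\<in>{1..d}. \<bar>A i j * v j\<bar>)"
    unfolding mat_vec_def by (rule sum_abs)
  also have "\<dots> \<le> (\<Sum>j\<in>{1..d}. \<bar>A i j\<bar> * C)"
    using assms by (intro sum_mono) (auto simp: abs_mult intro!: mult_left_mono)
  finally show ?thesis .
qed

lemma drift_locally_bounded:
  "\<exists>C\<ge>0. \<forall>u. (\<forall>i\<in>{1..n - 1}. \<bar>u i\<bar> \<le> R) \<longrightarrow> (\<forall>i\<in>{1..n - 1}. \<bar>drift n u i\<bar> \<le> C)"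
proof -
  define c where "c i = (\<Sum>j\<in>{1..n - 1}. \<bar>mat_mult (n - 1) (A_mat n) (A_mat n) i j\<bar> * \<bar>R\<bar>) +
    (\<Sum>j\<in>{1..n - 1}. \<bar>A_mat n i j\<bar> * (\<bar>R\<bar> ^ 3 + \<bar>R\<bar>))" for i
  have c0: "0 \<le> c i" for i unfolding c_def by (intro add_nonneg_nonneg sum_nonneg) auto
  show ?thesis
  proof (intro exI[of _ "\<Sum>i\<in>{1..n - 1}. c i"] conjI allI impI ballI)
    show "0 \<le> (\<Sum>i\<in>{1..n - 1}. c i)" using c0 by (rule sum_nonneg)
    fix u i assume u: "\<forall>i\<in>{1..n - 1}. \<bar>u i\<bar> \<le> R" and i: "i \<in> {1..n - 1}"
    have u': "\<bar>u j\<bar> \<le> \<bar>R\<bar>" if "j \<in> {1..n - 1}" for j using u that by fastforce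
    have f: "\<bar>F_vec u j\<bar> \<le> \<bar>R\<bar> ^ 3 + \<bar>R\<bar>" if "j \<in> {1..n - 1}" for j
    proof -
      have "\<bar>F_vec u j\<bar> \<le> \<bar>u j ^ 3\<bar> + \<bar>u j\<bar>" unfolding F_vec_def f_nl_def by (rule abs_triangle_ineq4)
      also have "\<dots> \<le> \<bar>R\<bar> ^ 3 + \<bar>R\<bar>"
        unfolding power_abs using u'[OF that] by (intro add_mono power_mono) auto
      finally show ?thesis .
    qed
    have "\<bar>drift n u i\<bar> \<le> \<bar>mat_vec (n - 1) (mat_mult (n - 1) (A_mat n) (A_mat n)) u i\<bar> + \<bar>mat_vec (n - 1) (A_mat n) (F_vec u) i\<bar>"
      unfolding drift_def by linarith
    also have "\<dots> \<le> c i" unfolding c_def using u' f by (intro add_mono mat_vec_bound)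
    also have "\<dots> \<le> (\<Sum>i\<in>{1..n - 1}. c i)" using i c0 by (intro member_le_sum) auto
    finally show "\<bar>drift n u i\<bar> \<le> (\<Sum>i\<in>{1..n - 1}. c i)" .
  qed
qed

lemma continuous_nonzero_bounded_below:
  fixes f :: "real \<Rightarrow> real"
  assumes f: "continuous_on UNIV f" and nz: "\<And>x. f x \<noteq> 0"
  shows "\<exists>c>0. \<forall>x. \<bar>x\<bar> \<le> R \<longrightarrow> c \<le> \<bar>f x\<bar>"
proof (cases "0 \<le> R")
  case True
  have "continuous_on {-R..R} (\<lambda>x. \<bar>f x\<bar>)" using f by (intro continuous_intros) (auto intro: continuous_on_subset)
  then obtain z where z: "\<forall>y\<in>{-R..R}. \<bar>f z\<bar> \<le> \<bar>f y\<bar>"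
    using continuous_attains_inf[of "{-R..R}" "\<lambda>x. \<bar>f x\<bar>"] True by auto
  have "\<bar>f z\<bar> \<le> \<bar>f x\<bar>" if "\<bar>x\<bar> \<le> R" for x
  proof -
    have "x \<in> {-R..R}" using that by auto
    with z show ?thesis by (rule bspec)
  qed
  then show ?thesis using nz[of z] by (intro exI[of _ "\<bar>f z\<bar>"]) simp
qed (auto intro: exI[of _ 1])

theorem theorem2p4:
  fixes M :: "'a measure" and F :: "real \<Rightarrow> 'a measure" and T :: real
    and W :: "real \<Rightarrow> real \<Rightarrow> 'a \<Rightarrow> real"
    and \<sigma> u\<^sub>0 :: "real \<Rightarrow> real" and n :: nat
    and U :: "real \<Rightarrow> 'a \<Rightarrow> nat \<Rightarrow> real"
  assumes "T > 0"
    and "complete_filtered_prob_space M F T"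
    and "brownian_sheet M F T pi W"
    and "bounded (range \<sigma>)"
    and "\<exists>L. L-lipschitz_on UNIV \<sigma>"
    and "continuous_on {0<..<pi} u\<^sub>0"
    and "n \<ge> 2"
    and "strong_solution M F T (n - 1) (drift n) (diffusion n \<sigma>) (noise n W)
           (\<lambda>i. u\<^sub>0 (real i * mesh n)) U"
    and "\<sigma> C1_differentiable_on UNIV"
    and "\<And>x. \<sigma> x \<noteq> 0"
  shows "\<forall>t\<in>{0<..T}.
    absolutely_continuous (\<Pi>\<^sub>M i\<in>{1..n - 1}. lborel)
      (distr M (\<Pi>\<^sub>M i\<in>{1..n - 1}. borel) (\<lambda>\<omega>. \<lambda>i\<in>{1..n - 1}. U t \<omega> i))"
proof -
  interpret complete_filtered_prob_space M F T by fact
  note W = \<open>brownian_sheet M F T pi W\<close> and n = \<open>n \<ge> 2\<close>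
  let ?I = "{1..n - 1}"
  define c where "c = sqrt (real n / pi)"
  \<comment> \<open>The factor sqrt (n / pi) joins the coefficient; the noise coordinates are
    already standard Brownian motions.\<close>
  define g where "g x = c * \<sigma> x" for x
  have c: "0 < c" using n by (simp add: c_def)
  obtain K0 where K0: "\<And>x. \<bar>\<sigma> x\<bar> \<le> K0" using \<open>bounded (range \<sigma>)\<close> by (auto simp: bounded_iff)
  obtain L0 where L0: "L0-lipschitz_on UNIV \<sigma>" using \<open>\<exists>L. L-lipschitz_on UNIV \<sigma>\<close> ..
  \<comment> \<open>Adding 1 makes both constants strictly positive; \<open>L0\<close> may be 0 when
    \<sigma> is constant.\<close>
  define K where "K = c * K0 + 1"
  define L where "L = c * L0 + 1"
  have K0': "0 \<le> K0" using K0[of 0] by linarith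
  have L0': "0 \<le> L0" using L0 by (rule lipschitz_on_nonneg)
  have sol: "\<forall>t\<in>{0..T}. \<forall>i\<in>?I. (\<lambda>\<omega>. U t \<omega> i) \<in> borel_measurable (F t)"
    "AE \<omega> in M. \<forall>i\<in>?I. continuous_on {0..T} (\<lambda>t. U t \<omega> i)"
    "AE \<omega> in M. \<forall>i\<in>?I. set_integrable lborel {0..T} (\<lambda>s. drift n (U s \<omega>) i)"
    and ex: "\<forall>t\<in>{0..T}. \<exists>J. (\<forall>i\<in>?I. \<forall>j\<in>?I. has_ito_integral M F (noise n W j) t (\<lambda>s \<omega>. diffusion n \<sigma> (U s \<omega>) i j) (J i j)) \<and>
        (AE \<omega> in M. \<forall>i\<in>?I. U t \<omega> i = u\<^sub>0 (real i * mesh n) + (LINT s:{0..t}|lborel. drift n (U s \<omega>) i) + (\<Sum>j\<in>?I. J i j \<omega>))"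
    using \<open>strong_solution M F T (n - 1) (drift n) (diffusion n \<sigma>) (noise n W) (\<lambda>i. u\<^sub>0 (real i * mesh n)) U\<close>
    unfolding strong_solution_def by blast+
  from bchoice[OF ex] obtain J where
    J: "\<And>t i j. t \<in> {0..T} \<Longrightarrow> i \<in> ?I \<Longrightarrow> j \<in> ?I \<Longrightarrow>
      has_ito_integral M F (noise n W j) t (\<lambda>s \<omega>. diffusion n \<sigma> (U s \<omega>) i j) (J t i j)"
    and U: "\<And>t. t \<in> {0..T} \<Longrightarrow> AE \<omega> in M. \<forall>i\<in>?I. U t \<omega> i = u\<^sub>0 (real i * mesh n) +
      (LINT s:{0..t}|lborel. drift n (U s \<omega>) i) + (\<Sum>j\<in>?I. J t i j \<omega>)"
    by blast
  \<comment> \<open>Off the diagonal the coefficient is identically 0, so each coordinate keeps only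
    the integral against its own noise.\<close>
  have off: "AE \<omega> in M. \<forall>i\<in>?I. \<forall>j\<in>?I. i \<noteq> j \<longrightarrow> J t i j \<omega> = 0" if t: "t \<in> {0..T}" for t
  proof (intro AE_finite_allI finite_atLeastAtMost)
    fix i j assume i: "i \<in> ?I" and j: "j \<in> ?I"
    show "AE \<omega> in M. i \<noteq> j \<longrightarrow> J t i j \<omega> = 0"
    proof (cases "i = j")
      case False
      interpret adapted_brownian_motion M F T "noise n W j" using W n j by (rule noise_brownian)
      have "has_ito_integral M F (noise n W j) t (\<lambda>s \<omega>. 0) (J t i j)"
        using J[OF t i j] False by (simp add: diffusion_def Sigma_mat_def)
      from ito_integral_zero[OF this t] show ?thesis by eventually_elim simp
    qed simp
  qed
  interpret diagonal_sde M F T ?I "noise n W" U "\<lambda>i t. J t i i" "drift n" "\<lambda>i. u\<^sub>0 (real i * mesh n)" g K L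
  proof (intro diagonal_sde.intro diagonal_sde_axioms.intro)
    show "prob_space M" by (rule prob_space_axioms)
    show "finite ?I" by simp
    show "subalgebra M (F t)" if "t \<in> {0..T}" for t using that by (rule subalgebra_F)
    show "sets (F s) \<subseteq> sets (F t)" if "0 \<le> s" "s \<le> t" "t \<le> T" for s t using that by (rule F_mono)
    show "adapted_brownian_motion M F T (noise n W i)" if "i \<in> ?I" for i using W n that by (rule noise_brownian)
    show "emeasure M {\<omega>\<in>A. (\<lambda>i\<in>?I. (noise n W i t \<omega> - noise n W i r \<omega>) / sqrt (t - r)) \<in> E} =
        emeasure M A * emeasure (std_gauss ?I) E"
      if "0 \<le> r" "r < t" "t \<le> T" "A \<in> sets (F r)" "E \<in> sets (\<Pi>\<^sub>M i\<in>?I. borel)" for r t A E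
      using W n that by (rule noise_increments_law)
    show "(\<lambda>\<omega>. U t \<omega> i) \<in> borel_measurable (F t)" if "t \<in> {0..T}" "i \<in> ?I" for t i
      using sol(1) that by blast
    show "AE \<omega> in M. \<forall>i\<in>?I. continuous_on {0..T} (\<lambda>t. U t \<omega> i)" by (rule sol(2))
    show "AE \<omega> in M. \<forall>i\<in>?I. set_integrable lborel {0..T} (\<lambda>s. drift n (U s \<omega>) i)" by (rule sol(3))
    show "AE \<omega> in M. \<forall>i\<in>?I. U t \<omega> i = u\<^sub>0 (real i * mesh n) + (LINT s:{0..t}|lborel. drift n (U s \<omega>) i) + J t i i \<omega>"
      if t: "t \<in> {0..T}" for t
      using U[OF t] off[OF t]
    proof eventually_elim
      case (elim \<omega>)
      have "(\<Sum>j\<in>?I. J t i j \<omega>) = J t i i \<omega>" if "i \<in> ?I" for i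
      proof -
        have "(\<Sum>j\<in>?I. J t i j \<omega>) = (\<Sum>j\<in>?I. if j = i then J t i i \<omega> else 0)"
          using elim(2) that by (intro sum.cong refl) auto
        then show ?thesis using that by simp
      qed
      then show ?case using elim(1) by simp
    qed
    show "has_ito_integral M F (noise n W i) t (\<lambda>s \<omega>. g (U s \<omega> i)) (J t i i)" if "t \<in> {0..T}" "i \<in> ?I" for t i
      using J[OF that that(2)] by (simp add: diffusion_def Sigma_mat_def g_def c_def)
    show "\<exists>C\<ge>0. \<forall>u. (\<forall>i\<in>?I. \<bar>u i\<bar> \<le> R) \<longrightarrow> (\<forall>i\<in>?I. \<bar>drift n u i\<bar> \<le> C)" for R
      by (rule drift_locally_bounded)
    show "\<bar>g x\<bar> \<le> K" for x
    proof -
      have "\<bar>g x\<bar> \<le> c * K0" unfolding g_def abs_mult using K0[of x] c by (simp add: mult_left_mono)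
      then show ?thesis by (simp add: K_def)
    qed
    show "\<bar>g x - g y\<bar> \<le> L * \<bar>x - y\<bar>" for x y
    proof -
      have "\<bar>\<sigma> x - \<sigma> y\<bar> \<le> L0 * \<bar>x - y\<bar>" using lipschitz_onD[OF L0, of x y] by (simp add: dist_real_def)
      then have "\<bar>g x - g y\<bar> \<le> c * (L0 * \<bar>x - y\<bar>)"
        unfolding g_def right_diff_distrib[symmetric] abs_mult using c by (simp add: mult_left_mono)
      also have "\<dots> \<le> L * \<bar>x - y\<bar>" by (simp add: L_def algebra_simps)
      finally show ?thesis .
    qed
    show "0 < K" "0 < L" using c K0' L0' by (auto simp: K_def L_def add_nonneg_pos)
    show "\<exists>c>0. \<forall>x. \<bar>x\<bar> \<le> R \<longrightarrow> c \<le> \<bar>g x\<bar>" for R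
    proof (rule continuous_nonzero_bounded_below)
      show "continuous_on UNIV g"
        unfolding g_def using lipschitz_on_continuous_on[OF L0] by (intro continuous_intros)
      show "g x \<noteq> 0" for x using c \<open>\<And>x. \<sigma> x \<noteq> 0\<close> by (simp add: g_def)
    qed
  qed
  show ?thesis using marginal_absolutely_continuous by blast
qed

end
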